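(* Let $\nu\ge0$, $0<\gamma\le2$ and $s>-\frac12$. Let $(\theta_n)$ be a sequence of weak solutions to the surface quasi-geostrophic equation (with viscosity $\nu$ and dissipation exponent $\gamma$), with $\theta_n\in L_t^2\dot H^s$, and suppose that $\theta_n$ converges weakly in $L_t^2\dot H^s$ to $f$. Then $f$ is also a weak solution to the surface quasi-geostrophic equation (with the same $\nu,\gamma$).
   Context: $\mathbb{T}^2=[-\pi,\pi]^2$ is the periodic torus; Fourier coefficients in $x$ are $\hat f(k)=\frac1{(2\pi)^2}\int_{\mathbb{T}^2}f(x)e^{-ix\cdot k}\,dx$. All functions are real-valued and have zero mean in $x$. For $s\ge0$, $\widehat{\Lambda^s f}(k)=|k|^s\hat f(k)$; for $s<0$ the formula is restricted to $k\ne0$. $\mathcal{R}_j=\partial_j\Lambda^{-1}$, $j=1,2$. $\|f\|_{\dot H^s}=\big(\sum_{0\ne k\in\mathbb{Z}^2}|k|^{2s}|\hat f(k)|^2\big)^{1/2}$, and $\dot H^s$ is the space of mean-zero distributions on $\mathbb{T}^2$ with finite norm. $L_t^2\dot H^s=L^2((0,\infty);\dot H^s(\mathbb{T}^2))$. $[\mathcal{R}_j,\phi]\theta=\mathcal{R}_j(\phi\theta)-\phi\,\mathcal{R}_j\theta$ and $[\mathcal{R}^\perp,\nabla\psi]\theta=-[\mathcal{R}_2,\partial_1\psi]\theta+[\mathcal{R}_1,\partial_2\psi]\theta$. The surface quasi-geostrophic (SQG) equation is $\partial_t\theta+u\cdot\nabla\theta=-\nu\Lambda^\gamma\theta$ on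 $\mathbb{T}^2\times(0,\infty)$, $u=\nabla^\perp\Lambda^{-1}\theta=(-\mathcal{R}_2\theta,\mathcal{R}_1\theta)$. A (time-dependent) weak solution is a $\theta\in L^2_{t,\mathrm{loc}}\dot H_x^{-1/2}$ such that for every test function $\psi\in C_c^\infty((0,\infty)\times\mathbb{T}^2)$ $$\langle\partial_t\theta,\psi\rangle+\frac12\big\langle\Lambda^{-\frac12}\theta,\Lambda^{\frac12}[\mathcal{R}^\perp,\nabla\psi]\theta\big\rangle+\nu\big\langle\Lambda^{-\frac12}\theta,\Lambda^{\gamma+\frac12}\psi\big\rangle=0,$$ where $\langle\cdot,\cdot\rangle$ is the $L^2$ inner product in $(t,x)$ and $\langle\partial_t\theta,\psi\rangle:=-\langle\theta,\partial_t\psi\rangle$ in the sense of distributions. *)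

theory Defs
  imports "HOL-Analysis.Analysis"
begin

section \<open>Smooth functions\<close>

definition pderiv_dir ::
  "'a::euclidean_space \<Rightarrow> ('a \<Rightarrow> 'b::real_normed_vector) \<Rightarrow> 'a \<Rightarrow> 'b" where
  "pderiv_dir e f = (\<lambda>x. frechet_derivative f (at x) e)"

primrec pderivs ::
  "'a::euclidean_space list \<Rightarrow> ('a \<Rightarrow> 'b::real_normed_vector) \<Rightarrow> 'a \<Rightarrow> 'b" where
  "pderivs [] f = f"
| "pderivs (e # es) f = pderiv_dir e (pderivs es f)"

definition smooth_fun :: "('a::euclidean_space \<Rightarrow> 'b::real_normed_vector) \<Rightarrow> bool" where
  "smooth_fun f \<longleftrightarrow> (\<forall>es\<in>lists Basis. \<forall>x. pderivs es f differentiable (at x))"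


section \<open>The torus, its test functions and its distributions\<close>

text \<open>Functions on the torus are functions on the plane that are \<open>2\<pi>\<close>-periodic in both
  coordinates; frequencies are pairs of integers.\<close>

type_synonym plane = "real \<times> real"
type_synonym freq = "int \<times> int"

definition vec_of :: "freq \<Rightarrow> plane" where
  "vec_of k = (real_of_int (fst k), real_of_int (snd k))"

definition torus :: "plane set" where
  "torus = cbox (- pi, - pi) (pi, pi)"

definition periodic2 :: "(plane \<Rightarrow> 'b) \<Rightarrow> bool" where
  "periodic2 g \<longleftrightarrow> (\<forall>k x. g (x + (2 * pi) *\<^sub>R vec_of k) = g x)"

definition torus_test :: "(plane \<Rightarrow> complex) set" where
  "torus_test = {g. smooth_fun g \<and> periodic2 g}"

definition wave :: "freq \<Rightarrow> plane \<Rightarrow> complex" where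
  "wave k x = cis (vec_of k \<bullet> x)"

text \<open>A distribution is a functional of which only the values on \<^term>\<open>torus_test\<close> matter.
  Continuity is expressed by a bound by finitely many of the seminorms
  \<open>sup \<bar>\<partial>\<^sup>\<alpha> g\<bar>\<close> defining the Frechet topology.\<close>

type_synonym distr = "(plane \<Rightarrow> complex) \<Rightarrow> complex"

definition distribution :: "distr \<Rightarrow> bool" where
  "distribution T \<longleftrightarrow>
     (\<forall>g\<in>torus_test. \<forall>h\<in>torus_test. T (\<lambda>x. g x + h x) = T g + T h) \<and>
     (\<forall>c. \<forall>g\<in>torus_test. T (\<lambda>x. c * g x) = c * T g) \<and>
     (\<exists>C N. \<forall>g\<in>torus_test. \<forall>B.
        (\<forall>es\<in>lists Basis. length es \<le> N \<longrightarrow> (\<forall>x. cmod (pderivs es g x) \<le> B))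
          \<longrightarrow> cmod (T g) \<le> C * B)"

definition real_valued :: "distr \<Rightarrow> bool" where
  "real_valued T \<longleftrightarrow> (\<forall>g\<in>torus_test. T (\<lambda>x. cnj (g x)) = cnj (T g))"

definition distr_of :: "(plane \<Rightarrow> complex) \<Rightarrow> distr" where
  "distr_of p = (\<lambda>g. LINT x:torus|lborel. p x * g x)"

definition fcoeff :: "distr \<Rightarrow> freq \<Rightarrow> complex" where
  "fcoeff T k = T (wave (- k)) / complex_of_real ((2 * pi)\<^sup>2)"


section \<open>Operators on distributions\<close>

text \<open>The distribution with Fourier series \<open>\<Sum>\<^sub>k m(k) T^(k) e\<^sup>i\<^sup>k\<^sup>x\<close>.  For \<open>m\<close> of polynomial
  growth the series, applied to a test function, converges absolutely.\<close>

definition fourier_mult :: "(freq \<Rightarrow> complex) \<Rightarrow> distr \<Rightarrow> distr" where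
  "fourier_mult m T = (\<lambda>g. \<Sum>\<^sub>\<infinity>k. m k * fcoeff T k * distr_of (wave k) g)"

text \<open>As \<^term>\<open>0 powr s = (0::real)\<close> for every \<open>s\<close>, the zero mode is dropped for negative
  \<open>s\<close> and annihilated for positive \<open>s\<close>; only \<open>s = 0\<close>, the identity, needs care.\<close>

definition Lam :: "real \<Rightarrow> distr \<Rightarrow> distr" where
  "Lam s = fourier_mult
     (\<lambda>k. complex_of_real (if s = 0 then 1 else norm (vec_of k) powr s))"

definition distr_deriv :: "plane \<Rightarrow> distr \<Rightarrow> distr" where
  "distr_deriv e T = (\<lambda>g. - T (pderiv_dir e g))"

definition distr_mult :: "(plane \<Rightarrow> complex) \<Rightarrow> distr \<Rightarrow> distr" where
  "distr_mult p T = (\<lambda>g. T (\<lambda>x. p x * g x))"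

definition e1 :: plane where "e1 = (1, 0)"
definition e2 :: plane where "e2 = (0, 1)"

definition riesz :: "plane \<Rightarrow> distr \<Rightarrow> distr" where
  "riesz e T = distr_deriv e (Lam (- 1) T)"

definition riesz_comm :: "plane \<Rightarrow> (plane \<Rightarrow> complex) \<Rightarrow> distr \<Rightarrow> distr" where
  "riesz_comm e p T = (\<lambda>g. riesz e (distr_mult p T) g - distr_mult p (riesz e T) g)"

definition riesz_perp_comm :: "(plane \<Rightarrow> complex) \<Rightarrow> distr \<Rightarrow> distr" where
  "riesz_perp_comm p T =
     (\<lambda>g. - riesz_comm e2 (pderiv_dir e1 p) T g + riesz_comm e1 (pderiv_dir e2 p) T g)"

text \<open>The \<open>L\<^sup>2\<close> inner product over the torus of two distributions with square summable
  Fourier coefficients, by Parseval; the factor is due to the normalisation of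
  \<^term>\<open>fcoeff\<close>.\<close>

definition L2_inner :: "distr \<Rightarrow> distr \<Rightarrow> complex" where
  "L2_inner S T = complex_of_real ((2 * pi)\<^sup>2) * (\<Sum>\<^sub>\<infinity>k. fcoeff S k * cnj (fcoeff T k))"


section \<open>Homogeneous Sobolev spaces and Bochner spaces over them\<close>

definition sobolev_space :: "real \<Rightarrow> distr set" where
  "sobolev_space s = {T. distribution T \<and> real_valued T \<and> fcoeff T 0 = 0 \<and>
     (\<lambda>k. norm (vec_of k) powr (2 * s) * (cmod (fcoeff T k))\<^sup>2) summable_on (- {0})}"

definition sobolev_norm :: "real \<Rightarrow> distr \<Rightarrow> real" where
  "sobolev_norm s T =
     sqrt (\<Sum>\<^sub>\<infinity>k\<in>- {0}. norm (vec_of k) powr (2 * s) * (cmod (fcoeff T k))\<^sup>2)"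

text \<open>Representatives of the elements of \<open>L\<^sup>2(I; H\<^sup>s)\<close>: strongly measurable, that is almost
  everywhere a limit of simple functions in the norm of \<open>H\<^sup>s\<close>, with square integrable norm.\<close>

definition L2_sobolev :: "real set \<Rightarrow> real \<Rightarrow> (real \<Rightarrow> distr) set" where
  "L2_sobolev I s = {u.
     (AE t in lebesgue_on I. u t \<in> sobolev_space s) \<and>
     (\<exists>F. (\<forall>n. simple_function (lebesgue_on I) (F n) \<and> F n ` I \<subseteq> sobolev_space s) \<and>
          (AE t in lebesgue_on I.
             (\<lambda>n::nat. sobolev_norm s (\<lambda>g. F n t g - u t g)) \<longlonglongrightarrow> 0)) \<and>
     integrable (lebesgue_on I) (\<lambda>t. (sobolev_norm s (u t))\<^sup>2)}"

definition L2_sobolev_norm :: "real set \<Rightarrow> real \<Rightarrow> (real \<Rightarrow> distr) \<Rightarrow> real" where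
  "L2_sobolev_norm I s u = sqrt (LINT t|lebesgue_on I. (sobolev_norm s (u t))\<^sup>2)"

definition L2_loc_sobolev :: "real \<Rightarrow> (real \<Rightarrow> distr) set" where
  "L2_loc_sobolev s = {u. \<forall>a b. 0 < a \<and> a < b \<longrightarrow> u \<in> L2_sobolev {a..b} s}"

text \<open>The functions being real-valued, these are real Hilbert spaces.  The bound makes a
  functional insensitive to changing its argument on a null set of times.\<close>

definition L2_sobolev_functional :: "real set \<Rightarrow> real \<Rightarrow> ((real \<Rightarrow> distr) \<Rightarrow> real) \<Rightarrow> bool" where
  "L2_sobolev_functional I s L \<longleftrightarrow>
     (\<forall>u\<in>L2_sobolev I s. \<forall>v\<in>L2_sobolev I s. L (\<lambda>t g. u t g + v t g) = L u + L v) \<and>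
     (\<forall>c. \<forall>u\<in>L2_sobolev I s. L (\<lambda>t g. complex_of_real c * u t g) = c * L u) \<and>
     (\<exists>C. \<forall>u\<in>L2_sobolev I s. \<bar>L u\<bar> \<le> C * L2_sobolev_norm I s u)"

definition weakly_converges ::
  "real set \<Rightarrow> real \<Rightarrow> (nat \<Rightarrow> real \<Rightarrow> distr) \<Rightarrow> (real \<Rightarrow> distr) \<Rightarrow> bool" where
  "weakly_converges I s u f \<longleftrightarrow>
     (\<forall>n. u n \<in> L2_sobolev I s) \<and> f \<in> L2_sobolev I s \<and>
     (\<forall>L. L2_sobolev_functional I s L \<longrightarrow> (\<lambda>n. L (u n)) \<longlonglongrightarrow> L f)"


section \<open>Weak solutions of the surface quasi-geostrophic equation\<close>

text \<open>A compactly supported smooth function on \<open>(0,\<infinity>)\<close> times the torus, extended by zero to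
  all times.\<close>

definition spacetime_test :: "(real \<times> plane \<Rightarrow> real) set" where
  "spacetime_test = {\<psi>. smooth_fun \<psi> \<and> (\<forall>t. periodic2 (\<lambda>x. \<psi> (t, x))) \<and>
     (\<exists>a b. 0 < a \<and> a < b \<and> (\<forall>t x. t \<notin> {a..b} \<longrightarrow> \<psi> (t, x) = 0))}"

definition slice :: "(real \<times> plane \<Rightarrow> real) \<Rightarrow> real \<Rightarrow> plane \<Rightarrow> complex" where
  "slice \<psi> t = (\<lambda>x. complex_of_real (\<psi> (t, x)))"

definition time_deriv :: "(real \<times> plane \<Rightarrow> real) \<Rightarrow> real \<times> plane \<Rightarrow> real" where
  "time_deriv \<psi> = pderiv_dir (1, 0) \<psi>"

text \<open>The first integral is the pairing of \<open>\<theta>\<close> with \<open>\<partial>\<^sub>t\<psi>\<close> in the sense of distributions.\<close>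

definition SQG_weak_solution :: "real \<Rightarrow> real \<Rightarrow> (real \<Rightarrow> distr) \<Rightarrow> bool" where
  "SQG_weak_solution \<nu> \<gamma> \<theta> \<longleftrightarrow> \<theta> \<in> L2_loc_sobolev (- 1/2) \<and>
     (\<forall>\<psi>\<in>spacetime_test.
        - (LINT t|lebesgue_on {0<..}. \<theta> t (slice (time_deriv \<psi>) t))
        + 1/2 * (LINT t|lebesgue_on {0<..}.
            L2_inner (Lam (- 1/2) (\<theta> t)) (Lam (1/2) (riesz_perp_comm (slice \<psi> t) (\<theta> t))))
        + complex_of_real \<nu> * (LINT t|lebesgue_on {0<..}.
            L2_inner (Lam (- 1/2) (\<theta> t)) (Lam (\<gamma> + 1/2) (distr_of (slice \<psi> t))))
        = 0)"

end

theory Submission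
  imports Defs
begin

text \<open>
  In Fourier variables the nonlinear term is a quadratic form with kernel
  \<open>cnj (\<psi>^(k - j)) (k \<times> j) (1/|k| - 1/|j|)\<close>, of size \<open>O(|k - j|\<^sup>2 |\<psi>^(k - j)| |k|\<^sup>-\<^sup>1\<^sup>/\<^sup>2 |j|\<^sup>-\<^sup>1\<^sup>/\<^sup>2)\<close>.
  Hence it is bounded on \<open>H\<^sup>-\<^sup>1\<^sup>/\<^sup>2\<close>, and on bounded sets of \<open>H\<^sup>s\<close>, \<open>s > -1/2\<close>, it is approximated
  uniformly by its restriction to finitely many modes.  A weakly convergent sequence is bounded;
  testing the equation with \<open>A(t) cos(k \<bullet> x)\<close> and \<open>A(t) sin(k \<bullet> x)\<close> then bounds the time derivative
  of each mode in the dual of the continuous functions, which makes products of two modes converge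
  to the product of the limits.  The linear terms are bounded functionals.
\<close>

section \<open>Smooth functions\<close>

text \<open>The obstacle is the quadratic term, since weak limits do not commute with products. In
  space, compactness comes from the strict inequality \<open>s > - 1/2\<close>: at high frequencies
  \<open>|k|^(-1/2)\<close> is small relative to \<open>|k|^s\<close>. In time there is less to work
  with. The nonlinear term, being quadratic, is only integrable in time, so the derivative of a mode
  is controlled by the supremum of the test function and by no weaker norm; this does not make the
  modes equicontinuous. Their primitives, however, are uniformly Hoelder continuous with exponent
  1/2 and converge uniformly as soon as they converge pointwise. A product of two modes is therefore
  treated by writing one factor as the derivative of a small primitive and moving that derivative to
  the other factor. Weak convergence is defined through bounded functionals and carries no norm
  bound; the bound is extracted by assembling a bad functional from the sequence itself. Working
  with coefficients alone is legitimate because a distribution is recovered on every test function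
  from its Fourier coefficients.\<close>

lemma pderiv_dir_eqI:
  assumes "(f has_derivative f') (at x)"
  shows "pderiv_dir e f x = f' e"
  using frechet_derivative_at[OF assms] by (simp add: pderiv_dir_def)

text \<open>Iterated partial derivatives of a member never leave a class closed under partial
  derivatives, so no formula for them has to be computed. The smoothness proofs below come down to
  choosing the class.\<close>

lemma smooth_fun_coinduct:
  assumes "f \<in> S"
    and "\<And>g x. g \<in> S \<Longrightarrow> g differentiable (at x)"
    and "\<And>g e. g \<in> S \<Longrightarrow> e \<in> Basis \<Longrightarrow> pderiv_dir e g \<in> S"
  shows "smooth_fun f"
proof -
  have "pderivs es f \<in> S" if "es \<in> lists Basis" for es
    using that by (induction es) (auto simp: assms)
  then show ?thesis
    unfolding smooth_fun_def using assms(2) by blast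
qed

lemma smooth_fun_differentiable:
  assumes "smooth_fun f"
  shows "f differentiable (at x)"
  using assms unfolding smooth_fun_def by (metis lists.Nil pderivs.simps(1))

lemma pderivs_append: "pderivs (es @ fs) f = pderivs es (pderivs fs f)"
  by (induction es) auto

lemma smooth_fun_pderiv_dir:
  assumes "smooth_fun f" "e \<in> Basis"
  shows "smooth_fun (pderiv_dir e f)"
  unfolding smooth_fun_def
proof (intro ballI allI)
  fix es :: "'a list" and x :: 'a
  assume "es \<in> lists Basis"
  then have "es @ [e] \<in> lists Basis"
    using assms by simp
  then have "pderivs (es @ [e]) f differentiable (at x)"
    using assms unfolding smooth_fun_def by blast
  then show "pderivs es (pderiv_dir e f) differentiable (at x)"
    by (simp add: pderivs_append)
qed

lemma smooth_fun_has_derivative: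
  assumes "smooth_fun f"
  shows "(f has_derivative (\<lambda>e. pderiv_dir e f x)) (at x)"
  using smooth_fun_differentiable[OF assms]
  by (simp add: pderiv_dir_def frechet_derivative_works[symmetric])

lemma smooth_fun_continuous_on:
  assumes "smooth_fun f"
  shows "continuous_on A f"
  using smooth_fun_differentiable[OF assms] differentiable_imp_continuous_within
    continuous_at_imp_continuous_on by blast

text \<open>The product rule yields a sum of two products; admitting finite sums of generators gives
  a class to which coinduction applies directly.\<close>

inductive sum_closure :: "('a \<Rightarrow> 'b::plus) set \<Rightarrow> ('a \<Rightarrow> 'b) \<Rightarrow> bool" for G where
  base: "g \<in> G \<Longrightarrow> sum_closure G g"
| add: "sum_closure G f \<Longrightarrow> sum_closure G g \<Longrightarrow> sum_closure G (\<lambda>x. f x + g x)"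

lemma pderiv_dir_add:
  assumes "\<And>x. f differentiable (at x)" "\<And>x. g differentiable (at x)"
  shows "pderiv_dir e (\<lambda>x. f x + g x) = (\<lambda>x. pderiv_dir e f x + pderiv_dir e g x)"
proof
  fix x
  have "((\<lambda>x. f x + g x) has_derivative
      (\<lambda>h. frechet_derivative f (at x) h + frechet_derivative g (at x) h)) (at x)"
    using assms[of x] by (intro has_derivative_add) (simp_all add: frechet_derivative_works[symmetric])
  then show "pderiv_dir e (\<lambda>x. f x + g x) x = pderiv_dir e f x + pderiv_dir e g x"
    by (subst pderiv_dir_eqI) (auto simp: pderiv_dir_def)
qed

lemma smooth_fun_sum_closure:
  fixes G :: "('a::euclidean_space \<Rightarrow> 'b::real_normed_vector) set"
  assumes "sum_closure G f"
    and diff: "\<And>g x. g \<in> G \<Longrightarrow> g differentiable (at x)"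
    and pd: "\<And>g e. g \<in> G \<Longrightarrow> e \<in> Basis \<Longrightarrow> sum_closure G (pderiv_dir e g)"
  shows "smooth_fun f"
proof (rule smooth_fun_coinduct[where S = "Collect (sum_closure G)"])
  show "f \<in> Collect (sum_closure G)" using assms by simp
  have d: "g differentiable (at x)" if "sum_closure G g" for g x
    using that by induction (auto intro: diff)
  then show "g differentiable (at x)" if "g \<in> Collect (sum_closure G)" for g x
    using that by simp
  have "sum_closure G (pderiv_dir e g)" if "sum_closure G g" "e \<in> Basis" for g e
    using that by induction (auto intro: pd sum_closure.add simp: pderiv_dir_add d)
  then show "pderiv_dir e g \<in> Collect (sum_closure G)"
    if "g \<in> Collect (sum_closure G)" "e \<in> Basis" for g e
    using that by simp
qed

section \<open>Sums, products, linear images and substitutions of smooth functions\<close>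

lemma smooth_fun_add:
  assumes "smooth_fun f" "smooth_fun g"
  shows "smooth_fun (\<lambda>x. f x + g x)"
proof (rule smooth_fun_sum_closure[where G = "Collect smooth_fun"])
  show "sum_closure (Collect smooth_fun) (\<lambda>x. f x + g x)"
    using assms by (intro sum_closure.intros) auto
qed (auto intro: smooth_fun_differentiable sum_closure.base smooth_fun_pderiv_dir)

lemma pderiv_dir_mult:
  fixes f g :: "'a::euclidean_space \<Rightarrow> 'b::real_normed_algebra"
  assumes "f differentiable (at x)" "g differentiable (at x)"
  shows "pderiv_dir e (\<lambda>x. f x * g x) x = f x * pderiv_dir e g x + pderiv_dir e f x * g x"
proof -
  have "((\<lambda>x. f x * g x) has_derivative
      (\<lambda>h. f x * frechet_derivative g (at x) h + frechet_derivative f (at x) h * g x)) (at x)"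
    using assms by (intro has_derivative_mult) (simp_all add: frechet_derivative_works[symmetric])
  then show ?thesis
    by (subst pderiv_dir_eqI) (auto simp: pderiv_dir_def)
qed

lemma smooth_fun_mult:
  fixes f g :: "'a::euclidean_space \<Rightarrow> 'b::real_normed_algebra"
  assumes "smooth_fun f" "smooth_fun g"
  shows "smooth_fun (\<lambda>x. f x * g x)"
proof -
  define G :: "('a \<Rightarrow> 'b) set" where
    "G = {\<lambda>x. u x * v x | u v. smooth_fun u \<and> smooth_fun v}"
  show ?thesis
  proof (rule smooth_fun_sum_closure[where G = G])
    show "sum_closure G (\<lambda>x. f x * g x)"
      using assms by (auto intro!: sum_closure.base simp: G_def)
    show "h differentiable (at x)" if "h \<in> G" for h x
      using that smooth_fun_differentiable by (auto simp: G_def intro!: differentiable_mult)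
    show "sum_closure G (pderiv_dir e h)" if h: "h \<in> G" and e: "e \<in> Basis" for h e
    proof -
      obtain u v where uv: "h = (\<lambda>x. u x * v x)" "smooth_fun u" "smooth_fun v"
        using h by (auto simp: G_def)
      have "pderiv_dir e h = (\<lambda>x. u x * pderiv_dir e v x + pderiv_dir e u x * v x)"
        using uv by (auto simp: pderiv_dir_mult smooth_fun_differentiable)
      moreover have "sum_closure G \<dots>"
        using uv(2,3) smooth_fun_pderiv_dir[OF uv(2) e] smooth_fun_pderiv_dir[OF uv(3) e]
        by (intro sum_closure.add; intro sum_closure.base) (unfold G_def, blast+)
      ultimately show ?thesis by simp
    qed
  qed
qed

lemma pderiv_dir_linear:
  assumes "bounded_linear L" "f differentiable (at x)"
  shows "pderiv_dir e (\<lambda>x. L (f x)) x = L (pderiv_dir e f x)"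
proof -
  have "((\<lambda>x. L (f x)) has_derivative (\<lambda>h. L (frechet_derivative f (at x) h))) (at x)"
    using assms by (intro bounded_linear.has_derivative[OF assms(1)]) (simp add: frechet_derivative_works[symmetric])
  then show ?thesis
    by (subst pderiv_dir_eqI) (auto simp: pderiv_dir_def)
qed

lemma smooth_fun_linear:
  assumes "bounded_linear L" "smooth_fun f"
  shows "smooth_fun (\<lambda>x. L (f x))"
proof (rule smooth_fun_coinduct[where S = "{\<lambda>x. L (f x) | f. smooth_fun f}"], goal_cases)
  case (2 g x)
  then show ?case
    using smooth_fun_differentiable bounded_linear.has_derivative[OF assms(1)]
    unfolding differentiable_def by blast
next
  case (3 g e)
  then obtain h where "g = (\<lambda>x. L (h x))" "smooth_fun h" by blast
  moreover from this have "pderiv_dir e g = (\<lambda>x. L (pderiv_dir e h x))"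
    using pderiv_dir_linear[OF assms(1)] smooth_fun_differentiable by fastforce
  ultimately show ?case
    using smooth_fun_pderiv_dir 3 by blast
qed (use assms in blast)

lemma smooth_fun_const: "smooth_fun (\<lambda>x. c)"
proof (rule smooth_fun_coinduct[where S = "range (\<lambda>c x. c)"], goal_cases)
  case (3 g e)
  then show ?case by (auto simp: pderiv_dir_def)
qed auto

lemma pderiv_dir_0:
  assumes "smooth_fun f"
  shows "pderiv_dir 0 f x = 0"
  using has_derivative_bounded_linear[OF smooth_fun_has_derivative[OF assms]] linear_simps(3) by blast

lemma pderiv_dir_compose:
  assumes "smooth_fun f" "(L has_derivative L') (at x)"
  shows "((\<lambda>x. f (L x)) has_derivative (\<lambda>e. pderiv_dir (L' e) f (L x))) (at x)"
    and "pderiv_dir e (\<lambda>x. f (L x)) x = pderiv_dir (L' e) f (L x)"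
proof -
  show D: "((\<lambda>x. f (L x)) has_derivative (\<lambda>e. pderiv_dir (L' e) f (L x))) (at x)"
    by (rule has_derivative_compose[OF assms(2) smooth_fun_has_derivative[OF assms(1)]])
  show "pderiv_dir e (\<lambda>x. f (L x)) x = pderiv_dir (L' e) f (L x)"
    by (rule pderiv_dir_eqI[OF D])
qed

text \<open>As \<open>L\<close> has the same derivative everywhere and sends each basis vector to a
  basis vector or to 0, a partial derivative of the composite is a partial derivative of
  \<open>f\<close> composed with \<open>L\<close>, or 0. This covers the projections of a product
  and the slices at a fixed time.\<close>

lemma smooth_fun_compose_affine:
  fixes f :: "'b::euclidean_space \<Rightarrow> 'c::real_normed_vector" and L :: "'a::euclidean_space \<Rightarrow> 'b"
  assumes f: "smooth_fun f" and L: "\<And>x. (L has_derivative L') (at x)"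
    and B: "\<And>e. e \<in> Basis \<Longrightarrow> L' e = 0 \<or> L' e \<in> Basis"
  shows "smooth_fun (\<lambda>x. f (L x))"
proof (rule smooth_fun_coinduct[where S = "{\<lambda>x. f (L x) | f. smooth_fun f}"], goal_cases)
  case (2 g x)
  then show ?case
    using pderiv_dir_compose(1)[OF _ L] unfolding differentiable_def by blast
next
  case (3 g e)
  then obtain h where h: "g = (\<lambda>x. h (L x))" "smooth_fun h" by blast
  have eq: "pderiv_dir e g = (\<lambda>x. pderiv_dir (L' e) h (L x))"
    unfolding h(1) using pderiv_dir_compose(2)[OF h(2) L] by fast
  from B[OF 3(2)] show ?case
  proof
    assume "L' e = 0"
    then have "pderiv_dir e g = (\<lambda>x. 0)" using eq pderiv_dir_0[OF h(2)] by simp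
    then show ?thesis using smooth_fun_const by (intro CollectI exI[of _ "\<lambda>_. 0"]) auto
  next
    assume "L' e \<in> Basis"
    then show ?thesis using eq smooth_fun_pderiv_dir[OF h(2)] by blast
  qed
qed (use f in blast)

lemma smooth_fun_compose_fst:
  "smooth_fun f \<Longrightarrow> smooth_fun (\<lambda>x :: 'a::euclidean_space \<times> 'b::euclidean_space. f (fst x))"
  by (rule smooth_fun_compose_affine[OF _ has_derivative_fst[OF has_derivative_ident]])
    (auto simp: Basis_prod_def)

lemma smooth_fun_compose_snd:
  "smooth_fun f \<Longrightarrow> smooth_fun (\<lambda>x :: 'a::euclidean_space \<times> 'b::euclidean_space. f (snd x))"
  by (rule smooth_fun_compose_affine[OF _ has_derivative_snd[OF has_derivative_ident]])
    (auto simp: Basis_prod_def)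

lemma has_derivative_Pair_const: "(Pair t has_derivative Pair 0) (at x)"
  by (rule has_derivative_Pair[OF has_derivative_const has_derivative_ident])

lemma pderiv_dir_slice:
  fixes f :: "'a::euclidean_space \<times> 'b::euclidean_space \<Rightarrow> 'c::real_normed_vector"
  assumes "smooth_fun f"
  shows "pderiv_dir e (\<lambda>x. f (t, x)) = (\<lambda>x. pderiv_dir (0, e) f (t, x))"
    and "(\<lambda>x. f (t, x)) differentiable (at x)"
  using pderiv_dir_compose[OF assms has_derivative_Pair_const]
  unfolding differentiable_def by blast+

lemma smooth_fun_slice:
  fixes f :: "'a::euclidean_space \<times> 'b::euclidean_space \<Rightarrow> 'c::real_normed_vector"
  assumes "smooth_fun f"
  shows "smooth_fun (\<lambda>x. f (t, x))"
  by (rule smooth_fun_compose_affine[OF assms has_derivative_Pair_const]) (simp add: Basis_prod_def)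

lemma pderiv_dir_real:
  assumes "(f has_real_derivative f') (at x)"
  shows "pderiv_dir e f x = f' * e"
  using assms by (intro pderiv_dir_eqI) (simp add: has_field_derivative_def)

lemma smooth_fun_poly: "smooth_fun (poly (p :: real poly))"
proof (rule smooth_fun_coinduct[where S = "range poly"], goal_cases)
  case (2 g x)
  then show ?case
    using poly_DERIV real_differentiable_def by (metis rangeE)
next
  case (3 g e)
  then obtain p where "g = poly p" by blast
  then have "pderiv_dir e g = poly (pderiv p)"
    using pderiv_dir_real[OF poly_DERIV[of p]] 3 by (intro ext) simp
  then show ?case by blast
qed auto

subsection \<open>A bump function\<close>

definition flat_exp :: "real poly \<Rightarrow> real \<Rightarrow> real" where
  "flat_exp p t = (if t > 0 then poly p (1 / t) * exp (- (1 / t)) else 0)"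

lemma poly_times_exp_minus_tendsto_0:
  "((\<lambda>x::real. poly p x * exp (- x)) \<longlongrightarrow> 0) at_top"
proof -
  have "((\<lambda>x. \<Sum>i\<le>degree p. coeff p i * (x ^ i / exp x)) \<longlongrightarrow> (\<Sum>i\<le>degree p. coeff p i * 0)) at_top"
    by (intro tendsto_intros tendsto_power_div_exp_0)
  moreover have "(\<Sum>i\<le>degree p. coeff p i * (x ^ i / exp x)) = poly p x * exp (- x)" for x
    unfolding poly_altdef exp_minus inverse_eq_divide by (simp add: sum_divide_distrib)
  ultimately show ?thesis by simp
qed

text \<open>In the variable \<open>s = 1 / t\<close> differentiation is \<open>- s^2 d/ds\<close>,
  which sends \<open>p(s) exp(-s)\<close> to \<open>s^2 (p - p')(s) exp(-s)\<close>; the polynomial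
  \<open>[:0, 0, 1:]\<close> is \<open>s^2\<close>. Letting \<open>p\<close> vary is what closes the
  family under differentiation.\<close>

lemma flat_exp_has_derivative:
  "(flat_exp p has_real_derivative flat_exp ([:0, 0, 1:] * (p - pderiv p)) t) (at t)"
proof -
  consider "t < 0" | "t > 0" | "t = 0" by linarith
  then show ?thesis
  proof cases
    case 1
    have "((\<lambda>_. 0::real) has_real_derivative 0) (at t)" by simp
    then have "(flat_exp p has_real_derivative 0) (at t)"
      by (rule has_field_derivative_transform_within_open[where S = "{..<0}"])
        (use 1 in \<open>auto simp: flat_exp_def\<close>)
    then show ?thesis using 1 by (simp add: flat_exp_def)
  next
    case 2
    have i: "((\<lambda>t. 1 / t) has_real_derivative - (1 / t * (1 / t))) (at t)"
      using 2 by (auto intro!: derivative_eq_intros simp: field_simps)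
    have "((\<lambda>t. poly p (1 / t) * exp (- (1 / t))) has_real_derivative
        poly p (1 / t) * (exp (- (1 / t)) * (1 / t * (1 / t)))
        + poly (pderiv p) (1 / t) * - (1 / t * (1 / t)) * exp (- (1 / t))) (at t)"
      using DERIV_mult'[OF DERIV_chain2[OF poly_DERIV i, of p] DERIV_fun_exp[OF DERIV_minus[OF i]]]
      by simp
    also have "poly p (1 / t) * (exp (- (1 / t)) * (1 / t * (1 / t)))
        + poly (pderiv p) (1 / t) * - (1 / t * (1 / t)) * exp (- (1 / t))
        = flat_exp ([:0, 0, 1:] * (p - pderiv p)) t"
      using 2 by (simp add: flat_exp_def algebra_simps)
    finally have "((\<lambda>t. poly p (1 / t) * exp (- (1 / t))) has_real_derivative
        flat_exp ([:0, 0, 1:] * (p - pderiv p)) t) (at t)" .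
    then show ?thesis
      by (rule has_field_derivative_transform_within_open[where S = "{0<..}"])
        (use 2 in \<open>auto simp: flat_exp_def\<close>)
  next
    case 3
    \<comment> \<open>The difference quotient at 0 is \<open>s p(s) exp(-s)\<close> with
      \<open>s = 1 / t\<close>; this is the origin of the extra factor
      \<open>[:0, 1:]\<close>.\<close>
    have "((\<lambda>x. poly ([:0, 1:] * p) (inverse x) * exp (- (inverse x))) \<longlongrightarrow> 0) (at_right (0::real))"
      by (rule filterlim_compose[OF poly_times_exp_minus_tendsto_0 filterlim_inverse_at_top_right])
    then have "((\<lambda>y. flat_exp p y / y) \<longlongrightarrow> 0) (at_right 0)"
      by (rule Lim_transform_eventually)
        (auto simp: flat_exp_def eventually_at_filter field_simps)
    moreover have "((\<lambda>y. flat_exp p y / y) \<longlongrightarrow> 0) (at_left 0)"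
      by (rule Lim_transform_eventually[OF tendsto_const])
        (auto simp: flat_exp_def eventually_at_filter)
    ultimately have "((\<lambda>y. flat_exp p y / y) \<longlongrightarrow> 0) (at 0)"
      by (simp add: filterlim_split_at)
    then show ?thesis
      using 3 by (simp add: has_field_derivative_iff flat_exp_def)
  qed
qed

text \<open>The scalar \<open>C\<close> in the class absorbs the factor \<open>c\<close> that the
  chain rule produces at each differentiation.\<close>

lemma smooth_fun_flat_exp: "smooth_fun (\<lambda>t. flat_exp p (c * t + d))"
proof (rule smooth_fun_coinduct[where S = "{\<lambda>t. C * flat_exp p (c * t + d) | C p. True}"], goal_cases)
  have D: "((\<lambda>t. C * flat_exp p (c * t + d)) has_real_derivative
      (C * c) * flat_exp ([:0, 0, 1:] * (p - pderiv p)) (c * t + d)) (at t)" for C p t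
  proof -
    have "((\<lambda>t. c * t + d) has_real_derivative c) (at t)"
      by (auto intro!: derivative_eq_intros)
    from DERIV_cmult[OF DERIV_chain2[OF flat_exp_has_derivative this], of C p] show ?thesis
      by (simp add: mult_ac)
  qed
  {
    case 1
    show ?case by (intro CollectI exI[of _ 1] exI[of _ p]) auto
  next
    case (2 g x)
    then show ?case using D by (auto simp: real_differentiable_def)
  next
    case (3 g e)
    then obtain C p where "g = (\<lambda>t. C * flat_exp p (c * t + d))" by blast
    then have "pderiv_dir e g = (\<lambda>t. (C * c) * flat_exp ([:0, 0, 1:] * (p - pderiv p)) (c * t + d))"
      using pderiv_dir_real[OF D[of C p]] 3 by (intro ext) simp
    then show ?case by blast
  }
qed

text \<open>What matters later is positivity inside \<open>(a, b)\<close>: a continuous coefficient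
  supported in a smaller interval will be divided by the bump.\<close>

definition bump :: "real \<Rightarrow> real \<Rightarrow> real \<Rightarrow> real" where
  "bump a b t = flat_exp 1 (t - a) * flat_exp 1 (b - t)"

lemma smooth_fun_bump: "smooth_fun (bump a b)"
  using smooth_fun_mult[OF smooth_fun_flat_exp[of 1 1 "- a"] smooth_fun_flat_exp[of 1 "- 1" b]]
  by (simp add: bump_def[abs_def] algebra_simps)

lemma bump_pos: "a < t \<Longrightarrow> t < b \<Longrightarrow> bump a b t > 0"
  by (simp add: bump_def flat_exp_def)

lemma bump_eq_0: "t \<notin> {a..b} \<Longrightarrow> bump a b t = 0"
  by (auto simp: bump_def flat_exp_def)

section \<open>Fourier series of smooth functions on the torus\<close>

lemma vec_of_add: "vec_of (j + k) = vec_of j + vec_of k"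
  and vec_of_minus: "vec_of (- k) = - vec_of k"
  and vec_of_0 [simp]: "vec_of 0 = 0"
  by (simp_all add: vec_of_def zero_prod_def)

lemma vec_of_eq_0_iff [simp]: "vec_of k = 0 \<longleftrightarrow> k = 0"
  by (cases k) (simp add: vec_of_def zero_prod_def)

lemma wave_add: "wave (j + k) x = wave j x * wave k x"
  by (simp add: wave_def vec_of_add inner_left_distrib cis_mult)

lemma wave_0 [simp]: "wave 0 x = 1"
  by (simp add: wave_def)

lemma cnj_wave: "cnj (wave k x) = wave (- k) x"
  by (simp add: wave_def vec_of_minus cis_cnj)

lemma norm_wave [simp]: "cmod (wave k x) = 1"
  by (simp add: wave_def)

lemma wave_has_derivative:
  "(wave k has_derivative (\<lambda>e. \<i> * of_real (vec_of k \<bullet> e) * wave k x)) (at x)"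
proof -
  have "((\<lambda>x. exp (\<i> * of_real (vec_of k \<bullet> x))) has_derivative
      (\<lambda>e. \<i> * of_real (vec_of k \<bullet> e) * exp (\<i> * of_real (vec_of k \<bullet> x)))) (at x)"
  proof -
    have "((\<lambda>x. \<i> * of_real (vec_of k \<bullet> x)) has_derivative (\<lambda>e. \<i> * of_real (vec_of k \<bullet> e))) (at x)"
      by (auto intro!: derivative_eq_intros)
    from has_derivative_compose[OF this DERIV_exp[unfolded has_field_derivative_def]] show ?thesis
      by (simp add: mult_ac)
  qed
  then show ?thesis
    by (simp add: wave_def[abs_def] cis_conv_exp)
qed

lemma pderiv_dir_wave: "pderiv_dir e (wave k) = (\<lambda>x. \<i> * of_real (vec_of k \<bullet> e) * wave k x)"
  using pderiv_dir_eqI[OF wave_has_derivative] by fast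

lemma smooth_fun_wave: "smooth_fun (wave k)"
proof (rule smooth_fun_coinduct[where S = "{\<lambda>x. c * wave k x | c. True}"], goal_cases)
  have diff: "wave k differentiable (at x)" for x
    using wave_has_derivative unfolding differentiable_def by blast
  {
    case 1
    show ?case by (intro CollectI exI[of _ 1]) auto
  next
    case (2 g x)
    then show ?case using differentiable_mult[OF differentiable_const diff[of x]] by auto
  next
    case (3 g e)
    then obtain c where c: "g = (\<lambda>x. c * wave k x)" by blast
    have "pderiv_dir e g x = c * pderiv_dir e (wave k) x" for x
      unfolding c by (rule pderiv_dir_linear[OF bounded_linear_mult_right diff])
    then have "pderiv_dir e g = (\<lambda>x. (c * (\<i> * of_real (vec_of k \<bullet> e))) * wave k x)"
      by (auto simp: pderiv_dir_wave)
    then show ?case by blast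
  }
qed

lemma periodic2_wave: "periodic2 (wave k)"
proof -
  have "wave k (x + (2 * pi) *\<^sub>R vec_of m) = wave k x" for m x
  proof -
    have "vec_of k \<bullet> vec_of m = of_int (fst k * fst m + snd k * snd m)"
      by (simp add: vec_of_def)
    then have "cis (2 * pi * (vec_of k \<bullet> vec_of m)) = 1"
      by (intro cis_multiple_2pi) auto
    then show ?thesis
      by (simp add: wave_def inner_right_distrib flip: cis_mult)
  qed
  then show ?thesis by (simp add: periodic2_def)
qed

lemma torus_test_wave: "wave k \<in> torus_test"
  by (simp add: torus_test_def smooth_fun_wave periodic2_wave)

lemma torus_test_add: "g \<in> torus_test \<Longrightarrow> h \<in> torus_test \<Longrightarrow> (\<lambda>x. g x + h x) \<in> torus_test"
  by (auto simp: torus_test_def smooth_fun_add periodic2_def)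

lemma torus_test_mult: "g \<in> torus_test \<Longrightarrow> h \<in> torus_test \<Longrightarrow> (\<lambda>x. g x * h x) \<in> torus_test"
  by (auto simp: torus_test_def smooth_fun_mult periodic2_def)

lemma torus_test_const: "(\<lambda>x. c) \<in> torus_test"
  by (auto simp: torus_test_def smooth_fun_const periodic2_def)

lemma torus_test_cmult: "g \<in> torus_test \<Longrightarrow> (\<lambda>x. c * g x) \<in> torus_test"
  by (rule torus_test_mult[OF torus_test_const])

lemma torus_test_diff: "g \<in> torus_test \<Longrightarrow> h \<in> torus_test \<Longrightarrow> (\<lambda>x. g x - h x) \<in> torus_test"
  using torus_test_add[OF _ torus_test_cmult[of h "- 1"], of g] by simp

lemma torus_test_sum:
  "(\<And>i. i \<in> F \<Longrightarrow> g i \<in> torus_test) \<Longrightarrow> (\<lambda>x. \<Sum>i\<in>F. g i x) \<in> torus_test"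
  by (induction F rule: infinite_finite_induct) (auto intro: torus_test_const torus_test_add)

lemma pderiv_dir_shift:
  assumes "\<And>x. g (x + c) = g x" "smooth_fun g"
  shows "pderiv_dir e g (x + c) = pderiv_dir e g x"
proof -
  have "((\<lambda>x. g (x + c)) has_derivative (\<lambda>e. pderiv_dir e g (x + c))) (at x)"
    by (rule has_derivative_compose[OF _ smooth_fun_has_derivative[OF assms(2)]])
      (auto intro!: derivative_eq_intros)
  then show ?thesis
    using pderiv_dir_eqI[of g _ x e] assms(1) by simp
qed

lemma torus_test_pderiv_dir:
  "g \<in> torus_test \<Longrightarrow> e \<in> Basis \<Longrightarrow> pderiv_dir e g \<in> torus_test"
  unfolding torus_test_def periodic2_def
  by (auto intro: smooth_fun_pderiv_dir pderiv_dir_shift)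

lemma torus_test_pderivs:
  "g \<in> torus_test \<Longrightarrow> es \<in> lists Basis \<Longrightarrow> pderivs es g \<in> torus_test"
  by (induction es) (auto simp: torus_test_pderiv_dir)

lemma torus_test_continuous_on: "g \<in> torus_test \<Longrightarrow> continuous_on A g"
  by (simp add: torus_test_def smooth_fun_continuous_on)

lemma torus_test_differentiable: "g \<in> torus_test \<Longrightarrow> g differentiable (at x)"
  by (simp add: torus_test_def smooth_fun_differentiable)

section \<open>Integration over the torus\<close>

lemma torus_integrable: "continuous_on torus (g :: plane \<Rightarrow> 'a::banach) \<Longrightarrow> g integrable_on torus"
  unfolding torus_def by (rule integrable_continuous)

lemma set_integral_torus:
  fixes g :: "plane \<Rightarrow> complex"
  assumes "continuous_on torus g"
  shows "(LINT x:torus|lborel. g x) = integral torus g"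
  by (rule set_borel_integral_eq_integral(2))
    (use borel_integrable_compact[OF _ assms] in \<open>simp add: set_integrable_def torus_def\<close>)

lemma content_torus: "measure lborel torus = (2 * pi)\<^sup>2"
  by (simp add: torus_def content_Pair power2_eq_square)

lemma norm_integral_torus_le:
  fixes g :: "plane \<Rightarrow> complex"
  assumes "continuous_on torus g" "\<And>x. x \<in> torus \<Longrightarrow> cmod (g x) \<le> B"
  shows "cmod (integral torus g) \<le> B * (2 * pi)\<^sup>2"
proof -
  have "0 \<in> torus" by (simp add: torus_def zero_prod_def)
  then have "0 \<le> B" using assms(2) norm_ge_zero order_trans by blast
  then have "cmod (integral torus g) \<le> B * measure lborel torus"
    using assms torus_integrable[OF assms(1)] unfolding torus_def by (intro integrable_bound) auto
  then show ?thesis by (simp add: content_torus)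
qed

lemma plane_Basis: "(Basis :: plane set) = {e1, e2}"
  by (auto simp: Basis_prod_def e1_def e2_def)

lemma e1_e2_Basis [simp]: "e1 \<in> Basis" "e2 \<in> Basis"
  by (simp_all add: plane_Basis)

text \<open>The fundamental theorem of calculus in the variable of \<open>e\<close>, with equal end
  values by periodicity. Fubini must have that variable innermost, which costs a swap of the
  integrals when \<open>e = e1\<close>.\<close>

lemma integral_torus_pderiv_dir:
  assumes "g \<in> torus_test" "e \<in> Basis"
  shows "integral torus (pderiv_dir e g) = 0"
proof -
  have sm: "smooth_fun g" using assms by (simp add: torus_test_def)
  have per: "g (x + (2 * pi) *\<^sub>R vec_of k) = g x" for x k
    using assms unfolding torus_test_def periodic2_def by blast
  have c: "continuous_on torus (pderiv_dir e g)"
    using assms torus_test_pderiv_dir torus_test_continuous_on by blast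
  have lin: "pderiv_dir (r *\<^sub>R v) g x = r *\<^sub>R pderiv_dir v g x" for r v x
    using bounded_linear.linear[OF has_derivative_bounded_linear[OF smooth_fun_has_derivative[OF sm]]]
    by (rule linear_scale)
  consider "e = e1" | "e = e2" using assms(2) by (auto simp: plane_Basis)
  then show ?thesis
  proof cases
    case 1
    have D: "((\<lambda>x. g (x, y)) has_vector_derivative pderiv_dir e1 g (x, y)) (at x within A)" for x y A
    proof -
      have "((\<lambda>x. g (x, y)) has_derivative (\<lambda>d. pderiv_dir (d, 0) g (x, y))) (at x)"
        using has_derivative_compose[OF has_derivative_Pair[OF has_derivative_ident has_derivative_const]
            smooth_fun_has_derivative[OF sm, of "(x, y)"]] .
      moreover have "(d, 0) = d *\<^sub>R e1" for d by (simp add: e1_def)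
      ultimately show ?thesis
        by (simp add: has_vector_derivative_def lin has_derivative_at_withinI)
    qed
    have "(pi, y) = (- pi, y) + (2 * pi) *\<^sub>R vec_of (1, 0)" for y
      by (simp add: vec_of_def)
    then have "g (pi, y) = g (- pi, y)" for y
      using per by metis
    then have z: "((\<lambda>x. pderiv_dir e1 g (x, y)) has_integral 0) {- pi..pi}" for y
      using fundamental_theorem_of_calculus[OF _ D, of "- pi" pi y] by simp
    have "integral torus (pderiv_dir e g)
        = integral (cbox (- pi) pi) (\<lambda>x. integral (cbox (- pi) pi) (\<lambda>y. pderiv_dir e g (x, y)))"
      using c unfolding torus_def by (rule integral_prod_continuous)
    also have "\<dots> = integral (cbox (- pi) pi) (\<lambda>y. integral (cbox (- pi) pi) (\<lambda>x. pderiv_dir e g (x, y)))"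
      using c unfolding torus_def by (intro integral_swap_continuous) (simp add: case_prod_beta')
    also have "\<dots> = 0" using 1 integral_unique[OF z] by simp
    finally show ?thesis .
  next
    case 2
    have D: "((\<lambda>y. g (x, y)) has_vector_derivative pderiv_dir e2 g (x, y)) (at y within A)" for x y A
    proof -
      have "((\<lambda>y. g (x, y)) has_derivative (\<lambda>d. pderiv_dir (0, d) g (x, y))) (at y)"
        using has_derivative_compose[OF has_derivative_Pair[OF has_derivative_const has_derivative_ident]
            smooth_fun_has_derivative[OF sm, of "(x, y)"]] .
      moreover have "(0, d) = d *\<^sub>R e2" for d by (simp add: e2_def)
      ultimately show ?thesis
        by (simp add: has_vector_derivative_def lin has_derivative_at_withinI)
    qed
    have "(x, pi) = (x, - pi) + (2 * pi) *\<^sub>R vec_of (0, 1)" for x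
      by (simp add: vec_of_def)
    then have "g (x, pi) = g (x, - pi)" for x
      using per by metis
    then have z: "((\<lambda>y. pderiv_dir e2 g (x, y)) has_integral 0) {- pi..pi}" for x
      using fundamental_theorem_of_calculus[OF _ D, of "- pi" pi x] by simp
    have "integral torus (pderiv_dir e g)
        = integral (cbox (- pi) pi) (\<lambda>x. integral (cbox (- pi) pi) (\<lambda>y. pderiv_dir e g (x, y)))"
      using c unfolding torus_def by (rule integral_prod_continuous)
    also have "\<dots> = 0" using 2 integral_unique[OF z] by simp
    finally show ?thesis .
  qed
qed

lemma integral_torus_by_parts:
  assumes "g \<in> torus_test" "h \<in> torus_test" "e \<in> Basis"
  shows "integral torus (\<lambda>x. pderiv_dir e g x * h x) = - integral torus (\<lambda>x. g x * pderiv_dir e h x)"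
proof -
  have c: "continuous_on torus (\<lambda>x. pderiv_dir e g x * h x)" "continuous_on torus (\<lambda>x. g x * pderiv_dir e h x)"
    by (intro torus_test_continuous_on torus_test_mult torus_test_pderiv_dir assms)+
  have "pderiv_dir e (\<lambda>x. g x * h x) = (\<lambda>x. g x * pderiv_dir e h x + pderiv_dir e g x * h x)"
    using assms by (auto simp: pderiv_dir_mult torus_test_differentiable)
  then have "integral torus (\<lambda>x. g x * pderiv_dir e h x + pderiv_dir e g x * h x) = 0"
    using integral_torus_pderiv_dir[OF torus_test_mult[OF assms(1,2)] assms(3)] by simp
  then show ?thesis
    using integral_add[OF torus_integrable[OF c(2)] torus_integrable[OF c(1)]]
    by (simp add: add_eq_0_iff)
qed

text \<open>For \<open>k \<noteq> 0\<close> some partial derivative multiplies \<open>wave k\<close>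
  by a nonzero constant, and the integral of a derivative over the torus is 0.\<close>

lemma integral_torus_wave: "integral torus (wave k) = (if k = 0 then of_real ((2 * pi)\<^sup>2) else 0)"
proof (cases "k = 0")
  case True
  then have "integral torus (wave k) = integral torus (\<lambda>x. 1)"
    by (intro integral_cong) simp
  also have "\<dots> = of_real (measure lborel torus)"
    unfolding torus_def by (simp add: of_real_def)
  finally show ?thesis using True by (simp add: content_torus)
next
  case False
  then obtain e where e: "e \<in> Basis" "vec_of k \<bullet> e \<noteq> 0"
    by (metis euclidean_all_zero_iff vec_of_eq_0_iff)
  have "\<i> * of_real (vec_of k \<bullet> e) * integral torus (wave k) = 0"
    using integral_torus_pderiv_dir[OF torus_test_wave e(1), of k]
    by (simp add: pderiv_dir_wave)
  then show ?thesis using e False by simp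
qed

section \<open>Fourier coefficients of functions\<close>

definition fhat :: "(plane \<Rightarrow> complex) \<Rightarrow> freq \<Rightarrow> complex" where
  "fhat g k = integral torus (\<lambda>x. g x * wave (- k) x) / of_real ((2 * pi)\<^sup>2)"

lemma continuous_on_wave [continuous_intros]: "continuous_on A (wave k)"
  using torus_test_continuous_on torus_test_wave by blast

lemma integrable_times_wave:
  "continuous_on torus g \<Longrightarrow> (\<lambda>x. g x * wave k x) integrable_on torus"
  by (intro torus_integrable continuous_intros)

lemma integral_torus_times_wave: "integral torus (\<lambda>x. g x * wave k x) = of_real ((2 * pi)\<^sup>2) * fhat g (- k)"
  by (simp add: fhat_def)

lemma fhat_wave: "fhat (wave j) k = (if j = k then 1 else 0)"
proof -
  have "(\<lambda>x. wave j x * wave (- k) x) = wave (j - k)"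
    by (auto simp flip: wave_add)
  then show ?thesis by (simp add: fhat_def integral_torus_wave)
qed

lemma fhat_add:
  "continuous_on torus g \<Longrightarrow> continuous_on torus h \<Longrightarrow> fhat (\<lambda>x. g x + h x) k = fhat g k + fhat h k"
  by (simp add: fhat_def distrib_right integral_add integrable_times_wave add_divide_distrib)

lemma fhat_cmult: "fhat (\<lambda>x. c * g x) k = c * fhat g k"
  by (simp add: fhat_def mult.assoc)

lemma fhat_diff:
  "continuous_on torus g \<Longrightarrow> continuous_on torus h \<Longrightarrow> fhat (\<lambda>x. g x - h x) k = fhat g k - fhat h k"
  by (simp add: fhat_def left_diff_distrib integral_diff integrable_times_wave diff_divide_distrib)

lemma fhat_sum:
  assumes "\<And>i. i \<in> F \<Longrightarrow> continuous_on torus (g i)"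
  shows "fhat (\<lambda>x. \<Sum>i\<in>F. g i x) k = (\<Sum>i\<in>F. fhat (g i) k)"
  using assms
proof (induction F rule: infinite_finite_induct)
  case (insert i F)
  then have "continuous_on torus (\<lambda>x. \<Sum>i\<in>F. g i x)" "continuous_on torus (g i)"
    by (auto intro!: continuous_intros)
  then show ?case using insert by (simp add: fhat_add)
qed (simp_all add: fhat_def)

lemma norm_fhat_le:
  assumes "continuous_on torus g" "\<And>x. x \<in> torus \<Longrightarrow> cmod (g x) \<le> B"
  shows "cmod (fhat g k) \<le> B"
proof -
  have "cmod (integral torus (\<lambda>x. g x * wave (- k) x)) \<le> B * (2 * pi)\<^sup>2"
    using assms by (intro norm_integral_torus_le continuous_intros) (auto simp: norm_mult)
  then show ?thesis
    by (simp add: fhat_def norm_divide norm_power divide_le_eq norm_mult)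
qed

lemma fhat_pderiv_dir:
  assumes "g \<in> torus_test" "e \<in> Basis"
  shows "fhat (pderiv_dir e g) k = \<i> * of_real (vec_of k \<bullet> e) * fhat g k"
proof -
  have "integral torus (\<lambda>x. g x * (\<i> * of_real (vec_of (- k) \<bullet> e) * wave (- k) x))
      = - (\<i> * of_real (vec_of k \<bullet> e) * integral torus (\<lambda>x. g x * wave (- k) x))"
    unfolding integral_mult_right[symmetric] integral_neg[symmetric]
    by (intro integral_cong) (simp add: vec_of_minus)
  then show ?thesis
    using integral_torus_by_parts[OF assms(1) torus_test_wave assms(2), of "- k"]
    by (simp add: fhat_def pderiv_dir_wave)
qed

lemma fcoeff_distr_of: "continuous_on torus p \<Longrightarrow> fcoeff (distr_of p) k = fhat p k"
  unfolding fcoeff_def distr_of_def fhat_def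
  by (subst set_integral_torus) (auto intro!: continuous_intros)

subsection \<open>Decay of the coefficients\<close>

text \<open>A product of one-variable factors rather than \<open>1 + |k|^2\<close>: its inverse is
  summable over all pairs of integers, whereas the sum of \<open>1 / (1 + |k|^2)\<close> diverges
  logarithmically in two dimensions.\<close>

definition weight :: "freq \<Rightarrow> real" where
  "weight k = (1 + (real_of_int (fst k))\<^sup>2) * (1 + (real_of_int (snd k))\<^sup>2)"

lemma norm_vec_of: "(norm (vec_of k))\<^sup>2 = (real_of_int (fst k))\<^sup>2 + (real_of_int (snd k))\<^sup>2"
  by (simp add: vec_of_def norm_Pair)

lemma weight_ge: "1 + (norm (vec_of k))\<^sup>2 \<le> weight k"
  by (simp add: weight_def norm_vec_of algebra_simps)

lemma weight_ge_1: "1 \<le> weight k"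
  using weight_ge[of k] by (smt (verit) zero_le_power2)

lemma norm_vec_of_le_weight: "norm (vec_of k) \<le> weight k"
proof -
  have "2 * norm (vec_of k) \<le> 1 + (norm (vec_of k))\<^sup>2"
    using sum_squares_bound[of 1 "norm (vec_of k)"] by simp
  then show ?thesis using weight_ge[of k] norm_ge_zero[of "vec_of k"] by linarith
qed

lemma weight_minus [simp]: "weight (- k) = weight k"
  by (simp add: weight_def)

lemma summable_on_inverse_weight: "(\<lambda>k. 1 / weight k) summable_on UNIV"
proof -
  have s: "(\<lambda>n::int. 1 / (1 + (real_of_int n)\<^sup>2)) summable_on UNIV" (is "?f summable_on _")
  proof -
    have "summable (\<lambda>n::nat. 1 / (1 + (real n)\<^sup>2))"
    proof (rule summable_comparison_test_ev)
      show "\<forall>\<^sub>F n in sequentially. norm (1 / (1 + (real n)\<^sup>2)) \<le> inverse (real n ^ 2)"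
        using eventually_gt_at_top[of 0] by eventually_elim (auto simp: inverse_eq_divide intro!: frac_le)
      show "summable (\<lambda>n. inverse (real n ^ 2))"
        by (rule inverse_power_summable) simp
    qed
    then have nat: "(\<lambda>n::nat. 1 / (1 + (real n)\<^sup>2)) summable_on UNIV"
      by (subst summable_on_UNIV_nonneg_real_iff) auto
    have a: "?f summable_on (range int)"
      by (subst summable_on_reindex) (use nat in \<open>auto simp: o_def inj_on_def\<close>)
    have b: "?f summable_on (range (\<lambda>n. - int n))"
      by (subst summable_on_reindex) (use nat in \<open>auto simp: o_def inj_on_def\<close>)
    have "range int \<union> range (\<lambda>n. - int n) = UNIV"
      by (metis (no_types, lifting) UNIV_eq_I UnCI int_cases2 rangeI)
    then show ?thesis using summable_on_union[OF a b] by simp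
  qed
  have "(\<lambda>k. 1 / weight k) summable_on (UNIV \<times> UNIV)"
  proof (rule summable_on_SigmaI)
    show "((\<lambda>y. 1 / weight (x, y)) has_sum ?f x * infsum ?f UNIV) UNIV" for x
      using has_sum_cmult_right[OF has_sum_infsum[OF s], of "?f x"]
      by (simp add: weight_def)
    show "(\<lambda>x. ?f x * infsum ?f UNIV) summable_on UNIV"
      using s by (rule summable_on_cmult_left)
    show "0 \<le> 1 / weight (x, y)" for x y
      using weight_ge_1[of "(x, y)"] by simp
  qed
  then show ?thesis by simp
qed

text \<open>The differential operator \<open>(1 - \<partial>\<^sub>1\<^sup>2) (1 - \<partial>\<^sub>2\<^sup>2)\<close>, whose symbol is \<^const>\<open>weight\<close>.\<close>

definition weight_op :: "(plane \<Rightarrow> complex) \<Rightarrow> plane \<Rightarrow> complex" where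
  "weight_op g = (\<lambda>x. g x - pderivs [e1, e1] g x - pderivs [e2, e2] g x + pderivs [e1, e1, e2, e2] g x)"

lemma torus_test_weight_op: "g \<in> torus_test \<Longrightarrow> weight_op g \<in> torus_test"
  unfolding weight_op_def
  by (intro torus_test_add torus_test_diff torus_test_pderivs) auto

lemma fhat_weight_op:
  assumes "g \<in> torus_test"
  shows "fhat (weight_op g) k = of_real (weight k) * fhat g k"
proof -
  have t: "pderivs es g \<in> torus_test" if "es \<in> lists Basis" for es
    using assms that by (rule torus_test_pderivs)
  have k: "vec_of k \<bullet> e1 = of_int (fst k)" "vec_of k \<bullet> e2 = of_int (snd k)"
    by (simp_all add: vec_of_def e1_def e2_def)
  have "fhat (weight_op g) k = fhat g k - fhat (pderivs [e1, e1] g) k - fhat (pderivs [e2, e2] g) k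
      + fhat (pderivs [e1, e1, e2, e2] g) k"
    unfolding weight_op_def
    by (simp add: fhat_add fhat_diff torus_test_continuous_on[OF t] torus_test_continuous_on[OF assms]
        continuous_on_diff del: pderivs.simps)
  also have "\<dots> = of_real (weight k) * fhat g k"
    by (simp add: fhat_pderiv_dir torus_test_pderiv_dir assms k weight_def algebra_simps power2_eq_square)
  finally show ?thesis .
qed

lemma torus_test_bounded:
  assumes "g \<in> torus_test"
  obtains B where "\<And>x. x \<in> torus \<Longrightarrow> cmod (g x) \<le> B"
proof -
  have "compact (g ` torus)"
    using assms by (intro compact_continuous_image torus_test_continuous_on) (auto simp: torus_def)
  then show ?thesis
    using that compact_imp_bounded by (metis bounded_iff imageI)
qed

lemma funpow_weight_op:
  assumes "g \<in> torus_test"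
  shows "(weight_op ^^ N) g \<in> torus_test"
    and "fhat ((weight_op ^^ N) g) k = of_real (weight k ^ N) * fhat g k"
proof -
  show *: "(weight_op ^^ N) g \<in> torus_test" for N
    by (induction N) (simp_all add: assms torus_test_weight_op)
  show "fhat ((weight_op ^^ N) g) k = of_real (weight k ^ N) * fhat g k"
    by (induction N) (simp_all add: fhat_weight_op *)
qed

text \<open>A power of \<open>weight\<close> on the Fourier side is a differential operator applied
  to \<open>g\<close>. The result is bounded on the torus, and coefficients never exceed a bound for
  the function.\<close>

lemma fhat_rapid_decay:
  assumes "g \<in> torus_test"
  obtains C where "\<And>k. weight k ^ N * cmod (fhat g k) \<le> C"
proof -
  obtain B where "\<And>x. x \<in> torus \<Longrightarrow> cmod ((weight_op ^^ N) g x) \<le> B"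
    using torus_test_bounded[OF funpow_weight_op(1)[OF assms]] by blast
  then have "cmod (fhat ((weight_op ^^ N) g) k) \<le> B" for k
    using funpow_weight_op(1)[OF assms] by (intro norm_fhat_le torus_test_continuous_on)
  then show ?thesis
    using that[of B] weight_ge_1 by (simp add: funpow_weight_op[OF assms] norm_mult norm_power abs_of_nonneg order_trans[OF zero_le_one])
qed

text \<open>One power of \<open>weight\<close> is spent on summability.\<close>

lemma summable_on_weight_bound:
  assumes "\<And>k. weight k ^ Suc N * a k \<le> C" "\<And>k. 0 \<le> a k"
  shows "(\<lambda>k. weight k ^ N * a k) summable_on UNIV"
proof (rule summable_on_comparison_test)
  show "(\<lambda>k. C * (1 / weight k)) summable_on UNIV"
    by (rule summable_on_cmult_right[OF summable_on_inverse_weight])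
  show "weight k ^ N * a k \<le> C * (1 / weight k)" for k
    using assms(1)[of k] weight_ge_1[of k] by (simp add: field_simps)
  show "0 \<le> weight k ^ N * a k" for k
    using assms(2) weight_ge_1[of k] by simp
qed

lemma summable_on_fhat:
  assumes "g \<in> torus_test"
  shows "(\<lambda>k. weight k ^ N * cmod (fhat g k)) summable_on UNIV"
proof -
  obtain C where "\<And>k. weight k ^ Suc N * cmod (fhat g k) \<le> C"
    using fhat_rapid_decay[OF assms] by blast
  then show ?thesis by (rule summable_on_weight_bound) simp
qed

subsection \<open>Completeness of the exponentials\<close>

text \<open>Polynomials in \<open>(1 + cos(x\<^sub>1 - a)) (1 + cos(x\<^sub>2 - b)) / 4\<close>, which has a strict maximum at
  \<open>(a, b)\<close>, are trigonometric; high powers concentrate there.\<close>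

definition peak :: "plane \<Rightarrow> plane \<Rightarrow> real" where
  "peak a x = (1 + cos (fst x - fst a)) * (1 + cos (snd x - snd a)) / 4"

lemma peak_nonneg: "0 \<le> peak a x" and peak_le_1: "peak a x \<le> 1" and peak_self: "peak a a = 1"
proof -
  have c: "0 \<le> 1 + cos t" "1 + cos t \<le> 2" for t :: real
    using cos_ge_minus_one[of t] cos_le_one[of t] by linarith+
  show "0 \<le> peak a x" using c by (simp add: peak_def)
  have "(1 + cos (fst x - fst a)) * (1 + cos (snd x - snd a)) \<le> 2 * 2"
    by (intro mult_mono c) auto
  then show "peak a x \<le> 1" by (simp add: peak_def)
  show "peak a a = 1" by (simp add: peak_def)
qed

text \<open>With \<open>a\<close> in the open square the coordinate differences stay below
  \<open>2 * pi\<close>, so both cosines reach 1 only at \<open>x = a\<close>. For \<open>a\<close>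
  on the boundary the opposite side would carry a second maximum.\<close>

lemma peak_less_1:
  assumes "a \<in> box (- pi, - pi) (pi, pi)" "x \<in> torus" "x \<noteq> a"
  shows "peak a x < 1"
proof -
  have c: "0 \<le> 1 + cos t" "1 + cos t \<le> 2" for t :: real
    using cos_ge_minus_one[of t] cos_le_one[of t] by linarith+
  have lt: "cos t < 1" if "\<bar>t\<bar> < 2 * pi" "t \<noteq> 0" for t :: real
  proof -
    have "cos t \<noteq> 1"
    proof
      assume "cos t = 1"
      then obtain n :: int where n: "t = of_int n * (2 * pi)"
        by (auto simp: cos_one_2pi_int mult.assoc)
      with that have "\<bar>real_of_int n\<bar> * (2 * pi) < 1 * (2 * pi)" by (simp add: abs_mult)
      then have "\<bar>real_of_int n\<bar> < 1" by (subst (asm) mult_less_cancel_right) auto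
      then show False using n that by auto
    qed
    then show ?thesis using cos_le_one[of t] by linarith
  qed
  obtain a1 a2 x1 x2 where ax: "a = (a1, a2)" "x = (x1, x2)" by fastforce
  have b: "\<bar>x1 - a1\<bar> < 2 * pi" "\<bar>x2 - a2\<bar> < 2 * pi"
    using assms ax by (auto simp: torus_def box_def Basis_prod_def abs_less_iff)
  consider "x1 \<noteq> a1" | "x2 \<noteq> a2" using assms ax by auto
  then have "(1 + cos (x1 - a1)) * (1 + cos (x2 - a2)) < 4"
  proof cases
    case 1
    then have "(1 + cos (x1 - a1)) * 2 < 4" using lt b by simp
    moreover have "(1 + cos (x1 - a1)) * (1 + cos (x2 - a2)) \<le> (1 + cos (x1 - a1)) * 2"
      by (intro mult_left_mono c)
    ultimately show ?thesis by (rule order.strict_trans1[rotated])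
  next
    case 2
    then have "2 * (1 + cos (x2 - a2)) < 4" using lt b by simp
    moreover have "(1 + cos (x1 - a1)) * (1 + cos (x2 - a2)) \<le> 2 * (1 + cos (x2 - a2))"
      by (intro mult_right_mono c)
    ultimately show ?thesis by (rule order.strict_trans1[rotated])
  qed
  then show ?thesis by (simp add: peak_def ax)
qed

lemma continuous_on_peak [continuous_intros]: "continuous_on A (peak a)"
  unfolding peak_def[abs_def] by (intro continuous_intros) auto

inductive trig_poly :: "(plane \<Rightarrow> complex) \<Rightarrow> bool" where
  wave: "trig_poly (\<lambda>x. c * wave k x)"
| add: "trig_poly f \<Longrightarrow> trig_poly g \<Longrightarrow> trig_poly (\<lambda>x. f x + g x)"

lemma trig_poly_cmult: "trig_poly f \<Longrightarrow> trig_poly (\<lambda>x. c * f x)"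
proof (induction rule: trig_poly.induct)
  case (wave d k)
  show ?case using trig_poly.wave[of "c * d" k] by (simp add: mult.assoc)
next
  case (add f g)
  then show ?case using trig_poly.add by (simp add: distrib_left)
qed

lemma trig_poly_mult_wave: "trig_poly f \<Longrightarrow> trig_poly (\<lambda>x. f x * wave j x)"
proof (induction rule: trig_poly.induct)
  case (wave d k)
  show ?case using trig_poly.wave[of d "k + j"] by (simp add: mult.assoc wave_add)
next
  case (add f g)
  then show ?case using trig_poly.add by (simp add: distrib_right)
qed

lemma trig_poly_mult: "trig_poly f \<Longrightarrow> trig_poly g \<Longrightarrow> trig_poly (\<lambda>x. f x * g x)"
proof (induction rule: trig_poly.induct)
  case (wave d k)
  then show ?case using trig_poly_cmult[OF trig_poly_mult_wave, of g d k] by (simp add: mult_ac)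
next
  case (add f h)
  then show ?case using trig_poly.add by (simp add: distrib_right)
qed

lemma trig_poly_peak: "trig_poly (\<lambda>x. of_real (peak a x))"
proof -
  have c: "of_real (cos (v - u)) = cis (- u) / 2 * cis v + cis u / 2 * cis (- v)" for u v :: real
    by (simp add: complex_eq_iff cos_diff field_simps)
  have 1: "trig_poly (\<lambda>x. 1)" using wave[of 1 0] by simp
  have w: "wave (1, 0) x = cis (fst x)" "wave (- 1, 0) x = cis (- fst x)"
    "wave (0, 1) x = cis (snd x)" "wave (0, - 1) x = cis (- snd x)" for x
    by (cases x; simp add: wave_def vec_of_def)+
  have "trig_poly (\<lambda>x. 1 + (cis (- fst a) / 2 * wave (1, 0) x + cis (fst a) / 2 * wave (- 1, 0) x))"
    "trig_poly (\<lambda>x. 1 + (cis (- snd a) / 2 * wave (0, 1) x + cis (snd a) / 2 * wave (0, - 1) x))"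
    by (intro add 1 wave)+
  from trig_poly_cmult[OF trig_poly_mult[OF this], of "1 / 4"] show ?thesis
    by (rule back_subst[of trig_poly]) (simp add: peak_def w c fun_eq_iff)
qed

lemma trig_poly_peak_power: "trig_poly (\<lambda>x. of_real (peak a x ^ n))"
proof (induction n)
  case 0
  show ?case using wave[of 1 0] by simp
next
  case (Suc n)
  then show ?case using trig_poly_mult[OF trig_poly_peak Suc, of a] by simp
qed

lemma integral_times_trig_poly_eq_0:
  assumes "continuous_on torus g" "\<And>k. fhat g k = 0" "trig_poly p"
  shows "integral torus (\<lambda>x. g x * p x) = 0 \<and> continuous_on torus p"
  using assms(3)
proof (induction rule: trig_poly.induct)
  case (wave c k)
  have "integral torus (\<lambda>x. g x * wave k x) = 0"
    using assms(2)[of "- k"] by (simp add: integral_torus_times_wave)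
  then have "integral torus (\<lambda>x. c * (g x * wave k x)) = 0" by simp
  then show ?case by (auto simp: mult_ac intro!: continuous_intros)
next
  case (add p q)
  then show ?case
    using assms(1)
    by (auto simp: distrib_left integral_add torus_integrable continuous_on_mult intro!: continuous_intros)
qed

text \<open>The integrals of \<open>h * peak a ^ n\<close> all vanish, powers of the peak being
  trigonometric polynomials. If \<open>h a > 0\<close>, the integrand contributes at least a
  constant times \<open>q ^ n\<close> near \<open>a\<close>, while elsewhere its negative part is at
  most a constant times \<open>r ^ n\<close> with \<open>r < q\<close>: a contradiction for large
  \<open>n\<close>.\<close>

lemma real_function_fhat_0_imp_nonpos:
  fixes h :: "plane \<Rightarrow> real"
  assumes cont: "continuous_on torus h" and z: "\<And>k. fhat (\<lambda>x. of_real (h x)) k = 0"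
    and a: "a \<in> box (- pi, - pi) (pi, pi)"
  shows "h a \<le> 0"
proof (rule ccontr)
  assume "\<not> h a \<le> 0"
  then have pos: "0 < h a" by simp
  let ?B = "box (- pi, - pi) (pi, pi) :: plane set"
  have Bt: "?B \<subseteq> torus" unfolding torus_def by (rule box_subset_cbox)
  have int0: "integral torus (\<lambda>x. h x * peak a x ^ n) = 0" for n
  proof -
    have "integral torus (\<lambda>x. complex_of_real (h x) * of_real (peak a x ^ n)) = 0"
      using integral_times_trig_poly_eq_0[OF _ z trig_poly_peak_power] cont
      by (metis continuous_on_of_real)
    moreover have "(\<lambda>x. h x * peak a x ^ n) integrable_on torus"
      by (intro torus_integrable continuous_intros cont)
    ultimately have "complex_of_real (integral torus (\<lambda>x. h x * peak a x ^ n)) = 0"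
      using integral_linear[of "\<lambda>x. h x * peak a x ^ n" torus complex_of_real] bounded_linear_of_real
      by (simp add: o_def)
    then show ?thesis by simp
  qed
  have cB: "continuous_on ?B h" using cont Bt continuous_on_subset by blast
  define U where "U = {x \<in> ?B. h x > h a / 2}"
  have U: "open U" "a \<in> U" "U \<subseteq> torus"
    using continuous_on_open_vimage[OF open_box, THEN iffD1, OF cB, rule_format, of "{h a / 2 <..}"] a pos Bt
    by (auto simp: U_def vimage_def Int_def conj_commute)
  obtain r where r: "0 \<le> r" "r < 1" "\<And>x. x \<in> torus - U \<Longrightarrow> peak a x \<le> r"
  proof (cases "torus - U = {}")
    case False
    have "compact (torus - U)"
      using U(1) by (auto simp: torus_def intro: compact_diff)
    from continuous_attains_sup[OF this False continuous_on_peak[of _ a]]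
    obtain y where y: "y \<in> torus - U" "\<forall>x\<in>torus - U. peak a x \<le> peak a y" by blast
    have "peak a y < 1" using y U a by (intro peak_less_1) auto
    then show ?thesis using that[of "peak a y"] y peak_nonneg by blast
  qed (use that[of 0] in auto)
  \<comment> \<open>Any number strictly between \<open>r\<close> and 1 would do: the peak exceeds it
    on a whole box around \<open>a\<close>, and this box carries the positive mass.\<close>
  define q where "q = (1 + r) / 2"
  have q: "r < q" "q < 1" "0 < q" using r by (auto simp: q_def)
  have "open (U \<inter> {x. peak a x > q})"
    using U(1) open_vimage[OF open_greaterThan, of "peak a" q] continuous_on_peak[of UNIV a]
    by (auto simp: vimage_def intro!: open_Int open_Collect_less continuous_intros)
  moreover have "a \<in> U \<inter> {x. peak a x > q}" using U q by (simp add: peak_self)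
  ultimately obtain c d where cd: "a \<in> box c d" "cbox c d \<subseteq> U \<inter> {x. peak a x > q}"
    by (meson open_contains_cbox)
  define m where "m = measure lborel (cbox c d)"
  have m: "0 < m"
    using cd(1) unfolding m_def by (subst content_pos_lt_eq) (auto simp: box_def)
  obtain M where M: "\<And>x. x \<in> torus \<Longrightarrow> \<bar>h x\<bar> \<le> M" "0 \<le> M"
  proof -
    have "bounded (h ` torus)"
      using cont by (intro compact_imp_bounded compact_continuous_image) (auto simp: torus_def)
    then obtain M where "\<forall>x\<in>torus. \<bar>h x\<bar> \<le> M" by (auto simp: bounded_iff)
    then show ?thesis using that[of "max M 0"] by fastforce
  qed
  have bound: "q ^ n * (h a / 2 * m) \<le> M * (2 * pi)\<^sup>2 * r ^ n" for n
  proof -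
    \<comment> \<open>A lower bound for the integrand in three regions: on the box both factors are
      bounded below, on the rest of \<open>U\<close> the integrand is nonnegative, and off
      \<open>U\<close> it is at least \<open>- M * r ^ n\<close>.\<close>
    define l where "l x = (if x \<in> cbox c d then h a / 2 * q ^ n else 0) - M * r ^ n" for x
    have le: "l x \<le> h x * peak a x ^ n" if x: "x \<in> torus" for x
    proof (cases "x \<in> U")
      case True
      then have hx: "h x \<ge> h a / 2" by (simp add: U_def)
      have Mr: "0 \<le> M * r ^ n" using M r by simp
      have p: "0 \<le> peak a x ^ n" using peak_nonneg by simp
      show ?thesis
      proof (cases "x \<in> cbox c d")
        case True
        then have "q ^ n \<le> peak a x ^ n" using cd q by (intro power_mono) auto
        then have "h a / 2 * q ^ n \<le> h x * peak a x ^ n"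
          using hx pos q by (intro mult_mono) auto
        then show ?thesis using Mr True by (simp add: l_def)
      next
        case False
        have "0 \<le> h x * peak a x ^ n" using hx pos p by simp
        then show ?thesis using Mr False by (simp add: l_def)
      qed
    next
      case False
      then have "peak a x ^ n \<le> r ^ n" using r(3)[of x] x peak_nonneg by (intro power_mono) auto
      then have "\<bar>h x\<bar> * peak a x ^ n \<le> M * r ^ n"
        using M x peak_nonneg by (intro mult_mono) auto
      moreover have "\<bar>h x * peak a x ^ n\<bar> = \<bar>h x\<bar> * peak a x ^ n"
        using peak_nonneg by (simp add: abs_mult)
      moreover have "x \<notin> cbox c d" using False cd by auto
      ultimately show ?thesis by (simp add: l_def abs_le_iff)
    qed
    have sub: "cbox c d \<subseteq> torus" using cd U by auto
    have i1: "((\<lambda>x. if x \<in> cbox c d then h a / 2 * q ^ n else 0) has_integral (m * (h a / 2 * q ^ n))) torus"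
      using has_integral_const[of "h a / 2 * q ^ n" c d] has_integral_restrict[OF sub, of "\<lambda>_. h a / 2 * q ^ n"]
      unfolding m_def by simp
    have i2: "((\<lambda>x. M * r ^ n) has_integral ((2 * pi)\<^sup>2 * (M * r ^ n))) torus"
      using has_integral_const[of "M * r ^ n" "(- pi, - pi) :: plane" "(pi, pi)"] content_torus by (simp add: torus_def)
    have "m * (h a / 2 * q ^ n) - (2 * pi)\<^sup>2 * (M * r ^ n) \<le> integral torus (\<lambda>x. h x * peak a x ^ n)"
    proof (rule has_integral_le)
      show "(l has_integral (m * (h a / 2 * q ^ n) - (2 * pi)\<^sup>2 * (M * r ^ n))) torus"
        using has_integral_diff[OF i1 i2] by (simp add: l_def[abs_def])
      show "((\<lambda>x. h x * peak a x ^ n) has_integral integral torus (\<lambda>x. h x * peak a x ^ n)) torus"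
        by (intro integrable_integral torus_integrable continuous_intros cont)
    qed (rule le)
    then show ?thesis using int0 by (simp add: mult_ac)
  qed
  have "(\<lambda>n. M * (2 * pi)\<^sup>2 * (r / q) ^ n) \<longlonglongrightarrow> M * (2 * pi)\<^sup>2 * 0"
    using r q by (intro tendsto_intros LIMSEQ_realpow_zero) auto
  moreover have "h a / 2 * m \<le> M * (2 * pi)\<^sup>2 * (r / q) ^ n" for n
    using bound[of n] q by (simp add: power_divide field_simps)
  ultimately have "h a / 2 * m \<le> 0"
    by (intro LIMSEQ_le_const) auto
  then show False using pos m by (simp add: mult_le_0_iff)
qed

text \<open>Continuity carries the value 0 from the open square to its closure, and translation by
  periods carries it to the whole plane.\<close>

lemma periodic2_eq_0:
  fixes g :: "plane \<Rightarrow> complex"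
  assumes per: "periodic2 g" and cont: "continuous_on UNIV g"
    and z: "\<And>a. a \<in> box (- pi, - pi) (pi, pi) \<Longrightarrow> g a = 0"
  shows "g x = 0"
proof -
  have zt: "g a = 0" if "a \<in> torus" for a
  proof -
    have "a \<in> closure (box (- pi, - pi) (pi, pi))"
      using that by (subst closure_box) (auto simp: torus_def box_def Basis_prod_def intro!: exI[of _ 0])
    then show ?thesis
      using continuous_constant_on_closure[of "box (- pi, - pi) (pi, pi)" g 0 a] z cont
        continuous_on_subset by blast
  qed
  define n where "n t = \<lfloor>(t + pi) / (2 * pi)\<rfloor>" for t
  have n: "t - 2 * pi * of_int (n t) \<in> {- pi..pi}" for t
  proof -
    have "of_int (n t) \<le> (t + pi) / (2 * pi)" "(t + pi) / (2 * pi) < of_int (n t) + 1"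
      by (auto simp: n_def)
    then show ?thesis by (auto simp: field_simps)
  qed
  let ?k = "(- n (fst x), - n (snd x))"
  have "x + (2 * pi) *\<^sub>R vec_of ?k \<in> torus"
    using n[of "fst x"] n[of "snd x"]
    by (cases x) (auto simp: torus_def vec_of_def cbox_Pair_eq)
  then show ?thesis
    using zt per unfolding periodic2_def by metis
qed

text \<open>The conjugate of \<open>g\<close> has vanishing coefficients too, hence so have its real
  and imaginary parts. The result for real functions gives only one inequality; the scalar
  \<open>c\<close>, set to 1 and to -1, turns it into an equality.\<close>

lemma fhat_0_imp_eq_0:
  assumes "periodic2 g" "continuous_on UNIV g" "\<And>k. fhat g k = 0"
  shows "g x = 0"
proof (rule periodic2_eq_0[OF assms(1,2)])
  fix a :: plane assume a: "a \<in> box (- pi, - pi) (pi, pi)"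
  have ct: "continuous_on torus g" using assms(2) continuous_on_subset by blast
  have cnj: "fhat (\<lambda>x. cnj (g x)) k = 0" for k
  proof -
    have "integral torus (\<lambda>x. cnj (g x) * wave (- k) x) = cnj (integral torus (\<lambda>x. g x * wave k x))"
      using integral_linear[OF integrable_times_wave[OF ct] bounded_linear_cnj, of k]
      by (simp add: o_def cnj_wave)
    also have "\<dots> = 0" using assms(3)[of "- k"] by (simp add: integral_torus_times_wave)
    finally show ?thesis by (simp add: fhat_def)
  qed
  have re: "fhat (\<lambda>x. of_real (c * Re (g x))) k = 0" for c k
  proof -
    have "(\<lambda>x. of_real (c * Re (g x))) = (\<lambda>x. of_real (c / 2) * (g x + cnj (g x)))"
      by (simp add: complex_eq_iff fun_eq_iff)
    then show ?thesis
      by (simp only: fhat_cmult) (simp add: fhat_add ct continuous_on_cnj assms(3) cnj)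
  qed
  have im: "fhat (\<lambda>x. of_real (c * Im (g x))) k = 0" for c k
  proof -
    have "(\<lambda>x. of_real (c * Im (g x))) = (\<lambda>x. (- \<i> * of_real (c / 2)) * (g x - cnj (g x)))"
      by (simp add: complex_eq_iff fun_eq_iff)
    then show ?thesis
      by (simp only: fhat_cmult) (simp add: fhat_diff ct continuous_on_cnj assms(3) cnj)
  qed
  have "continuous_on torus (\<lambda>x. c * Re (g x))" "continuous_on torus (\<lambda>x. c * Im (g x))" for c
    using ct by (intro continuous_intros; assumption)+
  then have "c * Re (g a) \<le> 0" "c * Im (g a) \<le> 0" for c
    using real_function_fhat_0_imp_nonpos[OF _ re a] real_function_fhat_0_imp_nonpos[OF _ im a]
    by blast+
  from this[of 1] this[of "- 1"] show "g a = 0" by (simp add: complex_eq_iff)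
qed

text \<open>The coefficients are summable, so the series converges uniformly to a continuous
  \<open>G\<close>. Coefficients pass to uniform limits, so those of \<open>G - g\<close> all
  vanish, and completeness of the exponentials gives \<open>G = g\<close>.\<close>

lemma has_sum_fhat:
  assumes "g \<in> torus_test"
  shows "((\<lambda>k. fhat g k * wave k x) has_sum g x) UNIV"
proof -
  have s: "(\<lambda>k. cmod (fhat g k)) summable_on UNIV"
    using summable_on_fhat[OF assms, of 0] by simp
  define G where "G x = (\<Sum>\<^sub>\<infinity>k. fhat g k * wave k x)" for x
  have hs: "((\<lambda>k. fhat g k * wave k x) has_sum G x) UNIV" for x
    unfolding G_def
    by (rule has_sum_infsum[OF abs_summable_summable]) (simp add: norm_mult s)
  have ul: "uniform_limit UNIV (\<lambda>F x. \<Sum>k\<in>F. fhat g k * wave k x) G (finite_subsets_at_top UNIV)"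
    by (rule Weierstrass_m_test_general'[OF _ _ s]) (auto simp: norm_mult hs)
  have cG: "continuous_on UNIV G"
    by (rule uniform_limit_theorem[OF _ ul]) (auto intro!: always_eventually continuous_intros)
  have cg: "continuous_on UNIV g" using assms by (rule torus_test_continuous_on)
  have cG': "continuous_on torus G" and cg': "continuous_on torus g"
    using cG cg continuous_on_subset by blast+
  have "fhat G k = fhat g k" for k
  proof -
    have "((\<lambda>F. fhat (\<lambda>x. \<Sum>j\<in>F. fhat g j * wave j x) k) \<longlongrightarrow> fhat G k) (finite_subsets_at_top UNIV)"
    proof (rule tendstoI)
      fix e :: real assume "0 < e"
      then have "\<forall>\<^sub>F F in finite_subsets_at_top UNIV. \<forall>x\<in>UNIV. dist (\<Sum>j\<in>F. fhat g j * wave j x) (G x) < e / 2"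
        using uniform_limitD[OF ul, of "e / 2"] by simp
      then show "\<forall>\<^sub>F F in finite_subsets_at_top UNIV. dist (fhat (\<lambda>x. \<Sum>j\<in>F. fhat g j * wave j x) k) (fhat G k) < e"
      proof eventually_elim
        case (elim F)
        have c: "continuous_on torus (\<lambda>x. \<Sum>j\<in>F. fhat g j * wave j x)"
          by (intro continuous_intros)
        have "cmod (fhat (\<lambda>x. (\<Sum>j\<in>F. fhat g j * wave j x) - G x) k) \<le> e / 2"
          using elim c cG' by (intro norm_fhat_le continuous_intros) (auto simp: dist_norm less_imp_le)
        then show ?case
          using fhat_diff[OF c cG'] \<open>0 < e\<close> by (simp add: dist_norm)
      qed
    qed
    moreover have "\<forall>\<^sub>F F in finite_subsets_at_top UNIV. fhat (\<lambda>x. \<Sum>j\<in>F. fhat g j * wave j x) k = fhat g k"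
    proof -
      have "fhat (\<lambda>x. \<Sum>j\<in>F. fhat g j * wave j x) k = fhat g k" if "finite F" "{k} \<subseteq> F" for F
      proof -
        have "fhat (\<lambda>x. \<Sum>j\<in>F. fhat g j * wave j x) k = (\<Sum>j\<in>F. fhat g j * (if j = k then 1 else 0))"
          by (subst fhat_sum) (auto intro!: continuous_intros simp: fhat_cmult fhat_wave)
        also have "\<dots> = fhat g k" using that by (simp add: if_distrib sum.delta cong: if_cong)
        finally show ?thesis .
      qed
      then show ?thesis
        by (subst eventually_finite_subsets_at_top) (auto intro!: exI[of _ "{k}"])
    qed
    ultimately show ?thesis
      by (rule tendsto_unique[OF finite_subsets_at_top_neq_bot _ tendsto_eventually])
  qed
  then have z: "fhat (\<lambda>x. G x - g x) k = 0" for k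
    by (simp add: fhat_diff cG' cg')
  have per: "periodic2 (\<lambda>x. G x - g x)"
    using assms periodic2_wave unfolding torus_test_def periodic2_def G_def by auto
  have "G x - g x = 0"
    by (rule fhat_0_imp_eq_0[OF per continuous_on_diff[OF cG cg] z])
  then show ?thesis using hs[of x] by simp
qed

subsection \<open>Distributions are determined by their Fourier coefficients\<close>

lemma distribution_add:
  "distribution T \<Longrightarrow> g \<in> torus_test \<Longrightarrow> h \<in> torus_test \<Longrightarrow> T (\<lambda>x. g x + h x) = T g + T h"
  and distribution_cmult: "distribution T \<Longrightarrow> g \<in> torus_test \<Longrightarrow> T (\<lambda>x. c * g x) = c * T g"
  unfolding distribution_def by blast+

lemma distribution_diff:
  assumes "distribution T" "g \<in> torus_test" "h \<in> torus_test"
  shows "T (\<lambda>x. g x - h x) = T g - T h"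
  using distribution_add[OF assms(1,2) torus_test_cmult[OF assms(3), of "- 1"]]
    distribution_cmult[OF assms(1,3), of "- 1"] by simp

lemma distribution_sum:
  assumes "distribution T" "\<And>i. i \<in> F \<Longrightarrow> g i \<in> torus_test"
  shows "T (\<lambda>x. \<Sum>i\<in>F. g i x) = (\<Sum>i\<in>F. T (g i))"
proof -
  have 0: "T (\<lambda>x. 0) = 0"
    using distribution_cmult[OF assms(1) torus_test_const, of 0] by simp
  show ?thesis
    using assms(2)
  proof (induction F rule: infinite_finite_induct)
    case (insert i F)
    then show ?case
      by (simp add: distribution_add[OF assms(1)] torus_test_sum)
  qed (simp_all add: 0)
qed

lemma fhat_pderivs_le:
  assumes "g \<in> torus_test" "es \<in> lists Basis" "length es \<le> N"
  shows "cmod (fhat (pderivs es g) k) \<le> weight k ^ N * cmod (fhat g k)"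
proof -
  have "cmod (fhat (pderivs es g) k) \<le> weight k ^ length es * cmod (fhat g k)"
    using assms(2)
  proof (induction es)
    case (Cons e es)
    have "\<bar>vec_of k \<bullet> e\<bar> \<le> norm (vec_of k)"
      using Cons.hyps by (simp add: Basis_le_norm)
    then have "\<bar>vec_of k \<bullet> e\<bar> \<le> weight k"
      using norm_vec_of_le_weight order_trans by blast
    then have "\<bar>vec_of k \<bullet> e\<bar> * cmod (fhat (pderivs es g) k)
        \<le> weight k * (weight k ^ length es * cmod (fhat g k))"
      using Cons by (intro mult_mono) auto
    then show ?case
      using Cons.hyps torus_test_pderivs[OF assms(1)]
      by (simp add: fhat_pderiv_dir norm_mult mult.assoc)
  qed simp
  also have "\<dots> \<le> weight k ^ N * cmod (fhat g k)"
    using assms(3) weight_ge_1 by (intro mult_right_mono power_increasing) auto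
  finally show ?thesis .
qed

text \<open>Continuity of \<open>T\<close> bounds its value on the remainder \<open>g - S F\<close>
  by finitely many derivatives of the remainder, and these are dominated by the tail of the summable
  series \<open>weight k ^ N * cmod (fhat g k)\<close>. Thus \<open>T\<close> is recovered on every
  test function from its values on the exponentials.\<close>

lemma distribution_has_sum:
  assumes T: "distribution T" and g: "g \<in> torus_test"
  shows "((\<lambda>k. fcoeff T k * (of_real ((2 * pi)\<^sup>2) * fhat g (- k))) has_sum T g) UNIV"
proof -
  obtain C N where CN: "\<And>g B. g \<in> torus_test \<Longrightarrow>
      (\<And>es x. es \<in> lists Basis \<Longrightarrow> length es \<le> N \<Longrightarrow> cmod (pderivs es g x) \<le> B) \<Longrightarrow> cmod (T g) \<le> C * B"
    using T unfolding distribution_def by metis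
  let ?w = "\<lambda>k. weight k ^ N * cmod (fhat g k)"
  have sw: "?w summable_on UNIV" by (rule summable_on_fhat[OF g])
  have nn: "0 \<le> ?w k" for k using weight_ge_1[of k] by simp
  define S where "S F = (\<lambda>x. \<Sum>k\<in>F. fhat g k * wave k x)" for F
  have St: "S F \<in> torus_test" for F
    unfolding S_def by (intro torus_test_sum torus_test_cmult torus_test_wave)
  have bound: "cmod ((\<Sum>k\<in>F. fhat g k * T (wave k)) - T g) \<le> \<bar>C\<bar> * infsum ?w (- F)" if F: "finite F" for F
  proof -
    have d: "(\<lambda>x. g x - S F x) \<in> torus_test" using g St by (rule torus_test_diff)
    have fd: "fhat (\<lambda>x. g x - S F x) k = (if k \<in> F then 0 else fhat g k)" for k
    proof -
      have "fhat (S F) k = (\<Sum>j\<in>F. fhat g j * (if j = k then 1 else 0))"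
        unfolding S_def by (subst fhat_sum) (auto intro!: continuous_intros simp: fhat_cmult fhat_wave)
      also have "\<dots> = (if k \<in> F then fhat g k else 0)"
        using F by (simp add: if_distrib sum.delta cong: if_cong)
      finally show ?thesis
        using g St by (simp add: fhat_diff torus_test_continuous_on)
    qed
    have b: "cmod (pderivs es (\<lambda>x. g x - S F x) x) \<le> infsum ?w (- F)"
      if es: "es \<in> lists Basis" "length es \<le> N" for es x
    proof -
      let ?h = "pderivs es (\<lambda>x. g x - S F x)"
      have h: "?h \<in> torus_test" using d es by (simp add: torus_test_pderivs)
      have le: "cmod (fhat ?h k) \<le> (if k \<in> F then 0 else ?w k)" for k
        using fhat_pderivs_le[OF d es, of k] fd by (auto split: if_splits)
      have hs: "((\<lambda>k. if k \<in> F then 0 else ?w k) has_sum infsum ?w (- F)) UNIV"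
        using has_sum_infsum[OF summable_on_subset[OF sw subset_UNIV[of "- F"]]]
        by (rule has_sum_cong_neutral[THEN iffD1, rotated 3]) auto
      show ?thesis
        by (rule norm_infsum_le[OF has_sum_fhat[OF h] hs]) (use le in \<open>simp add: norm_mult\<close>)
    qed
    have "T (\<lambda>x. g x - S F x) = T g - (\<Sum>k\<in>F. fhat g k * T (wave k))"
      using distribution_diff[OF T g St[of F]] distribution_sum[OF T, of F "\<lambda>k x. fhat g k * wave k x"]
      by (simp add: S_def torus_test_cmult torus_test_wave distribution_cmult[OF T])
    moreover have "cmod (T (\<lambda>x. g x - S F x)) \<le> C * infsum ?w (- F)"
      by (rule CN[OF d b])
    moreover have "C * infsum ?w (- F) \<le> \<bar>C\<bar> * infsum ?w (- F)"
      using nn by (intro mult_right_mono infsum_nonneg) auto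
    ultimately show ?thesis by (simp add: norm_minus_commute[of _ "T g"])
  qed
  have "((\<lambda>F. sum ?w F) \<longlongrightarrow> infsum ?w UNIV) (finite_subsets_at_top UNIV)"
    using has_sum_infsum[OF sw] by (simp add: has_sum_def)
  then have "((\<lambda>F. \<bar>C\<bar> * (infsum ?w UNIV - sum ?w F)) \<longlongrightarrow> \<bar>C\<bar> * (infsum ?w UNIV - infsum ?w UNIV)) (finite_subsets_at_top UNIV)"
    by (intro tendsto_intros)
  moreover have "infsum ?w (- F) = infsum ?w UNIV - sum ?w F" if "finite F" for F
    using infsum_Un_disjoint[of ?w F "- F"] summable_on_subset[OF sw] that
    by (simp add: Compl_partition)
  ultimately have lim: "((\<lambda>F. \<bar>C\<bar> * infsum ?w (- F)) \<longlongrightarrow> 0) (finite_subsets_at_top UNIV)"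
    by (auto elim!: Lim_transform_eventually intro!: eventually_finite_subsets_at_top_weakI)
  have "((\<lambda>k. fhat g k * T (wave k)) has_sum T g) UNIV"
    unfolding has_sum_def
    by (rule Lim_transform_bound[OF _ lim, THEN LIM_zero_cancel])
      (use bound in \<open>auto intro!: eventually_finite_subsets_at_top_weakI simp: order_trans[OF _ abs_ge_self]\<close>)
  \<comment> \<open>Reindexed because \<open>fcoeff T k\<close> is, up to a constant, the value of
    \<open>T\<close> at \<open>wave (- k)\<close>.\<close>
  then have "((\<lambda>k. fhat g (- k) * T (wave (- k))) has_sum T g) UNIV"
    by (subst (asm) has_sum_reindex_bij_betw[of uminus UNIV UNIV, symmetric]) (auto simp: bij_uminus)
  then show ?thesis
    by (simp add: fcoeff_def mult.commute)
qed

subsection \<open>Slices of space-time test functions\<close>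

lemma slice_torus_test:
  assumes "\<psi> \<in> spacetime_test"
  shows "slice \<psi> t \<in> torus_test"
  using assms smooth_fun_linear[OF bounded_linear_of_real smooth_fun_slice, of \<psi> t]
  by (auto simp: spacetime_test_def torus_test_def slice_def periodic2_def)

lemma pderiv_dir_slice_eq:
  assumes "smooth_fun \<psi>"
  shows "pderiv_dir e (slice \<psi> t) = slice (pderiv_dir (0, e) \<psi>) t"
  unfolding slice_def
  by (intro ext) (subst pderiv_dir_linear[OF bounded_linear_of_real pderiv_dir_slice(2)[OF assms]],
      simp add: pderiv_dir_slice(1)[OF assms])

lemma pderiv_dir_eq_0:
  assumes "open U" "x \<in> U" "\<And>y. y \<in> U \<Longrightarrow> f y = 0"
  shows "pderiv_dir e f x = 0"
proof -
  have "(f has_derivative (\<lambda>_. 0)) (at x)"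
    by (rule has_derivative_transform_within_open[OF has_derivative_const assms(1,2)])
      (use assms(3) in auto)
  then show ?thesis by (rule pderiv_dir_eqI)
qed

definition time_supp :: "real \<Rightarrow> real \<Rightarrow> (real \<times> plane \<Rightarrow> real) \<Rightarrow> bool" where
  "time_supp a b \<psi> \<longleftrightarrow> (\<forall>t x. t \<notin> {a..b} \<longrightarrow> \<psi> (t, x) = 0)"

lemma time_supp_pderiv_dir:
  assumes "time_supp a b \<psi>"
  shows "time_supp a b (pderiv_dir e \<psi>)"
  unfolding time_supp_def
proof (intro allI impI)
  fix t x assume t: "t \<notin> {a..b}"
  show "pderiv_dir e \<psi> (t, x) = 0"
    by (rule pderiv_dir_eq_0[of "(- {a..b}) \<times> UNIV"])
      (use t assms in \<open>auto simp: time_supp_def intro!: open_Times\<close>)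
qed

lemma spacetime_testI:
  "smooth_fun \<psi> \<Longrightarrow> (\<And>t. periodic2 (\<lambda>x. \<psi> (t, x))) \<Longrightarrow> 0 < a \<Longrightarrow> a < b \<Longrightarrow> time_supp a b \<psi> \<Longrightarrow> \<psi> \<in> spacetime_test"
  by (auto simp: spacetime_test_def time_supp_def)

lemma spacetime_testE:
  assumes "\<psi> \<in> spacetime_test"
  obtains a b where "smooth_fun \<psi>" "\<And>t. periodic2 (\<lambda>x. \<psi> (t, x))" "0 < a" "a < b" "time_supp a b \<psi>"
  using assms by (auto simp: spacetime_test_def time_supp_def)

lemma spacetime_test_pderiv_dir:
  assumes "\<psi> \<in> spacetime_test" "e \<in> Basis"
  shows "pderiv_dir e \<psi> \<in> spacetime_test"
proof -
  obtain a b where *: "smooth_fun \<psi>" "\<And>t. periodic2 (\<lambda>x. \<psi> (t, x))" "0 < a" "a < b" "time_supp a b \<psi>"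
    using assms(1) by (rule spacetime_testE) blast
  have per: "periodic2 (\<lambda>x. pderiv_dir e \<psi> (t, x))" for t
    unfolding periodic2_def
  proof (intro allI)
    fix k :: freq and x
    have "\<psi> (y + (0, (2 * pi) *\<^sub>R vec_of k)) = \<psi> y" for y
      using *(2)[of "fst y"] unfolding periodic2_def by (cases y) (metis add_0_right add_Pair fst_conv)
    from pderiv_dir_shift[OF this *(1), of e "(t, x)"]
    show "pderiv_dir e \<psi> (t, x + (2 * pi) *\<^sub>R vec_of k) = pderiv_dir e \<psi> (t, x)" by simp
  qed
  show ?thesis
    using * per assms(2) by (intro spacetime_testI[of _ a b] smooth_fun_pderiv_dir time_supp_pderiv_dir)
qed

lemma spacetime_test_add:
  assumes "\<phi> \<in> spacetime_test" "\<psi> \<in> spacetime_test"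
  shows "(\<lambda>z. \<phi> z + \<psi> z) \<in> spacetime_test"
proof -
  obtain a b where *: "smooth_fun \<phi>" "\<And>t. periodic2 (\<lambda>x. \<phi> (t, x))" "0 < a" "a < b" "time_supp a b \<phi>"
    using assms(1) by (rule spacetime_testE) blast
  obtain c d where **: "smooth_fun \<psi>" "\<And>t. periodic2 (\<lambda>x. \<psi> (t, x))" "0 < c" "c < d" "time_supp c d \<psi>"
    using assms(2) by (rule spacetime_testE) blast
  show ?thesis
    by (rule spacetime_testI[of _ "min a c" "max b d"])
      (use * ** in \<open>auto simp: smooth_fun_add periodic2_def time_supp_def min_def max_def split: if_splits\<close>)
qed

lemma spacetime_test_uminus:
  assumes "\<psi> \<in> spacetime_test"
  shows "(\<lambda>z. - \<psi> z) \<in> spacetime_test"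
proof -
  obtain a b where *: "smooth_fun \<psi>" "\<And>t. periodic2 (\<lambda>x. \<psi> (t, x))" "0 < a" "a < b" "time_supp a b \<psi>"
    using assms(1) by (rule spacetime_testE) blast
  have "smooth_fun (\<lambda>z. - \<psi> z)"
    by (rule smooth_fun_linear[OF bounded_linear_minus[OF bounded_linear_ident] *(1)])
  then show ?thesis
    by (rule spacetime_testI[of _ a b]) (use * in \<open>auto simp: periodic2_def time_supp_def\<close>)
qed

text \<open>Derivatives in \<open>x\<close> commute with fixing the time, so the operator can be
  applied before slicing and yields another space-time test function.\<close>

lemma spacetime_test_weight_op:
  assumes "\<psi> \<in> spacetime_test"
  obtains \<phi> where "\<phi> \<in> spacetime_test" "\<And>t. weight_op (slice \<psi> t) = slice \<phi> t"
proof -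
  have B: "(0, e1) \<in> Basis" "(0, e2) \<in> Basis" by (auto simp: Basis_prod_def e1_def e2_def)
  note P = spacetime_test_pderiv_dir[OF _ B(1)] spacetime_test_pderiv_dir[OF _ B(2)]
  have sm: "smooth_fun \<phi>" if "\<phi> \<in> spacetime_test" for \<phi> using that by (auto simp: spacetime_test_def)
  define d1 where "d1 = (pderiv_dir (0, e1) :: _ \<Rightarrow> real \<times> plane \<Rightarrow> real)"
  define d2 where "d2 = (pderiv_dir (0, e2) :: _ \<Rightarrow> real \<times> plane \<Rightarrow> real)"
  have d: "d1 \<phi> \<in> spacetime_test" "d2 \<phi> \<in> spacetime_test" if "\<phi> \<in> spacetime_test" for \<phi>
    using P that by (auto simp: d1_def d2_def)
  have sl: "pderiv_dir e1 (slice \<phi> t) = slice (d1 \<phi>) t" "pderiv_dir e2 (slice \<phi> t) = slice (d2 \<phi>) t"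
    if "\<phi> \<in> spacetime_test" for \<phi> t
    using pderiv_dir_slice_eq[OF sm[OF that]] by (auto simp: d1_def d2_def)
  show ?thesis
  proof (rule that)
    show "(\<lambda>z. ((\<psi> z + - d1 (d1 \<psi>) z) + - d2 (d2 \<psi>) z) + d1 (d1 (d2 (d2 \<psi>))) z) \<in> spacetime_test"
      using assms by (intro spacetime_test_add spacetime_test_uminus d)
    show "weight_op (slice \<psi> t)
        = slice (\<lambda>z. ((\<psi> z + - d1 (d1 \<psi>) z) + - d2 (d2 \<psi>) z) + d1 (d1 (d2 (d2 \<psi>))) z) t" for t
      by (simp add: weight_op_def sl d assms) (simp add: slice_def)
  qed
qed

lemma spacetime_test_funpow_weight_op:
  assumes "\<psi> \<in> spacetime_test"
  shows "\<exists>\<phi>\<in>spacetime_test. \<forall>t. (weight_op ^^ N) (slice \<psi> t) = slice \<phi> t"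
proof (induction N)
  case 0
  then show ?case using assms by auto
next
  case (Suc N)
  then obtain \<phi> where p: "\<phi> \<in> spacetime_test" "\<And>t. (weight_op ^^ N) (slice \<psi> t) = slice \<phi> t" by blast
  obtain \<xi> where "\<xi> \<in> spacetime_test" "\<And>t. weight_op (slice \<phi> t) = slice \<xi> t"
    using spacetime_test_weight_op[OF p(1)] by blast
  then show ?case using p(2) by (intro bexI[of _ \<xi>]) auto
qed

lemma spacetime_test_bounded:
  assumes "\<psi> \<in> spacetime_test"
  obtains B where "\<And>t x. x \<in> torus \<Longrightarrow> \<bar>\<psi> (t, x)\<bar> \<le> B"
proof -
  obtain a b where *: "smooth_fun \<psi>" "a < b" "time_supp a b \<psi>"
    using assms(1) by (rule spacetime_testE) blast
  have "compact (\<psi> ` ({a..b} \<times> torus))"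
    by (intro compact_continuous_image smooth_fun_continuous_on[OF *(1)] compact_Times) (auto simp: torus_def)
  then have "bounded (\<psi> ` ({a..b} \<times> torus))" by (rule compact_imp_bounded)
  then obtain B where "\<forall>y\<in>\<psi> ` ({a..b} \<times> torus). norm y \<le> B" unfolding bounded_iff by blast
  then have B: "\<bar>\<psi> z\<bar> \<le> B" if "z \<in> {a..b} \<times> torus" for z
    using that by (metis imageI real_norm_def)
  have "\<bar>\<psi> (t, x)\<bar> \<le> max B 0" if "x \<in> torus" for t x
  proof (cases "t \<in> {a..b}")
    case True
    then show ?thesis using B[of "(t, x)"] that by simp
  next
    case False
    then have "\<psi> (t, x) = 0" using *(3) unfolding time_supp_def by blast
    then show ?thesis by simp
  qed
  then show ?thesis using that by blast
qed

text \<open>Uniformity in \<open>t\<close> comes from bounding a single space-time function, whose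
  supremum is taken over a compact set, instead of each slice separately.\<close>

lemma fhat_slice_decay:
  assumes "\<psi> \<in> spacetime_test"
  obtains C where "\<And>t k. weight k ^ N * cmod (fhat (slice \<psi> t) k) \<le> C"
proof -
  obtain \<phi> where p: "\<phi> \<in> spacetime_test" "\<And>t. (weight_op ^^ N) (slice \<psi> t) = slice \<phi> t"
    using spacetime_test_funpow_weight_op[OF assms] by blast
  obtain B where B: "\<And>t x. x \<in> torus \<Longrightarrow> \<bar>\<phi> (t, x)\<bar> \<le> B"
    using spacetime_test_bounded[OF p(1)] by blast
  have "weight k ^ N * cmod (fhat (slice \<psi> t) k) \<le> B" for t k
  proof -
    have "cmod (fhat (slice \<phi> t) k) \<le> B"
      using B by (intro norm_fhat_le torus_test_continuous_on slice_torus_test p(1)) (simp add: slice_def)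
    moreover have "fhat (slice \<phi> t) k = of_real (weight k ^ N) * fhat (slice \<psi> t) k"
      using funpow_weight_op(2)[OF slice_torus_test[OF assms], of N t k] p(2) by simp
    ultimately show ?thesis
      using weight_ge_1[of k] by (simp add: norm_mult norm_power)
  qed
  then show ?thesis using that by blast
qed

lemma fhat_slice_eq_0:
  assumes "time_supp a b \<psi>" "t \<notin> {a..b}"
  shows "fhat (slice \<psi> t) k = 0"
proof -
  have "slice \<psi> t = (\<lambda>x. 0)" using assms by (auto simp: slice_def time_supp_def)
  then show ?thesis by (simp add: fhat_def)
qed

lemma continuous_on_fhat_slice:
  assumes "\<psi> \<in> spacetime_test"
  shows "continuous_on A (\<lambda>t. fhat (slice \<psi> t) k)"
proof -
  have c: "continuous_on UNIV \<psi>"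
    using assms by (auto simp: spacetime_test_def smooth_fun_continuous_on)
  have "continuous_on (A \<times> cbox (- pi, - pi) (pi, pi)) (\<lambda>(t, x). slice \<psi> t x * wave (- k) x)"
    unfolding slice_def case_prod_beta
    by (intro continuous_intros continuous_on_compose2[OF c] continuous_on_compose2[OF continuous_on_wave]) auto
  then show ?thesis
    unfolding fhat_def torus_def
    by (intro continuous_on_divide integral_continuous_on_param continuous_on_const) auto
qed

section \<open>The equation in Fourier variables\<close>

lemma distr_of_wave:
  assumes "continuous_on torus g"
  shows "distr_of (wave k) g = of_real ((2 * pi)\<^sup>2) * fhat g (- k)"
proof -
  have "distr_of (wave k) g = integral torus (\<lambda>x. g x * wave k x)"
    unfolding distr_of_def
    by (subst set_integral_torus) (auto intro!: continuous_intros assms simp: mult.commute)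
  then show ?thesis by (simp only: integral_torus_times_wave)
qed

text \<open>Orthogonality leaves a single nonzero summand, so the infinite sum in
  \<open>fourier_mult\<close> raises no question of convergence here. The scalar \<open>c\<close>
  accommodates the derivative of a wave, which occurs in \<open>riesz\<close>.\<close>

lemma fourier_mult_wave:
  "fourier_mult m T (\<lambda>x. c * wave (- k) x) = c * m k * fcoeff T k * of_real ((2 * pi)\<^sup>2)"
proof -
  have "fourier_mult m T (\<lambda>x. c * wave (- k) x)
      = (\<Sum>\<^sub>\<infinity>j\<in>{k}. m j * fcoeff T j * distr_of (wave j) (\<lambda>x. c * wave (- k) x))"
    unfolding fourier_mult_def
    by (rule infsum_cong_neutral)
      (auto simp: distr_of_wave continuous_intros fhat_cmult fhat_wave)
  then show ?thesis
    by (simp add: distr_of_wave continuous_intros fhat_cmult fhat_wave)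
qed

lemma fcoeff_fourier_mult: "fcoeff (fourier_mult m T) k = m k * fcoeff T k"
  using fourier_mult_wave[of m T 1 k] by (simp add: fcoeff_def)

definition lam :: "real \<Rightarrow> freq \<Rightarrow> real" where
  "lam s k = (if s = 0 then 1 else norm (vec_of k) powr s)"

lemma fcoeff_Lam: "fcoeff (Lam s T) k = of_real (lam s k) * fcoeff T k"
  by (simp add: Lam_def fcoeff_fourier_mult lam_def)

lemma has_sum_fcoeff_distr_mult:
  assumes "distribution T" "q \<in> torus_test"
  shows "((\<lambda>j. fcoeff T j * fhat q (k - j)) has_sum fcoeff (distr_mult q T) k) UNIV"
proof -
  have "fhat (\<lambda>x. q x * wave (- k) x) (- j) = fhat q (k - j)" for j
    by (simp add: fhat_def mult.assoc flip: wave_add)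
  then have "((\<lambda>j. fcoeff T j * (of_real ((2 * pi)\<^sup>2) * fhat q (k - j)))
      has_sum distr_mult q T (wave (- k))) UNIV"
    using distribution_has_sum[OF assms(1) torus_test_mult[OF assms(2) torus_test_wave], of "- k"]
    by (simp add: distr_mult_def)
  from has_sum_cmult_right[OF this, of "1 / of_real ((2 * pi)\<^sup>2)"] show ?thesis
    by (simp add: fcoeff_def mult_ac)
qed

text \<open>The Fourier symbol of the Riesz transform with its factor \<open>\<i>\<close> removed,
  so that it is real; at \<open>k = 0\<close> it is 0.\<close>

definition riesz_symbol :: "plane \<Rightarrow> freq \<Rightarrow> real" where
  "riesz_symbol e k = (vec_of k \<bullet> e) * lam (- 1) k"

lemma lam_minus_1: "lam (- 1) k = 1 / norm (vec_of k)"
  by (cases "k = 0") (simp_all add: lam_def powr_minus_divide)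

lemma abs_riesz_symbol_le_1:
  assumes "e \<in> Basis"
  shows "\<bar>riesz_symbol e k\<bar> \<le> 1"
  using Basis_le_norm[OF assms, of "vec_of k"]
  by (auto simp: riesz_symbol_def lam_minus_1 abs_mult divide_le_eq_1)

text \<open>The two halves of the commutator see the symbol at different places. Multiplying by
  \<open>q\<close> first leaves it at the output frequency \<open>k\<close>; multiplying last puts
  \<open>q\<close> into the test function, and the symbol is evaluated under the sum at
  \<open>j\<close>. As the symbol is bounded, the second series converges absolutely like the
  first.\<close>

lemma has_sum_fcoeff_riesz_comm:
  assumes T: "distribution T" and q: "q \<in> torus_test" and e: "e \<in> Basis"
  shows "((\<lambda>j. \<i> * of_real (riesz_symbol e k - riesz_symbol e j) * (fcoeff T j * fhat q (k - j)))
    has_sum fcoeff (riesz_comm e q T) k) UNIV"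
proof -
  let ?c = "of_real ((2 * pi)\<^sup>2) :: complex"
  let ?t = "\<lambda>j. fcoeff T j * fhat q (k - j)"
  note hs = has_sum_fcoeff_distr_mult[OF T q, of k]
  have A: "riesz e (distr_mult q T) (wave (- k)) = ?c * (\<i> * of_real (riesz_symbol e k) * fcoeff (distr_mult q T) k)"
    using fourier_mult_wave[of "\<lambda>k. of_real (lam (- 1) k)" "distr_mult q T" "\<i> * of_real (vec_of (- k) \<bullet> e)" k]
    by (simp add: riesz_def distr_deriv_def pderiv_dir_wave Lam_def lam_def riesz_symbol_def vec_of_minus mult_ac)
  have s: "(\<lambda>j. of_real (riesz_symbol e j) * ?t j) summable_on UNIV"
  proof (rule abs_summable_summable, rule summable_on_comparison_test)
    show "(\<lambda>j. norm (?t j)) summable_on UNIV"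
      by (rule summable_on_iff_abs_summable_on_complex[THEN iffD1, OF has_sum_imp_summable[OF hs]])
    show "norm (of_real (riesz_symbol e j) * ?t j) \<le> norm (?t j)" for j
      using abs_riesz_symbol_le_1[OF e, of j] by (simp add: norm_mult mult_left_le_one_le)
  qed simp
  have test: "(\<lambda>x. q x * wave (- k) x) \<in> torus_test"
    by (rule torus_test_mult[OF q torus_test_wave])
  have f: "fhat (\<lambda>x. q x * wave (- k) x) (- j) = fhat q (k - j)" for j
    by (simp add: fhat_def mult.assoc flip: wave_add)
  have "riesz e T (\<lambda>x. q x * wave (- k) x)
      = - (\<Sum>\<^sub>\<infinity>j. of_real (lam (- 1) j) * fcoeff T j * distr_of (wave j) (pderiv_dir e (\<lambda>x. q x * wave (- k) x)))"
    by (simp add: riesz_def distr_deriv_def Lam_def fourier_mult_def lam_def)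
  also have "\<dots> = - (\<Sum>\<^sub>\<infinity>j. - (?c * \<i>) * (of_real (riesz_symbol e j) * ?t j))"
    by (intro arg_cong[of _ _ uminus] infsum_cong)
      (simp add: distr_of_wave torus_test_continuous_on torus_test_pderiv_dir test e fhat_pderiv_dir f
        vec_of_minus riesz_symbol_def)
  also have "\<dots> = (?c * \<i>) * (\<Sum>\<^sub>\<infinity>j. of_real (riesz_symbol e j) * ?t j)"
    by (subst infsum_cmult_right') simp
  finally have B: "riesz e T (\<lambda>x. q x * wave (- k) x) = ?c * (\<i> * (\<Sum>\<^sub>\<infinity>j. of_real (riesz_symbol e j) * ?t j))"
    by (simp add: mult.assoc)
  have C: "fcoeff (riesz_comm e q T) k
      = \<i> * of_real (riesz_symbol e k) * fcoeff (distr_mult q T) k - \<i> * (\<Sum>\<^sub>\<infinity>j. of_real (riesz_symbol e j) * ?t j)"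
    using A B by (simp add: fcoeff_def riesz_comm_def distr_mult_def diff_divide_distrib)
  show ?thesis
    unfolding C
    using has_sum_add[OF has_sum_cmult_right[OF hs, of "\<i> * of_real (riesz_symbol e k)"]
        has_sum_cmult_right[OF has_sum_infsum[OF s], of "- \<i>"]]
    by (simp add: algebra_simps)
qed

text \<open>Real, because the \<open>\<i>\<close> of the Riesz transform and the \<open>\<i>\<close>
  from differentiating the test function multiply to -1; the signs here have absorbed it.\<close>

definition sqg_kernel :: "freq \<Rightarrow> freq \<Rightarrow> real" where
  "sqg_kernel k j = (riesz_symbol e2 k - riesz_symbol e2 j) * (vec_of (k - j) \<bullet> e1)
    - (riesz_symbol e1 k - riesz_symbol e1 j) * (vec_of (k - j) \<bullet> e2)"

lemma has_sum_fcoeff_riesz_perp_comm: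
  assumes T: "distribution T" and p: "p \<in> torus_test"
  shows "((\<lambda>j. of_real (sqg_kernel k j) * (fcoeff T j * fhat p (k - j)))
    has_sum fcoeff (riesz_perp_comm p T) k) UNIV"
proof -
  have C: "fcoeff (riesz_perp_comm p T) k
      = - fcoeff (riesz_comm e2 (pderiv_dir e1 p) T) k + fcoeff (riesz_comm e1 (pderiv_dir e2 p) T) k"
    by (simp add: fcoeff_def riesz_perp_comm_def diff_divide_distrib)
  have ii: "\<i> * a * (b * (\<i> * c * d)) = - (a * c * (b * d))" for a b c d
    by (simp add: algebra_simps)
  show ?thesis
    unfolding C
    using has_sum_add[OF has_sum_uminusI[OF has_sum_fcoeff_riesz_comm[OF T torus_test_pderiv_dir[OF p e1_e2_Basis(1)] e1_e2_Basis(2), of k]]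
        has_sum_fcoeff_riesz_comm[OF T torus_test_pderiv_dir[OF p e1_e2_Basis(2)] e1_e2_Basis(1), of k]]
    by (simp add: fhat_pderiv_dir p ii sqg_kernel_def algebra_simps)
qed

text \<open>The commutator structure: with \<open>u\<^sub>k = k/|k|\<close> the kernel is the cross product
  \<open>(k - j) \<times> (u\<^sub>k - u\<^sub>j) = (k \<times> j)(1/|k| - 1/|j|)\<close>.\<close>

lemma abs_sqg_kernel_le:
  assumes "k \<noteq> 0" "j \<noteq> 0"
  shows "\<bar>sqg_kernel k j\<bar>
    \<le> (norm (vec_of (k - j)))\<^sup>2 * (norm (vec_of k) powr (- 1 / 2) * norm (vec_of j) powr (- 1 / 2))"
proof -
  define K where "K = norm (vec_of k)"
  define J where "J = norm (vec_of j)"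
  define D where "D = norm (vec_of (k - j))"
  have pos: "0 < K" "0 < J" "0 \<le> D" using assms by (simp_all add: K_def J_def D_def)
  obtain k1 k2 where k: "vec_of k = (k1, k2)" by fastforce
  obtain j1 j2 where j: "vec_of j = (j1, j2)" by fastforce
  have kj: "vec_of (k - j) = (k1 - j1, k2 - j2)"
    using vec_of_add[of k "- j"] by (simp add: vec_of_minus k j)
  define X where "X = k1 * j2 - k2 * j1"
  have cross: "\<bar>a1 * b2 - a2 * b1\<bar> \<le> norm (a1, a2) * norm (b1, b2)" for a1 a2 b1 b2 :: real
  proof -
    have "(a1 * b2 - a2 * b1)\<^sup>2 \<le> (a1\<^sup>2 + a2\<^sup>2) * (b1\<^sup>2 + b2\<^sup>2)"
      using zero_le_power2[of "a1 * b1 + a2 * b2"] by (simp add: power2_eq_square algebra_simps)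
    then have "\<bar>a1 * b2 - a2 * b1\<bar> \<le> sqrt ((a1\<^sup>2 + a2\<^sup>2) * (b1\<^sup>2 + b2\<^sup>2))"
      by (simp add: real_le_rsqrt)
    then show ?thesis by (simp add: norm_Pair real_sqrt_mult)
  qed
  have "\<bar>(k1 - j1) * j2 - (k2 - j2) * j1\<bar> \<le> D * J" "\<bar>k1 * (k2 - j2) - k2 * (k1 - j1)\<bar> \<le> K * D"
    using cross[of "k1 - j1" j2 "k2 - j2" j1] cross[of k1 "k2 - j2" k2 "k1 - j1"]
    by (simp_all add: D_def J_def K_def kj k j)
  \<comment> \<open>Replacing either vector by the difference \<open>k - j\<close> changes the cross
    product of \<open>k\<close> and \<open>j\<close> at most in sign. It is therefore at most
    \<open>D\<close> times either length, in particular times the smaller one.\<close>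
  moreover have "(k1 - j1) * j2 - (k2 - j2) * j1 = X" "k1 * (k2 - j2) - k2 * (k1 - j1) = - X"
    by (simp_all add: X_def algebra_simps)
  ultimately have X: "\<bar>X\<bar> \<le> D * min K J" by (simp add: min_def mult.commute)
  have eq: "sqg_kernel k j = X * ((J - K) / (K * J))"
    using pos unfolding sqg_kernel_def riesz_symbol_def lam_minus_1 K_def[symmetric] J_def[symmetric] kj
    by (simp add: k j e1_def e2_def X_def field_simps)
  have JK: "\<bar>J - K\<bar> \<le> D"
    using norm_triangle_ineq3[of "vec_of k" "vec_of j"] vec_of_add[of k "- j"]
    by (simp add: J_def K_def D_def vec_of_minus abs_minus_commute)
  have "\<bar>sqg_kernel k j\<bar> \<le> (D * min K J) * (D / (K * J))"
    unfolding eq abs_mult abs_divide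
    using X JK pos by (intro mult_mono divide_right_mono) (auto simp: abs_mult intro!: divide_right_mono)
  also have "\<dots> = D\<^sup>2 * (min K J / (K * J))" by (simp add: power2_eq_square)
  also have "\<dots> \<le> D\<^sup>2 * (K powr (- 1 / 2) * J powr (- 1 / 2))"
  proof (intro mult_left_mono)
    \<comment> \<open>Passing to the geometric mean shares the decay equally between
      \<open>k\<close> and \<open>j\<close>, as the \<open>H^(-1/2)\<close> norms of both factors
      require.\<close>
    have "min K J \<le> sqrt (K * J)"
      using pos by (intro real_le_rsqrt) (auto simp: power2_eq_square min_def intro!: mult_mono)
    then have "min K J / (K * J) \<le> sqrt (K * J) / (K * J)"
      using pos by (intro divide_right_mono) auto
    also have "\<dots> = 1 / (sqrt K * sqrt J)"
      using pos by (simp add: real_sqrt_mult real_div_sqrt field_simps)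
    also have "\<dots> = K powr (- 1 / 2) * J powr (- 1 / 2)"
      using pos by (simp add: powr_minus_divide powr_half_sqrt)
    finally show "min K J / (K * J) \<le> K powr (- 1 / 2) * J powr (- 1 / 2)" .
  qed simp
  finally show ?thesis by (simp add: D_def K_def J_def)
qed

section \<open>The nonlinear term as a double series\<close>

definition sqg_term :: "(freq \<Rightarrow> complex) \<Rightarrow> (freq \<Rightarrow> complex) \<Rightarrow> freq \<times> freq \<Rightarrow> complex" where
  "sqg_term p a = (\<lambda>(k, j). of_real ((2 * pi)\<^sup>2 * sqg_kernel k j) * cnj (p (k - j)) * (a k * cnj (a j)))"

text \<open>The factor \<open>weight m\<close> dominates the \<open>|k - j|^2\<close> of the kernel
  bound, so that this acts as the summable convolution kernel majorising the double series.\<close>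

definition conv_weight :: "(freq \<Rightarrow> complex) \<Rightarrow> freq \<Rightarrow> real" where
  "conv_weight p m = (2 * pi)\<^sup>2 * (weight m * cmod (p m))"

lemma conv_weight_nonneg: "0 \<le> conv_weight p m"
  using weight_ge_1[of m] by (simp add: conv_weight_def)

lemma norm_sqg_term_le:
  assumes "a 0 = 0"
  shows "cmod (sqg_term p a (k, j))
    \<le> conv_weight p (k - j) * ((norm (vec_of k) powr (- 1 / 2) * cmod (a k)) * (norm (vec_of j) powr (- 1 / 2) * cmod (a j)))"
proof (cases "k = 0 \<or> j = 0")
  case True
  then show ?thesis using assms by (auto simp: sqg_term_def)
next
  case False
  have "(norm (vec_of (k - j)))\<^sup>2 \<le> weight (k - j)"
    using weight_ge[of "k - j"] by simp
  then have "\<bar>sqg_kernel k j\<bar> \<le> weight (k - j) * (norm (vec_of k) powr (- 1 / 2) * norm (vec_of j) powr (- 1 / 2))"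
    using abs_sqg_kernel_le[of k j] False by (auto elim!: order_trans intro!: mult_right_mono)
  then have "\<bar>sqg_kernel k j\<bar> * ((2 * pi)\<^sup>2 * cmod (p (k - j)) * (cmod (a k) * cmod (a j)))
      \<le> weight (k - j) * (norm (vec_of k) powr (- 1 / 2) * norm (vec_of j) powr (- 1 / 2))
        * ((2 * pi)\<^sup>2 * cmod (p (k - j)) * (cmod (a k) * cmod (a j)))"
    by (rule mult_right_mono) simp
  then show ?thesis
    by (simp add: sqg_term_def conv_weight_def norm_mult norm_power abs_mult mult_ac)
qed

text \<open>Schur's test: once a product of two coefficients has been split into squares, each half
  of the double sum factorises after the substitution \<open>m = k - j\<close>.\<close>

lemma has_sum_convolution:
  fixes b y :: "freq \<Rightarrow> real"
  assumes b: "(b has_sum B) UNIV" "\<And>k. 0 \<le> b k" and y: "(y has_sum Y) UNIV" "\<And>k. 0 \<le> y k"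
  shows "((\<lambda>(k, j). b (k - j) * (y k + y j)) has_sum 2 * (B * Y)) UNIV"
proof -
  have prod: "((\<lambda>(m, k). b m * y k) has_sum B * Y) (UNIV \<times> UNIV)"
  proof (rule has_sum_SigmaI)
    show "((\<lambda>k. case (m, k) of (m, k) \<Rightarrow> b m * y k) has_sum b m * Y) UNIV" for m
      using has_sum_cmult_right[OF y(1)] by simp
    show "((\<lambda>m. b m * Y) has_sum B * Y) UNIV"
      by (rule has_sum_cmult_left[OF b(1)])
    show "(\<lambda>(m, k). b m * y k) summable_on UNIV \<times> UNIV"
    proof (rule summable_on_SigmaI)
      show "((\<lambda>k. case (m, k) of (m, k) \<Rightarrow> b m * y k) has_sum b m * Y) UNIV" for m
        using has_sum_cmult_right[OF y(1)] by simp
      show "(\<lambda>m. b m * Y) summable_on UNIV"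
        using has_sum_cmult_left[OF b(1)] has_sum_imp_summable by blast
    qed (use assms in auto)
  qed
  have 1: "((\<lambda>(k, j). b (k - j) * y k) has_sum B * Y) UNIV"
    by (rule has_sum_reindex_bij_witness[where i = "\<lambda>(m, k). (k, k - m)" and j = "\<lambda>(k, j). (k - j, k)", THEN iffD2, OF _ _ _ _ _ refl prod])
      auto
  have 2: "((\<lambda>(k, j). b (k - j) * y j) has_sum B * Y) UNIV"
    by (rule has_sum_reindex_bij_witness[where i = "\<lambda>(m, j). (m + j, j)" and j = "\<lambda>(k, j). (k - j, j)", THEN iffD2, OF _ _ _ _ _ refl prod])
      auto
  show ?thesis
    using has_sum_add[OF 1 2] by (simp add: case_prod_unfold distrib_left)
qed

subsection \<open>Weighted coefficient sequences\<close>

text \<open>As \<open>0 powr s = 0\<close> for every \<open>s\<close>, the zero mode always has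
  weight 0, and sums can run over all frequencies instead of \<open>- {0}\<close>.\<close>

definition wcoeff :: "real \<Rightarrow> (freq \<Rightarrow> complex) \<Rightarrow> freq \<Rightarrow> real" where
  "wcoeff s a k = norm (vec_of k) powr s * cmod (a k)"

definition hnorm2 :: "real \<Rightarrow> (freq \<Rightarrow> complex) \<Rightarrow> real" where
  "hnorm2 s a = (\<Sum>\<^sub>\<infinity>k. (wcoeff s a k)\<^sup>2)"

definition hseq :: "real \<Rightarrow> (freq \<Rightarrow> complex) \<Rightarrow> bool" where
  "hseq s a \<longleftrightarrow> (\<lambda>k. (wcoeff s a k)\<^sup>2) summable_on UNIV"

lemma wcoeff_nonneg: "0 \<le> wcoeff s a k"
  by (simp add: wcoeff_def)

lemma wcoeff_0 [simp]: "wcoeff s a 0 = 0"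
  by (simp add: wcoeff_def)

lemma wcoeff_sq: "(wcoeff s a k)\<^sup>2 = norm (vec_of k) powr (2 * s) * (cmod (a k))\<^sup>2"
  by (simp add: wcoeff_def power_mult_distrib power2_eq_square powr_add[symmetric])

lemma hnorm2_nonneg: "0 \<le> hnorm2 s a"
  unfolding hnorm2_def by (rule infsum_nonneg) simp

lemma hseq_has_sum: "hseq s a \<Longrightarrow> ((\<lambda>k. (wcoeff s a k)\<^sup>2) has_sum hnorm2 s a) UNIV"
  by (simp add: hseq_def hnorm2_def)

lemma norm_vec_of_ge_1:
  assumes "k \<noteq> 0"
  shows "1 \<le> norm (vec_of k)"
proof -
  have "1 \<le> \<bar>fst k\<bar> \<or> 1 \<le> \<bar>snd k\<bar>"
    using assms by (cases k) (auto simp: zero_prod_def)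
  then have "1 \<le> \<bar>real_of_int (fst k)\<bar> \<or> 1 \<le> \<bar>real_of_int (snd k)\<bar>" by linarith
  moreover have "\<bar>real_of_int (fst k)\<bar> \<le> norm (vec_of k)" "\<bar>real_of_int (snd k)\<bar> \<le> norm (vec_of k)"
    using norm_fst_le[of "real_of_int (fst k)" "real_of_int (snd k)"]
      norm_snd_le[of "real_of_int (snd k)" "real_of_int (fst k)"] by (simp_all add: vec_of_def)
  ultimately show ?thesis by linarith
qed

lemma norm_vec_of_powr_mono:
  assumes "r \<le> s"
  shows "norm (vec_of k) powr r \<le> norm (vec_of k) powr s"
  using assms norm_vec_of_ge_1[of k] by (cases "k = 0") (auto intro: powr_mono)

lemma wcoeff_mono: "r \<le> s \<Longrightarrow> wcoeff r a k \<le> wcoeff s a k"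
  unfolding wcoeff_def by (intro mult_right_mono norm_vec_of_powr_mono) auto

lemma hseq_mono:
  assumes "r \<le> s" "hseq s a"
  shows "hseq r a" "hnorm2 r a \<le> hnorm2 s a"
proof -
  have le: "(wcoeff r a k)\<^sup>2 \<le> (wcoeff s a k)\<^sup>2" for k
    using wcoeff_mono[OF assms(1)] wcoeff_nonneg by (intro power_mono)
  show *: "hseq r a"
    unfolding hseq_def
    by (rule summable_on_comparison_test[OF assms(2)[unfolded hseq_def]]) (use le in auto)
  show "hnorm2 r a \<le> hnorm2 s a"
    unfolding hnorm2_def using le * assms(2) by (intro infsum_mono) (auto simp: hseq_def)
qed

lemma wcoeff_add_sq_le: "(wcoeff s (\<lambda>k. a k + b k) k)\<^sup>2 \<le> 2 * (wcoeff s a k)\<^sup>2 + 2 * (wcoeff s b k)\<^sup>2"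
proof -
  have "wcoeff s (\<lambda>k. a k + b k) k \<le> wcoeff s a k + wcoeff s b k"
    unfolding wcoeff_def distrib_left[symmetric] by (intro mult_left_mono norm_triangle_ineq) auto
  then have "(wcoeff s (\<lambda>k. a k + b k) k)\<^sup>2 \<le> (wcoeff s a k + wcoeff s b k)\<^sup>2"
    by (intro power_mono wcoeff_nonneg)
  also have "\<dots> \<le> 2 * (wcoeff s a k)\<^sup>2 + 2 * (wcoeff s b k)\<^sup>2"
    using sum_squares_bound[of "wcoeff s a k" "wcoeff s b k"] by (simp add: power2_sum)
  finally show ?thesis .
qed

lemma hseq_add:
  assumes "hseq s a" "hseq s b"
  shows "hseq s (\<lambda>k. a k + b k)"
  unfolding hseq_def
proof (rule summable_on_comparison_test)
  show "(\<lambda>k. 2 * (wcoeff s a k)\<^sup>2 + 2 * (wcoeff s b k)\<^sup>2) summable_on UNIV"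
    using assms unfolding hseq_def by (intro summable_on_add summable_on_cmult_right)
qed (simp_all add: wcoeff_add_sq_le)

lemma hseq_cmult: "hseq s a \<Longrightarrow> hseq s (\<lambda>k. c * a k)"
  unfolding hseq_def wcoeff_def norm_mult
  by (drule summable_on_cmult_right[of _ _ "(cmod c)\<^sup>2"]) (simp add: power_mult_distrib mult_ac)

lemma hseq_diff: "hseq s a \<Longrightarrow> hseq s b \<Longrightarrow> hseq s (\<lambda>k. a k - b k)"
  using hseq_add[OF _ hseq_cmult[of s b "- 1"], of a] by simp

lemma norm_le_hnorm2:
  assumes "hseq s a" "k \<noteq> 0"
  shows "(cmod (a k))\<^sup>2 \<le> norm (vec_of k) powr (- 2 * s) * hnorm2 s a"
proof -
  have "(wcoeff s a k)\<^sup>2 \<le> hnorm2 s a"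
    using finite_sum_le_has_sum[OF hseq_has_sum[OF assms(1)], of "{k}"] by simp
  then have "norm (vec_of k) powr (- 2 * s) * (wcoeff s a k)\<^sup>2 \<le> norm (vec_of k) powr (- 2 * s) * hnorm2 s a"
    by (rule mult_left_mono) simp
  then show ?thesis
    using assms(2) by (simp add: wcoeff_sq mult.assoc[symmetric] powr_add[symmetric])
qed

lemma sobolev_spaceD:
  assumes "T \<in> sobolev_space s"
  shows "distribution T" "fcoeff T 0 = 0" "hseq s (fcoeff T)"
proof -
  show "distribution T" "fcoeff T 0 = 0" using assms by (auto simp: sobolev_space_def)
  have "(\<lambda>k. (wcoeff s (fcoeff T) k)\<^sup>2) summable_on - {0}"
    using assms by (simp add: sobolev_space_def wcoeff_sq)
  then show "hseq s (fcoeff T)"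
    unfolding hseq_def by (rule summable_on_cong_neutral[THEN iffD1, rotated 3]) auto
qed

lemma sobolev_space_iff:
  "T \<in> sobolev_space s \<longleftrightarrow> distribution T \<and> real_valued T \<and> fcoeff T 0 = 0 \<and> hseq s (fcoeff T)"
proof -
  have "(\<lambda>k. (wcoeff s (fcoeff T) k)\<^sup>2) summable_on - {0}" if "hseq s (fcoeff T)"
    using that unfolding hseq_def by (rule summable_on_subset) auto
  then show ?thesis
    using sobolev_spaceD[of T s] unfolding sobolev_space_def mem_Collect_eq wcoeff_sq[symmetric]
    by blast
qed

lemma sobolev_space_mono: "r \<le> s \<Longrightarrow> T \<in> sobolev_space s \<Longrightarrow> T \<in> sobolev_space r"
  using hseq_mono(1) by (auto simp: sobolev_space_iff)

lemma sobolev_norm_sq: "(sobolev_norm s T)\<^sup>2 = hnorm2 s (fcoeff T)"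
proof -
  have "hnorm2 s (fcoeff T) = (\<Sum>\<^sub>\<infinity>k\<in>- {0}. norm (vec_of k) powr (2 * s) * (cmod (fcoeff T k))\<^sup>2)"
    unfolding hnorm2_def wcoeff_sq[symmetric] by (rule infsum_cong_neutral) auto
  then show ?thesis
    using hnorm2_nonneg[of s "fcoeff T"] by (simp add: sobolev_norm_def)
qed

subsection \<open>Truncation of the nonlinear term\<close>

text \<open>One majorant is used with two constants: the crude \<open>M\<close> gives summability,
  the small \<open>e\<close> off \<open>F\<close> gives the remainder.\<close>

lemma has_sum_tail_bound:
  fixes f :: "'i \<Rightarrow> 'b::banach"
  assumes g: "(g has_sum G) UNIV" "\<And>i. norm (f i) \<le> M * g i" "\<And>i. 0 \<le> g i" and "finite F" "0 \<le> e"
    and tail: "\<And>i. i \<notin> F \<Longrightarrow> norm (f i) \<le> e * g i"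
  shows "f summable_on UNIV" "norm (infsum f UNIV - sum f F) \<le> e * G"
proof -
  have "(\<lambda>i. norm (f i)) summable_on UNIV"
    by (rule summable_on_comparison_test[OF has_sum_imp_summable[OF has_sum_cmult_right[OF g(1)]] g(2)]) simp
  then show s: "f summable_on UNIV" by (rule abs_summable_summable)
  have "infsum f UNIV = sum f F + infsum f (- F)"
    using infsum_Un_disjoint[of f F "- F"] summable_on_subset_banach[OF s] assms(4) by (simp add: Compl_partition)
  then have "norm (infsum f UNIV - sum f F) = norm (infsum f (- F))" by simp
  also have "\<dots> \<le> (\<Sum>\<^sub>\<infinity>i\<in>- F. e * g i)"
  proof (rule norm_infsum_le)
    show "(f has_sum infsum f (- F)) (- F)"
      using summable_on_subset_banach[OF s] by simp
    show "((\<lambda>i. e * g i) has_sum (\<Sum>\<^sub>\<infinity>i\<in>- F. e * g i)) (- F)"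
      using summable_on_subset_banach[OF has_sum_imp_summable[OF has_sum_cmult_right[OF g(1), of e]]] by simp
  qed (use tail in auto)
  also have "\<dots> \<le> (\<Sum>\<^sub>\<infinity>i. e * g i)"
    using has_sum_imp_summable[OF has_sum_cmult_right[OF g(1), of e]] assms(3,5)
      summable_on_subset_banach[OF has_sum_imp_summable[OF has_sum_cmult_right[OF g(1), of e]], of "- F"]
    by (intro infsum_mono_neutral) auto
  also have "\<dots> = e * G"
    using has_sum_cmult_right[OF g(1)] by (rule infsumI)
  finally show "norm (infsum f UNIV - sum f F) \<le> e * G" .
qed

text \<open>A gain at one of the two frequencies is enough, since the other factor is controlled by
  \<open>- 1 / 2 \<le> s\<close> alone. Outside a square \<open>F \<times> F\<close> of low modes at
  least one of \<open>k\<close> and \<open>j\<close> is high, which is why the hypothesis is a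
  disjunction.\<close>

lemma norm_sqg_term_le_hs:
  assumes "a 0 = 0" "- 1 / 2 \<le> s" and e: "norm (vec_of k) powr (- 1 / 2) \<le> e * norm (vec_of k) powr s
      \<or> norm (vec_of j) powr (- 1 / 2) \<le> e * norm (vec_of j) powr s" and "0 \<le> e"
  shows "cmod (sqg_term p a (k, j))
    \<le> (e / 2) * (conv_weight p (k - j) * ((wcoeff s a k)\<^sup>2 + (wcoeff s a j)\<^sup>2))"
proof -
  have w: "norm (vec_of i) powr (- 1 / 2) * cmod (a i) \<le> wcoeff s a i" for i
    unfolding wcoeff_def using assms(2) by (intro mult_right_mono norm_vec_of_powr_mono) auto
  have we: "norm (vec_of i) powr (- 1 / 2) * cmod (a i) \<le> e * wcoeff s a i"
    if "norm (vec_of i) powr (- 1 / 2) \<le> e * norm (vec_of i) powr s" for i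
    using mult_right_mono[OF that, of "cmod (a i)"] by (simp add: wcoeff_def mult.assoc)
  have "(norm (vec_of k) powr (- 1 / 2) * cmod (a k)) * (norm (vec_of j) powr (- 1 / 2) * cmod (a j))
      \<le> e * (wcoeff s a k * wcoeff s a j)"
    using e
  proof
    assume "norm (vec_of k) powr (- 1 / 2) \<le> e * norm (vec_of k) powr s"
    from mult_mono[OF we[OF this] w[of j]] show ?thesis
      using assms(4) wcoeff_nonneg by (simp add: mult_ac)
  next
    assume "norm (vec_of j) powr (- 1 / 2) \<le> e * norm (vec_of j) powr s"
    from mult_mono[OF w[of k] we[OF this]] show ?thesis
      using assms(4) wcoeff_nonneg by (simp add: mult_ac)
  qed
  also have "\<dots> \<le> e * (((wcoeff s a k)\<^sup>2 + (wcoeff s a j)\<^sup>2) / 2)"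
    using sum_squares_bound[of "wcoeff s a k" "wcoeff s a j"] assms(4) by (intro mult_left_mono) auto
  finally have "conv_weight p (k - j) * ((norm (vec_of k) powr (- 1 / 2) * cmod (a k)) * (norm (vec_of j) powr (- 1 / 2) * cmod (a j)))
      \<le> conv_weight p (k - j) * (e * (((wcoeff s a k)\<^sup>2 + (wcoeff s a j)\<^sup>2) / 2))"
    by (intro mult_left_mono conv_weight_nonneg)
  with norm_sqg_term_le[of a p k j, OF assms(1)] show ?thesis by (simp add: mult_ac)
qed

lemma sqg_term_truncation:
  assumes a: "a 0 = 0" "hseq s a" "- 1 / 2 \<le> s" and p: "(conv_weight p has_sum B) UNIV"
    and F: "finite F" "\<And>k. k \<notin> F \<Longrightarrow> norm (vec_of k) powr (- 1 / 2) \<le> e * norm (vec_of k) powr s" and e: "0 \<le> e"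
  shows "sqg_term p a summable_on UNIV"
    and "cmod (infsum (sqg_term p a) UNIV - sum (sqg_term p a) (F \<times> F)) \<le> e * (B * hnorm2 s a)"
proof -
  let ?g = "\<lambda>(k, j). conv_weight p (k - j) * ((wcoeff s a k)\<^sup>2 + (wcoeff s a j)\<^sup>2)"
  have g: "(?g has_sum 2 * (B * hnorm2 s a)) UNIV"
    by (rule has_sum_convolution[OF p conv_weight_nonneg hseq_has_sum[OF a(2)]]) simp
  have 1: "cmod (sqg_term p a i) \<le> (1 / 2) * ?g i" for i :: "freq \<times> freq"
  proof -
    obtain k j where i: "i = (k, j)" by (rule prod.exhaust)
    have "norm (vec_of k) powr (- 1 / 2) \<le> 1 * norm (vec_of k) powr s"
      using norm_vec_of_powr_mono[OF a(3)] by simp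
    then show ?thesis using norm_sqg_term_le_hs[of a s k 1 j p] a i by simp
  qed
  have 2: "cmod (sqg_term p a i) \<le> (e / 2) * ?g i" if "i \<notin> F \<times> F" for i :: "freq \<times> freq"
  proof -
    obtain k j where i: "i = (k, j)" by (rule prod.exhaust)
    have "k \<notin> F \<or> j \<notin> F" using that i by auto
    then have "norm (vec_of k) powr (- 1 / 2) \<le> e * norm (vec_of k) powr s
        \<or> norm (vec_of j) powr (- 1 / 2) \<le> e * norm (vec_of j) powr s"
      using F(2)[of k] F(2)[of j] by fast
    from norm_sqg_term_le_hs[of a s k e j p, OF a(1,3) this e] show ?thesis by (simp add: i)
  qed
  have 3: "0 \<le> ?g i" for i
    using conv_weight_nonneg by (auto simp: case_prod_unfold)
  have "finite (F \<times> F)" using F by simp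
  \<comment> \<open>The \<open>e / 2\<close> of the arithmetic-geometric inequality meets the
    \<open>2 * (B * hnorm2 s a)\<close> of the convolution, so that no constant remains.\<close>
  note T = has_sum_tail_bound[OF g 1 3 this _ 2]
  show "sqg_term p a summable_on UNIV" using T(1) e by auto
  show "cmod (infsum (sqg_term p a) UNIV - sum (sqg_term p a) (F \<times> F)) \<le> e * (B * hnorm2 s a)"
    using T(2) e by auto
qed

lemma sqg_term_summable:
  assumes "a 0 = 0" "hseq s a" "- 1 / 2 \<le> s" "(conv_weight p has_sum B) UNIV"
  shows "sqg_term p a summable_on UNIV" "cmod (infsum (sqg_term p a) UNIV) \<le> B * hnorm2 s a"
  \<comment> \<open>With no low modes at all and \<open>e = 1\<close> the truncation estimate
    becomes the plain bound of the form.\<close>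
  using sqg_term_truncation[OF assms, of "{}" 1] norm_vec_of_powr_mono[OF assms(3)] by simp_all

lemma finite_freq_ball: "finite {k. norm (vec_of k) \<le> R}"
proof (rule finite_subset)
  show "{k. norm (vec_of k) \<le> R} \<subseteq> {- \<lceil>R\<rceil>..\<lceil>R\<rceil>} \<times> {- \<lceil>R\<rceil>..\<lceil>R\<rceil>}"
  proof
    fix k assume "k \<in> {k. norm (vec_of k) \<le> R}"
    then have "\<bar>real_of_int (fst k)\<bar> \<le> R" "\<bar>real_of_int (snd k)\<bar> \<le> R"
      using norm_fst_le[of "real_of_int (fst k)" "real_of_int (snd k)"]
        norm_snd_le[of "real_of_int (snd k)" "real_of_int (fst k)"] by (auto simp: vec_of_def)
    then show "k \<in> {- \<lceil>R\<rceil>..\<lceil>R\<rceil>} \<times> {- \<lceil>R\<rceil>..\<lceil>R\<rceil>}"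
      by (cases k) (auto simp: le_ceiling_iff ceiling_le_iff abs_le_iff; linarith)
  qed
qed simp

text \<open>This is where the inequality \<open>- 1 / 2 < s\<close> must be strict: the ratio
  \<open>|k|^(- 1/2 - s)\<close> tends to 0. The radius \<open>R\<close> solves
  \<open>R powr (s + 1 / 2) = 1 / e\<close>.\<close>

lemma freq_truncation:
  assumes "- 1 / 2 < s" "0 < e"
  obtains F where "finite F" "\<And>k. k \<notin> F \<Longrightarrow> norm (vec_of k) powr (- 1 / 2) \<le> e * norm (vec_of k) powr s"
proof -
  define R where "R = (1 / e) powr (1 / (s + 1 / 2))"
  have "norm (vec_of k) powr (- 1 / 2) \<le> e * norm (vec_of k) powr s" if "norm (vec_of k) > R" for k
  proof -
    let ?K = "norm (vec_of k)"
    have R: "0 < R" using assms by (simp add: R_def)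
    have "1 / e = R powr (s + 1 / 2)"
      using assms by (simp add: R_def powr_powr)
    also have "\<dots> \<le> ?K powr (s + 1 / 2)"
      using that R assms by (intro powr_mono2) auto
    finally have "1 \<le> e * ?K powr (s + 1 / 2)" using assms by (simp add: field_simps)
    then have "?K powr (- 1 / 2) * 1 \<le> ?K powr (- 1 / 2) * (e * ?K powr (s + 1 / 2))"
      by (intro mult_left_mono) auto
    also have "\<dots> = e * ?K powr s"
      by (simp add: powr_add[symmetric])
    finally show ?thesis by simp
  qed
  then show ?thesis
    using that[of "{k. norm (vec_of k) \<le> R}"] finite_freq_ball by (auto simp: not_le)
qed

text \<open>The operators \<open>Lam (- 1/2)\<close> and \<open>Lam (1/2)\<close> cancel mode by
  mode, the zero mode being removed by the mean-zero condition. Joint summability over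
  \<open>(k, j)\<close> permits summing over \<open>j\<close> first, which produces the coefficients
  of the commutator.\<close>

lemma L2_inner_nonlinear:
  assumes T: "T \<in> sobolev_space s" and s: "- 1 / 2 \<le> s" and p: "p \<in> torus_test"
    and B: "(conv_weight (fhat p) has_sum B) UNIV"
  shows "L2_inner (Lam (- 1/2) T) (Lam (1/2) (riesz_perp_comm p T)) = infsum (sqg_term (fhat p) (fcoeff T)) UNIV"
proof -
  let ?a = "fcoeff T" and ?N = "fcoeff (riesz_perp_comm p T)" and ?c = "of_real ((2 * pi)\<^sup>2) :: complex"
  note D = sobolev_spaceD[OF T]
  have "(sqg_term (fhat p) ?a has_sum infsum (sqg_term (fhat p) ?a) UNIV) (UNIV \<times> UNIV)"
    using sqg_term_summable(1)[OF D(2,3) s B] by simp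
  moreover have "((\<lambda>j. sqg_term (fhat p) ?a (k, j)) has_sum ?c * (?a k * cnj (?N k))) UNIV" for k
  proof -
    have "((\<lambda>j. cnj (of_real (sqg_kernel k j) * (?a j * fhat p (k - j)))) has_sum cnj (?N k)) UNIV"
      using has_sum_fcoeff_riesz_perp_comm[OF D(1) p, of k] by (simp only: has_sum_cnj_iff)
    from has_sum_cmult_right[OF this, of "?c * ?a k"] show ?thesis
      by (simp add: sqg_term_def mult_ac)
  qed
  ultimately have "((\<lambda>k. ?c * (?a k * cnj (?N k))) has_sum infsum (sqg_term (fhat p) ?a) UNIV) UNIV"
    by (rule has_sum_SigmaD)
  then have "infsum (sqg_term (fhat p) ?a) UNIV = (\<Sum>\<^sub>\<infinity>k. ?c * (?a k * cnj (?N k)))"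
    by (rule infsumI[symmetric])
  also have "\<dots> = ?c * (\<Sum>\<^sub>\<infinity>k. ?a k * cnj (?N k))"
    by (rule infsum_cmult_right')
  also have "(\<Sum>\<^sub>\<infinity>k. ?a k * cnj (?N k))
      = (\<Sum>\<^sub>\<infinity>k. fcoeff (Lam (- 1/2) T) k * cnj (fcoeff (Lam (1/2) (riesz_perp_comm p T)) k))"
  proof (rule infsum_cong)
    fix k :: freq
    show "?a k * cnj (?N k) = fcoeff (Lam (- 1/2) T) k * cnj (fcoeff (Lam (1/2) (riesz_perp_comm p T)) k)"
    proof (cases "k = 0")
      case False
      then have "lam (- 1/2) k * lam (1/2) k = 1"
        by (simp add: lam_def powr_add[symmetric])
      then have "complex_of_real (lam (- 1/2) k) * complex_of_real (lam (1/2) k) = 1"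
        by (metis of_real_1 of_real_mult)
      then show ?thesis by (simp add: fcoeff_Lam mult_ac flip: mult.assoc)
    qed (simp add: fcoeff_Lam D)
  qed
  finally show ?thesis by (simp add: L2_inner_def)
qed

section \<open>Square integrable functions of time with values in a Sobolev space\<close>

lemma AE_lebesgue_on_iff:
  "S \<in> sets lebesgue \<Longrightarrow> (AE x in lebesgue_on S. P x) \<longleftrightarrow> (AE x in lebesgue. x \<in> S \<longrightarrow> P x)"
  by (simp add: AE_restrict_space_iff)

lemma AE_lebesgue_on_subset:
  assumes "S \<in> sets lebesgue" "A \<in> sets lebesgue" "A \<subseteq> S" "AE x in lebesgue_on S. P x"
  shows "AE x in lebesgue_on A. P x"
  using assms(3,4) unfolding AE_lebesgue_on_iff[OF assms(1)] AE_lebesgue_on_iff[OF assms(2)]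
  by (auto elim!: eventually_mono)

text \<open>Completeness of Lebesgue measure. A time-dependent distribution is known to lie in a
  Sobolev space only at almost every time, so identities between its terms hold only there.\<close>

lemma borel_measurable_lebesgue_on_AE:
  fixes f g :: "'a::euclidean_space \<Rightarrow> 'b::euclidean_space"
  assumes S: "S \<in> sets lebesgue" and f: "f \<in> borel_measurable (lebesgue_on S)"
    and ae: "AE x in lebesgue_on S. f x = g x"
  shows "g \<in> borel_measurable (lebesgue_on S)"
proof -
  have "(\<lambda>x. if x \<in> S then f x else 0) \<in> borel_measurable lebesgue"
    using f borel_measurable_if[OF S] by blast
  moreover have "AE x in lebesgue. (if x \<in> S then f x else 0) = (if x \<in> S then g x else 0)"
    using ae unfolding AE_lebesgue_on_iff[OF S] by eventually_elim auto
  ultimately have "(\<lambda>x. if x \<in> S then g x else 0) \<in> borel_measurable lebesgue"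
    by (rule borel_measurable_AE)
  then show ?thesis using borel_measurable_if[OF S] by blast
qed

lemma borel_measurable_lebesgue_on_LIMSEQ:
  fixes f :: "nat \<Rightarrow> 'a::euclidean_space \<Rightarrow> 'b::euclidean_space"
  assumes S: "S \<in> sets lebesgue" and f: "\<And>n. f n \<in> borel_measurable (lebesgue_on S)"
    and lim: "AE x in lebesgue_on S. (\<lambda>n. f n x) \<longlonglongrightarrow> g x"
  shows "g \<in> borel_measurable (lebesgue_on S)"
proof (rule borel_measurable_lebesgue_on_AE[OF S])
  show "(\<lambda>x. lim (\<lambda>n. f n x)) \<in> borel_measurable (lebesgue_on S)"
    by (rule borel_measurable_lim_metric[OF f])
  show "AE x in lebesgue_on S. lim (\<lambda>n. f n x) = g x"
    using lim by eventually_elim (rule limI)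
qed

text \<open>An unordered sum over a countable type becomes a sequential limit along an enumeration,
  a form in which measurability passes to the limit.\<close>

lemma has_sum_imp_LIMSEQ:
  fixes f :: "'i::countable \<Rightarrow> 'b::{comm_monoid_add, topological_space}"
  assumes "(f has_sum S) UNIV"
  shows "(\<lambda>n. sum f {k. to_nat k < n}) \<longlonglongrightarrow> S"
proof -
  have fin: "finite {k :: 'i. to_nat k < n}" for n
    by (rule finite_imageD[of to_nat, OF finite_subset[of _ "{..<n}"]]) (auto simp: inj_on_def)
  have "filterlim (\<lambda>n. {k :: 'i. to_nat k < n}) (finite_subsets_at_top UNIV) sequentially"
    unfolding filterlim_finite_subsets_at_top
  proof (intro allI impI)
    fix X :: "'i set" assume X: "finite X \<and> X \<subseteq> UNIV"
    have "\<forall>k\<in>X. \<forall>\<^sub>F n in sequentially. to_nat k < n"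
      using eventually_gt_at_top by blast
    then have "\<forall>\<^sub>F n in sequentially. \<forall>k\<in>X. to_nat k < n"
      using X by (simp add: eventually_ball_finite)
    then show "\<forall>\<^sub>F n in sequentially. finite {k :: 'i. to_nat k < n} \<and> X \<subseteq> {k. to_nat k < n} \<and> {k. to_nat k < n} \<subseteq> UNIV"
      by eventually_elim (use fin in auto)
  qed
  then show ?thesis
    using assms unfolding has_sum_def by (rule filterlim_compose[rotated])
qed

lemma borel_measurable_infsum:
  fixes f :: "'i::countable \<Rightarrow> 'a::euclidean_space \<Rightarrow> 'b::euclidean_space"
  assumes "S \<in> sets lebesgue" and "\<And>k. f k \<in> borel_measurable (lebesgue_on S)"
    and "AE x in lebesgue_on S. (\<lambda>k. f k x) summable_on UNIV"
  shows "(\<lambda>x. \<Sum>\<^sub>\<infinity>k. f k x) \<in> borel_measurable (lebesgue_on S)"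
proof (rule borel_measurable_lebesgue_on_LIMSEQ[OF assms(1)])
  show "(\<lambda>x. \<Sum>k | to_nat k < n. f k x) \<in> borel_measurable (lebesgue_on S)" for n
    using assms(2) by (intro borel_measurable_sum)
  show "AE x in lebesgue_on S. (\<lambda>n. \<Sum>k | to_nat k < n. f k x) \<longlonglongrightarrow> (\<Sum>\<^sub>\<infinity>k. f k x)"
    using assms(3) by eventually_elim (intro has_sum_imp_LIMSEQ has_sum_infsum)
qed

text \<open>On the coefficient side strong measurability is replaced by measurability of each mode.
  The notion serves both the solutions, with exponent \<open>s\<close>, and the symbols they are
  paired with, with exponent \<open>- s\<close>.\<close>

definition L2_hseq :: "real set \<Rightarrow> real \<Rightarrow> (real \<Rightarrow> freq \<Rightarrow> complex) \<Rightarrow> bool" where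
  "L2_hseq I s A \<longleftrightarrow> (\<forall>k. (\<lambda>t. A t k) \<in> borel_measurable (lebesgue_on I)) \<and>
     (AE t in lebesgue_on I. hseq s (A t)) \<and> integrable (lebesgue_on I) (\<lambda>t. hnorm2 s (A t))"

lemma L2_hseqD:
  assumes "L2_hseq I s A"
  shows "(\<lambda>t. A t k) \<in> borel_measurable (lebesgue_on I)" "AE t in lebesgue_on I. hseq s (A t)"
    "integrable (lebesgue_on I) (\<lambda>t. hnorm2 s (A t))"
  using assms unfolding L2_hseq_def by blast+

lemma integrable_lebesgue_on_subset:
  fixes f :: "'a::euclidean_space \<Rightarrow> 'b::{banach, second_countable_topology}"
  assumes I: "I \<in> sets lebesgue" "J \<in> sets lebesgue" "J \<subseteq> I" and f: "integrable (lebesgue_on I) f"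
  shows "integrable (lebesgue_on J) f"
proof -
  have "integrable lebesgue (\<lambda>x. indicator I x *\<^sub>R f x)"
    using f I(1) by (simp add: integrable_restrict_space)
  from integrable_mult_indicator[OF I(2) this]
  have "integrable lebesgue (\<lambda>x. indicator J x *\<^sub>R indicator I x *\<^sub>R f x)" .
  moreover have "(\<lambda>x. indicator J x *\<^sub>R indicator I x *\<^sub>R f x) = (\<lambda>x. indicator J x *\<^sub>R f x)"
    using I(3) by (auto simp: indicator_def fun_eq_iff)
  ultimately show ?thesis
    using I(2) by (simp add: integrable_restrict_space)
qed

lemma borel_measurable_hnorm2:
  assumes "I \<in> sets lebesgue" "\<And>k. (\<lambda>t. A t k) \<in> borel_measurable (lebesgue_on I)"
    "AE t in lebesgue_on I. hseq s (A t)"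
  shows "(\<lambda>t. hnorm2 s (A t)) \<in> borel_measurable (lebesgue_on I)"
  unfolding hnorm2_def
proof (rule borel_measurable_infsum[OF assms(1)])
  show "(\<lambda>t. (wcoeff s (A t) k)\<^sup>2) \<in> borel_measurable (lebesgue_on I)" for k
    using assms(2)[of k] unfolding wcoeff_def by measurable
qed (use assms(3) in \<open>simp add: hseq_def\<close>)

lemma L2_hseq_mono:
  assumes I: "I \<in> sets lebesgue" "J \<in> sets lebesgue" "J \<subseteq> I" and "r \<le> s" and A: "L2_hseq I s A"
  shows "L2_hseq J r A"
proof -
  note D = L2_hseqD[OF A]
  have m: "(\<lambda>t. A t k) \<in> borel_measurable (lebesgue_on J)" for k
    using D(1) measurable_restrict_mono[OF _ I(3)] by blast
  have ae: "AE t in lebesgue_on J. hseq s (A t)"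
    by (rule AE_lebesgue_on_subset[OF I D(2)])
  have ae': "AE t in lebesgue_on J. hseq r (A t)"
    using ae by eventually_elim (rule hseq_mono(1)[OF assms(4)])
  have "integrable (lebesgue_on J) (\<lambda>t. hnorm2 s (A t))"
    by (rule integrable_lebesgue_on_subset[OF I D(3)])
  then have "integrable (lebesgue_on J) (\<lambda>t. hnorm2 r (A t))"
  proof (rule Bochner_Integration.integrable_bound)
    show "(\<lambda>t. hnorm2 r (A t)) \<in> borel_measurable (lebesgue_on J)"
      by (rule borel_measurable_hnorm2[OF I(2) m ae'])
    show "AE t in lebesgue_on J. norm (hnorm2 r (A t)) \<le> norm (hnorm2 s (A t))"
      using ae by eventually_elim (simp add: hnorm2_nonneg hseq_mono(2)[OF assms(4)])
  qed
  then show ?thesis using m ae' by (simp add: L2_hseq_def)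
qed

lemma L2_hseq_cmult:
  assumes I: "I \<in> sets lebesgue" and A: "L2_hseq I s A"
  shows "L2_hseq I s (\<lambda>t k. c * A t k)"
proof -
  note D = L2_hseqD[OF A]
  have m: "(\<lambda>t. c * A t k) \<in> borel_measurable (lebesgue_on I)" for k
    using D(1) by measurable
  have ae: "AE t in lebesgue_on I. hseq s (\<lambda>k. c * A t k)"
    using D(2) by eventually_elim (rule hseq_cmult)
  have "hnorm2 s (\<lambda>k. c * a k) = (cmod c)\<^sup>2 * hnorm2 s a" for a
    unfolding hnorm2_def infsum_cmult_right'[symmetric]
    by (intro infsum_cong) (simp add: wcoeff_def norm_mult power_mult_distrib)
  then show ?thesis using m ae D(3) by (simp add: L2_hseq_def)
qed

text \<open>A single mode is continuous for the Sobolev norm; hence the modes of an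
  \<open>L2_sobolev\<close> function are limits of simple functions and measurable.\<close>

lemma fcoeff_diff_tendsto:
  assumes u: "u \<in> sobolev_space s" and v: "\<And>n. v n \<in> sobolev_space s"
    and lim: "(\<lambda>n. sobolev_norm s (\<lambda>g. v n g - u g)) \<longlonglongrightarrow> 0"
  shows "(\<lambda>n. fcoeff (v n) k) \<longlonglongrightarrow> fcoeff u k"
proof (cases "k = 0")
  case True
  then show ?thesis using sobolev_spaceD(2)[OF u] sobolev_spaceD(2)[OF v] by simp
next
  case False
  have f: "fcoeff (\<lambda>g. v n g - u g) = (\<lambda>k. fcoeff (v n) k - fcoeff u k)" for n
    by (auto simp: fcoeff_def diff_divide_distrib)
  have "(\<lambda>n. sqrt (norm (vec_of k) powr (- 2 * s)) * sobolev_norm s (\<lambda>g. v n g - u g)) \<longlonglongrightarrow> sqrt (norm (vec_of k) powr (- 2 * s)) * 0"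
    by (intro tendsto_intros lim)
  then have l: "(\<lambda>n. sqrt (norm (vec_of k) powr (- 2 * s)) * sobolev_norm s (\<lambda>g. v n g - u g)) \<longlonglongrightarrow> 0"
    by simp
  have "norm (fcoeff (v n) k - fcoeff u k) \<le> sqrt (norm (vec_of k) powr (- 2 * s)) * sobolev_norm s (\<lambda>g. v n g - u g)" for n
  proof -
    have "0 \<le> sobolev_norm s (\<lambda>g. v n g - u g)"
      by (auto simp: sobolev_norm_def intro!: infsum_nonneg)
    moreover have "(cmod (fcoeff (v n) k - fcoeff u k))\<^sup>2 \<le> norm (vec_of k) powr (- 2 * s) * (sobolev_norm s (\<lambda>g. v n g - u g))\<^sup>2"
      using norm_le_hnorm2[OF hseq_diff[OF sobolev_spaceD(3)[OF v] sobolev_spaceD(3)[OF u]] False]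
      by (simp add: sobolev_norm_sq f)
    ultimately show ?thesis
      by (smt (verit, ccfv_SIG) mult_nonneg_nonneg norm_ge_zero power_mono_iff power_mult_distrib powr_ge_zero
          real_sqrt_ge_zero real_sqrt_pow2 zero_less_numeral)
  qed
  then show ?thesis
    by (intro LIM_zero_cancel[OF Lim_null_comparison[OF always_eventually l]]) auto
qed

lemma L2_sobolevD:
  assumes I: "I \<in> sets lebesgue" and u: "u \<in> L2_sobolev I s"
  shows "AE t in lebesgue_on I. u t \<in> sobolev_space s"
    and "L2_hseq I s (\<lambda>t. fcoeff (u t))"
    and "(L2_sobolev_norm I s u)\<^sup>2 = (LINT t|lebesgue_on I. hnorm2 s (fcoeff (u t)))"
proof -
  show ae: "AE t in lebesgue_on I. u t \<in> sobolev_space s"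
    using u by (simp add: L2_sobolev_def)
  obtain F where F: "\<And>n. simple_function (lebesgue_on I) (F n)" "\<And>n. F n ` I \<subseteq> sobolev_space s"
    "AE t in lebesgue_on I. (\<lambda>n::nat. sobolev_norm s (\<lambda>g. F n t g - u t g)) \<longlonglongrightarrow> 0"
    using u by (auto simp: L2_sobolev_def)
  have "(\<lambda>t. fcoeff (u t) k) \<in> borel_measurable (lebesgue_on I)" for k
  proof (rule borel_measurable_lebesgue_on_LIMSEQ[OF I])
    show "(\<lambda>t. fcoeff (F n t) k) \<in> borel_measurable (lebesgue_on I)" for n
      using simple_function_compose1[OF F(1)[of n], of "\<lambda>T. fcoeff T k"] by (rule borel_measurable_simple_function)
    have "AE t in lebesgue_on I. t \<in> I" by (rule AE_I2) simp
    then show "AE t in lebesgue_on I. (\<lambda>n. fcoeff (F n t) k) \<longlonglongrightarrow> fcoeff (u t) k"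
      using ae F(3)
    proof eventually_elim
      case (elim t)
      then show ?case using F(2) by (intro fcoeff_diff_tendsto[of _ s]) auto
    qed
  qed
  moreover have "AE t in lebesgue_on I. hseq s (fcoeff (u t))"
    using ae by eventually_elim (rule sobolev_spaceD)
  moreover have "integrable (lebesgue_on I) (\<lambda>t. hnorm2 s (fcoeff (u t)))"
    using u by (simp add: L2_sobolev_def sobolev_norm_sq)
  ultimately show "L2_hseq I s (\<lambda>t. fcoeff (u t))"
    by (simp add: L2_hseq_def)
  have "0 \<le> (LINT t|lebesgue_on I. hnorm2 s (fcoeff (u t)))"
    by (intro integral_nonneg_AE always_eventually) (simp add: hnorm2_nonneg)
  then show "(L2_sobolev_norm I s u)\<^sup>2 = (LINT t|lebesgue_on I. hnorm2 s (fcoeff (u t)))"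
    by (simp add: L2_sobolev_norm_def sobolev_norm_sq)
qed

text \<open>The same simple functions serve as approximations, the norm with the smaller exponent
  being the weaker one.\<close>

lemma L2_sobolev_mono:
  assumes I: "I \<in> sets lebesgue" "J \<in> sets lebesgue" "J \<subseteq> I" and "r \<le> s" and u: "u \<in> L2_sobolev I s"
  shows "u \<in> L2_sobolev J r"
proof -
  obtain F where F: "\<And>n. simple_function (lebesgue_on I) (F n)" "\<And>n. F n ` I \<subseteq> sobolev_space s"
    "AE t in lebesgue_on I. (\<lambda>n::nat. sobolev_norm s (\<lambda>g. F n t g - u t g)) \<longlonglongrightarrow> 0"
    using u by (auto simp: L2_sobolev_def)
  have ae: "AE t in lebesgue_on J. u t \<in> sobolev_space s"
    by (rule AE_lebesgue_on_subset[OF I L2_sobolevD(1)[OF I(1) u]])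
  have aeJ: "AE t in lebesgue_on J. t \<in> J" by (rule AE_I2) simp
  have simple: "simple_function (lebesgue_on J) (F n)" for n
  proof -
    have fin: "finite (F n ` I)" using simple_functionD(1)[OF F(1)[of n]] by simp
    have "F n -` {y} \<inter> J \<in> sets (lebesgue_on J)" for y
    proof -
      have "F n -` {y} \<inter> I \<in> sets (lebesgue_on I)" using simple_functionD(2)[OF F(1)[of n], of "{y}"] by simp
      then have "F n -` {y} \<inter> I \<in> sets lebesgue"
        using I(1) by (simp add: sets_restrict_space_iff)
      then have "(F n -` {y} \<inter> I) \<inter> J \<in> sets lebesgue" using I(2) by (rule sets.Int)
      moreover have "(F n -` {y} \<inter> I) \<inter> J = F n -` {y} \<inter> J" using I(3) by auto
      ultimately show ?thesis using I(2) by (simp add: sets_restrict_space_iff)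
    qed
    then show ?thesis
      using finite_subset[OF image_mono[OF I(3)] fin] by (simp add: simple_function_def)
  qed
  have lim: "AE t in lebesgue_on J. (\<lambda>n::nat. sobolev_norm r (\<lambda>g. F n t g - u t g)) \<longlonglongrightarrow> 0"
    using ae aeJ AE_lebesgue_on_subset[OF I F(3)]
  proof eventually_elim
    case (elim t)
    have le: "sobolev_norm r (\<lambda>g. F n t g - u t g) \<le> sobolev_norm s (\<lambda>g. F n t g - u t g)" for n
    proof -
      have f: "fcoeff (\<lambda>g. F n t g - u t g) = (\<lambda>k. fcoeff (F n t) k - fcoeff (u t) k)"
        by (auto simp: fcoeff_def diff_divide_distrib)
      have "F n t \<in> sobolev_space s" using elim F(2) I(3) by blast
      then have "hseq s (fcoeff (\<lambda>g. F n t g - u t g))"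
        unfolding f using elim(1) by (intro hseq_diff sobolev_spaceD)
      from hseq_mono(2)[OF assms(4) this]
      have "(sobolev_norm r (\<lambda>g. F n t g - u t g))\<^sup>2 \<le> (sobolev_norm s (\<lambda>g. F n t g - u t g))\<^sup>2"
        by (simp add: sobolev_norm_sq)
      then show ?thesis
        by (rule power2_le_imp_le) (auto simp: sobolev_norm_def intro!: infsum_nonneg)
    qed
    show ?case
      by (rule tendsto_sandwich[OF always_eventually always_eventually tendsto_const elim(3)])
        (use le in \<open>auto intro!: infsum_nonneg simp: sobolev_norm_def[of r]\<close>)
  qed
  have "L2_hseq J r (\<lambda>t. fcoeff (u t))"
    by (rule L2_hseq_mono[OF I assms(4) L2_sobolevD(2)[OF I(1) u]])
  then have int: "integrable (lebesgue_on J) (\<lambda>t. (sobolev_norm r (u t))\<^sup>2)"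
    by (simp add: sobolev_norm_sq L2_hseq_def)
  have "F n ` J \<subseteq> sobolev_space r" for n
    using F(2) I(3) sobolev_space_mono[OF assms(4)] by blast
  moreover have "AE t in lebesgue_on J. u t \<in> sobolev_space r"
    using ae by eventually_elim (rule sobolev_space_mono[OF assms(4)])
  ultimately show ?thesis
    unfolding L2_sobolev_def using simple lim int by blast
qed

subsection \<open>Bounded functionals and the boundedness of weakly convergent sequences\<close>

lemma borel_measurable_cnj: "cnj \<in> borel_measurable borel"
  by (intro borel_measurable_continuous_onI continuous_intros)

lemma infsum_complex_of_real: "(\<Sum>\<^sub>\<infinity>k\<in>A. complex_of_real (g k)) = complex_of_real (infsum g A)"
proof (cases "g summable_on A")
  case True
  then show ?thesis by (intro infsumI has_sum_of_real has_sum_infsum)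
next
  case False
  then have "\<not> (\<lambda>k. complex_of_real (g k)) summable_on A"
    using summable_on_Re[of "\<lambda>k. complex_of_real (g k)" A] by auto
  then show ?thesis using False by (simp add: infsum_not_exists)
qed

text \<open>Bilinear, without conjugation, so that multiplying a symbol by a complex scalar
  multiplies the pairing by the same scalar.\<close>

definition pairing :: "(freq \<Rightarrow> complex) \<Rightarrow> (freq \<Rightarrow> complex) \<Rightarrow> complex" where
  "pairing c a = (\<Sum>\<^sub>\<infinity>k. c k * a k)"

lemma weighted_am_gm:
  fixes x y l :: real
  assumes "0 < l"
  shows "x * y \<le> (l * x\<^sup>2 + y\<^sup>2 / l) / 2"
proof -
  have "0 \<le> (sqrt l * x - y / sqrt l)\<^sup>2" by simp
  also have "\<dots> = l * x\<^sup>2 + y\<^sup>2 / l - 2 * (x * y)"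
    using assms by (simp add: power2_diff power_mult_distrib power_divide)
  finally show ?thesis by simp
qed

text \<open>Recovers Cauchy-Schwarz from a family of additive bounds, which can be summed and
  integrated term by term. The optimal \<open>l\<close> is \<open>sqrt (Y / X)\<close>; adding
  \<open>e\<close> to both quantities avoids a division by 0, and then \<open>e\<close> tends to
  0.\<close>

lemma le_sqrt_mult_sqrtI:
  fixes x X Y :: real
  assumes le: "\<And>l. 0 < l \<Longrightarrow> x \<le> (l * X + Y / l) / 2" and "0 \<le> X" "0 \<le> Y"
  shows "x \<le> sqrt X * sqrt Y"
proof -
  have "x \<le> sqrt (X + e) * sqrt (Y + e)" if "0 < e" for e
  proof -
    define p where "p = sqrt (X + e)"
    define q where "q = sqrt (Y + e)"
    have pq: "0 < p" "0 < q" "p\<^sup>2 = X + e" "q\<^sup>2 = Y + e" using assms that by (auto simp: p_def q_def)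
    have "x \<le> (q / p * X + Y / (q / p)) / 2"
      by (rule le) (use pq in simp)
    also have "\<dots> \<le> (q / p * p\<^sup>2 + q\<^sup>2 / (q / p)) / 2"
      using pq that by (intro divide_right_mono add_mono mult_left_mono) auto
    also have "\<dots> = p * q" using pq(1,2) by (simp add: power2_eq_square)
    finally show ?thesis by (simp add: p_def q_def)
  qed
  moreover have "((\<lambda>e. sqrt (X + e) * sqrt (Y + e)) \<longlongrightarrow> sqrt (X + 0) * sqrt (Y + 0)) (at_right 0)"
    by (intro tendsto_intros)
  ultimately have "x \<le> sqrt (X + 0) * sqrt (Y + 0)"
    by (intro tendsto_lowerbound[of _ _ "at_right 0"])
      (auto simp: eventually_at_filter)
  then show ?thesis by simp
qed

text \<open>Duality of the exponents \<open>- s\<close> and \<open>s\<close>. At the zero mode both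
  weights vanish and cannot control the product, so there \<open>a 0 = 0\<close> takes over.\<close>

lemma pairing_summable:
  assumes c: "hseq (- s) c" and a: "hseq s a" "a 0 = 0" and l: "0 < l"
  shows "(\<lambda>k. c k * a k) summable_on UNIV"
    and "cmod (pairing c a) \<le> (l * hnorm2 (- s) c + hnorm2 s a / l) / 2"
proof -
  let ?g = "\<lambda>k. (l * (wcoeff (- s) c k)\<^sup>2 + (wcoeff s a k)\<^sup>2 / l) / 2"
  have g: "(?g has_sum (l * hnorm2 (- s) c + hnorm2 s a / l) / 2) UNIV"
    by (intro has_sum_divide_const has_sum_add has_sum_cmult_right hseq_has_sum c a)
  have le: "cmod (c k * a k) \<le> ?g k" for k
  proof -
    have "cmod (c k * a k) = wcoeff (- s) c k * wcoeff s a k"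
      using a(2) by (cases "k = 0") (auto simp: wcoeff_def norm_mult powr_minus)
    then show ?thesis using weighted_am_gm[OF l] by simp
  qed
  show s: "(\<lambda>k. c k * a k) summable_on UNIV"
    by (rule abs_summable_summable, rule summable_on_comparison_test[OF has_sum_imp_summable[OF g] le]) simp
  show "cmod (pairing c a) \<le> (l * hnorm2 (- s) c + hnorm2 s a / l) / 2"
    unfolding pairing_def by (rule norm_infsum_le[OF has_sum_infsum[OF s] g le])
qed

text \<open>The same \<open>l\<close> is used at every frequency and every time, so the bound is
  integrated while still additive and optimised only once at the end.\<close>

lemma integral_pairing:
  assumes I: "I \<in> sets lebesgue" and C: "L2_hseq I (- s) C" and A: "L2_hseq I s A"
    and A0: "AE t in lebesgue_on I. A t 0 = 0"
  shows "integrable (lebesgue_on I) (\<lambda>t. pairing (C t) (A t))"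
    and "cmod (LINT t|lebesgue_on I. pairing (C t) (A t))
      \<le> sqrt (LINT t|lebesgue_on I. hnorm2 (- s) (C t)) * sqrt (LINT t|lebesgue_on I. hnorm2 s (A t))"
proof -
  note D = L2_hseqD[OF A] and E = L2_hseqD[OF C]
  have le: "AE t in lebesgue_on I. cmod (pairing (C t) (A t)) \<le> (l * hnorm2 (- s) (C t) + hnorm2 s (A t) / l) / 2"
    if "0 < l" for l
    using D(2) E(2) A0 by eventually_elim (rule pairing_summable(2)[OF _ _ _ that])
  have int: "integrable (lebesgue_on I) (\<lambda>t. (l * hnorm2 (- s) (C t) + hnorm2 s (A t) / l) / 2)" for l
    using D(3) E(3) by auto
  have m: "(\<lambda>t. pairing (C t) (A t)) \<in> borel_measurable (lebesgue_on I)"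
    unfolding pairing_def
  proof (rule borel_measurable_infsum[OF I])
    show "(\<lambda>t. C t k * A t k) \<in> borel_measurable (lebesgue_on I)" for k
      using D(1)[of k] E(1)[of k] by measurable
    show "AE t in lebesgue_on I. (\<lambda>k. C t k * A t k) summable_on UNIV"
      using D(2) E(2) A0 by eventually_elim (rule pairing_summable(1)[OF _ _ _ zero_less_one])
  qed
  show i: "integrable (lebesgue_on I) (\<lambda>t. pairing (C t) (A t))"
    by (rule Bochner_Integration.integrable_bound[OF int[of 1] m])
      (use le[of 1] in \<open>auto elim!: eventually_mono\<close>)
  show "cmod (LINT t|lebesgue_on I. pairing (C t) (A t))
      \<le> sqrt (LINT t|lebesgue_on I. hnorm2 (- s) (C t)) * sqrt (LINT t|lebesgue_on I. hnorm2 s (A t))"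
  proof (rule le_sqrt_mult_sqrtI)
    fix l :: real assume l: "0 < l"
    have "cmod (LINT t|lebesgue_on I. pairing (C t) (A t)) \<le> (LINT t|lebesgue_on I. cmod (pairing (C t) (A t)))"
      by (rule integral_norm_bound)
    also have "\<dots> \<le> (LINT t|lebesgue_on I. (l * hnorm2 (- s) (C t) + hnorm2 s (A t) / l) / 2)"
      using i by (intro integral_mono_AE le[OF l] int) auto
    also have "\<dots> = (l * (LINT t|lebesgue_on I. hnorm2 (- s) (C t)) + (LINT t|lebesgue_on I. hnorm2 s (A t)) / l) / 2"
      using D(3) E(3) by simp
    finally show "cmod (LINT t|lebesgue_on I. pairing (C t) (A t))
      \<le> (l * (LINT t|lebesgue_on I. hnorm2 (- s) (C t)) + (LINT t|lebesgue_on I. hnorm2 s (A t)) / l) / 2" .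
  qed (auto intro!: integral_nonneg_AE simp: hnorm2_nonneg)
qed

lemma L2_sobolev_fcoeff_0:
  assumes "I \<in> sets lebesgue" "u \<in> L2_sobolev I s"
  shows "AE t in lebesgue_on I. fcoeff (u t) 0 = 0"
  using L2_sobolevD(1)[OF assms] by eventually_elim (rule sobolev_spaceD)

lemma L2_sobolev_norm_eq:
  assumes "I \<in> sets lebesgue" "u \<in> L2_sobolev I s"
  shows "L2_sobolev_norm I s u = sqrt (LINT t|lebesgue_on I. hnorm2 s (fcoeff (u t)))"
  by (simp add: L2_sobolev_norm_def sobolev_norm_sq)

definition time_pairing :: "real set \<Rightarrow> (real \<Rightarrow> freq \<Rightarrow> complex) \<Rightarrow> (real \<Rightarrow> distr) \<Rightarrow> complex" where
  "time_pairing I C u = (LINT t|lebesgue_on I. pairing (C t) (fcoeff (u t)))"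

lemma time_pairing:
  assumes I: "I \<in> sets lebesgue" and C: "L2_hseq I (- s) C" and u: "u \<in> L2_sobolev I s"
  shows "integrable (lebesgue_on I) (\<lambda>t. pairing (C t) (fcoeff (u t)))"
    and "cmod (time_pairing I C u) \<le> sqrt (LINT t|lebesgue_on I. hnorm2 (- s) (C t)) * L2_sobolev_norm I s u"
  using integral_pairing[OF I C L2_sobolevD(2)[OF I u] L2_sobolev_fcoeff_0[OF I u]]
  by (simp_all add: time_pairing_def L2_sobolev_norm_eq[OF I u])

lemma time_pairing_add:
  assumes I: "I \<in> sets lebesgue" and C: "L2_hseq I (- s) C" and u: "u \<in> L2_sobolev I s" and v: "v \<in> L2_sobolev I s"
  shows "time_pairing I C (\<lambda>t g. u t g + v t g) = time_pairing I C u + time_pairing I C v"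
proof -
  have f: "fcoeff (\<lambda>g. S g + T g) = (\<lambda>k. fcoeff S k + fcoeff T k)" for S T
    by (auto simp: fcoeff_def add_divide_distrib)
  have "AE t in lebesgue_on I. pairing (C t) (fcoeff (u t)) + pairing (C t) (fcoeff (v t)) = pairing (C t) (fcoeff (\<lambda>g. u t g + v t g))"
    using L2_hseqD(2)[OF C] L2_sobolevD(1)[OF I u] L2_sobolevD(1)[OF I v]
  proof eventually_elim
    case (elim t)
    show ?case
      unfolding pairing_def f distrib_left
      by (rule infsum_add[symmetric]; rule pairing_summable(1)[OF elim(1) _ _ zero_less_one])
        (use elim sobolev_spaceD in auto)
  qed
  moreover from this have "(\<lambda>t. pairing (C t) (fcoeff (\<lambda>g. u t g + v t g))) \<in> borel_measurable (lebesgue_on I)"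
    by (rule borel_measurable_lebesgue_on_AE[OF I, rotated])
      (use time_pairing(1)[OF I C u] time_pairing(1)[OF I C v] in auto)
  ultimately have "time_pairing I C (\<lambda>t g. u t g + v t g)
      = (LINT t|lebesgue_on I. pairing (C t) (fcoeff (u t)) + pairing (C t) (fcoeff (v t)))"
    unfolding time_pairing_def using time_pairing(1)[OF I C u] time_pairing(1)[OF I C v]
    by (intro integral_cong_AE) auto
  then show ?thesis
    using time_pairing(1)[OF I C u] time_pairing(1)[OF I C v] by (simp add: time_pairing_def)
qed

lemma pairing_cmult_right: "pairing c (\<lambda>k. r * a k) = r * pairing c a"
  and pairing_cmult_left: "pairing (\<lambda>k. r * c k) a = r * pairing c a"
  unfolding pairing_def infsum_cmult_right'[symmetric] by (simp_all add: mult_ac)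

lemma time_pairing_cmult: "time_pairing I C (\<lambda>t g. r * u t g) = r * time_pairing I C u"
proof -
  have "fcoeff (\<lambda>g. r * T g) = (\<lambda>k. r * fcoeff T k)" for T
    by (auto simp: fcoeff_def)
  then show ?thesis
    by (simp add: time_pairing_def pairing_cmult_right)
qed

lemma L2_sobolev_functional_time_pairing:
  assumes I: "I \<in> sets lebesgue" and C: "L2_hseq I (- s) C"
  shows "L2_sobolev_functional I s (\<lambda>u. Re (time_pairing I C u))"
  unfolding L2_sobolev_functional_def
proof (intro conjI ballI allI exI)
  show "Re (time_pairing I C (\<lambda>t g. u t g + v t g)) = Re (time_pairing I C u) + Re (time_pairing I C v)"
    if "u \<in> L2_sobolev I s" "v \<in> L2_sobolev I s" for u v
    using time_pairing_add[OF I C that] by simp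
  show "Re (time_pairing I C (\<lambda>t g. complex_of_real c * u t g)) = c * Re (time_pairing I C u)" for c u
    by (simp add: time_pairing_cmult)
  show "\<bar>Re (time_pairing I C u)\<bar> \<le> sqrt (LINT t|lebesgue_on I. hnorm2 (- s) (C t)) * L2_sobolev_norm I s u"
    if "u \<in> L2_sobolev I s" for u
    using time_pairing(2)[OF I C that] abs_Re_le_cmod order_trans by blast
qed

lemma weakly_converges_time_pairing:
  assumes I: "I \<in> sets lebesgue" and C: "L2_hseq I (- s) C" and w: "weakly_converges I s u f"
  shows "(\<lambda>n. time_pairing I C (u n)) \<longlonglongrightarrow> time_pairing I C f"
proof -
  have R: "(\<lambda>n. Re (time_pairing I C (u n))) \<longlonglongrightarrow> Re (time_pairing I C f)" if "L2_hseq I (- s) C" for C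
    using w L2_sobolev_functional_time_pairing[OF I that] unfolding weakly_converges_def by blast
  \<comment> \<open>Functionals are real valued and see only real parts; an imaginary part is the
    real part after multiplying the symbol by \<open>- \<i>\<close>.\<close>
  have "Re (time_pairing I (\<lambda>t k. - \<i> * C t k) v) = Im (time_pairing I C v)" for v
    unfolding time_pairing_def by (subst pairing_cmult_left) simp
  then have "(\<lambda>n. Im (time_pairing I C (u n))) \<longlonglongrightarrow> Im (time_pairing I C f)"
    using R[OF L2_hseq_cmult[OF I C, of "- \<i>"]] by simp
  then show ?thesis using R[OF C] by (simp add: tendsto_complex_iff)
qed

text \<open>Sokal's gliding hump: the signs of the coefficients \<open>\<plusminus> 3\<^sup>-\<^sup>j / N\<^sub>j\<close> are chosen
  one after the other such that the \<open>j\<close>-th summand does not cancel the earlier ones.\<close>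

lemma gliding_hump:
  fixes X :: "nat \<Rightarrow> nat \<Rightarrow> real" and N :: "nat \<Rightarrow> real"
  assumes X: "\<And>i j. \<bar>X i j\<bar> \<le> N i * N j" "\<And>j. X j j = (N j)\<^sup>2" and unbounded: "\<And>K. \<exists>n. K < N n"
  obtains \<beta> idx where "summable (\<lambda>j. \<bar>\<beta> j\<bar> * N (idx j))" "\<And>K. \<exists>m. K < \<bar>\<Sum>j. \<beta> j * X (idx j) m\<bar>"
proof -
  \<comment> \<open>The threshold is set so that more than \<open>j + 1\<close> remains after the
    factor \<open>(1 / 3) ^ j\<close> has been lost and the tail has taken half of the rest.\<close>
  define idx where "idx j = (SOME n. 2 * (real j + 1) * 3 ^ j < N n)" for j :: nat
  have idx: "2 * (real j + 1) * 3 ^ j < N (idx j)" for j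
    unfolding idx_def by (rule someI_ex[OF unbounded])
  then have Npos: "0 < N (idx j)" for j
    by (rule order.strict_trans1[rotated]) simp
  define P where "P \<beta> j r \<longleftrightarrow> \<bar>r\<bar> = (1 / 3) ^ j / N (idx j) \<and>
      (1 / 3) ^ j * N (idx j) \<le> \<bar>(\<Sum>i<j. \<beta> i * X (idx i) (idx j)) + r * X (idx j) (idx j)\<bar>" for \<beta> j r
  have "\<exists>\<beta>. \<forall>j. P \<beta> j (\<beta> j)"
  proof (rule dependent_wellorder_choice)
    show "P \<beta> j r = P \<beta>' j r" if "\<And>y. y < j \<Longrightarrow> \<beta> y = \<beta>' y" for r \<beta> \<beta>' j
    proof -
      have "(\<Sum>i<j. \<beta> i * X (idx i) (idx j)) = (\<Sum>i<j. \<beta>' i * X (idx i) (idx j))"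
        using that by (intro sum.cong) auto
      then show ?thesis by (simp add: P_def)
    qed
    show "\<exists>r. P \<beta> j r" for j \<beta>
    proof -
      define p where "p = (\<Sum>i<j. \<beta> i * X (idx i) (idx j))"
      define e where "e = (1 / 3) ^ j / N (idx j)"
      have e: "0 < e" "e * X (idx j) (idx j) = (1 / 3) ^ j * N (idx j)"
        using Npos[of j] by (auto simp: e_def X(2) power2_eq_square)
      have pos: "0 < (1 / 3) ^ j * N (idx j)" using Npos[of j] by simp
      \<comment> \<open>Giving the new summand the sign of the partial sum \<open>p\<close> makes
        the two add up in absolute value.\<close>
      have "P \<beta> j (if 0 \<le> p then e else - e)"
        unfolding P_def p_def[symmetric] using e pos Npos[of j] by (auto simp: e_def)
      then show ?thesis by blast
    qed
  qed
  then obtain \<beta> where \<beta>: "\<And>j. P \<beta> j (\<beta> j)" by blast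
  have abs: "\<bar>\<beta> j\<bar> * N (idx j) = (1 / 3) ^ j" for j
    using \<beta>[of j] Npos[of j] by (simp add: P_def)
  have geo: "summable (\<lambda>j. (1 / 3 :: real) ^ j)" by simp
  have tm: "\<bar>\<beta> j * X (idx j) m\<bar> \<le> (1 / 3) ^ j * N m" for j m
    using mult_left_mono[OF X(1)[of "idx j" m], of "\<bar>\<beta> j\<bar>"] abs[of j]
    by (simp add: abs_mult mult.assoc[symmetric])
  show ?thesis
  proof
    show "summable (\<lambda>j. \<bar>\<beta> j\<bar> * N (idx j))" by (simp add: abs)
    show "\<exists>m. K < \<bar>\<Sum>j. \<beta> j * X (idx j) m\<bar>" for K
    proof -
      obtain j :: nat where j: "K < real j" using reals_Archimedean2 by blast
      define m where "m = idx j"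
      let ?f = "\<lambda>i. \<beta> i * X (idx i) m"
      have s: "summable ?f"
        by (rule summable_comparison_test'[OF summable_mult2[OF geo]]) (use tm in auto)
      have "suminf ?f = (\<Sum>i. ?f (i + Suc j)) + sum ?f {..<Suc j}"
        by (rule suminf_split_initial_segment[OF s])
      moreover have "\<bar>\<Sum>i. ?f (i + Suc j)\<bar> \<le> (\<Sum>i. (1 / 3) ^ (i + Suc j) * N m)"
      proof -
        have g: "summable (\<lambda>i. (1 / 3) ^ (i + Suc j) * N m)"
          using summable_ignore_initial_segment[OF geo] by (intro summable_mult2) auto
        have le: "\<bar>?f (i + Suc j)\<bar> \<le> (1 / 3) ^ (i + Suc j) * N m" for i by (rule tm)
        have sa: "summable (\<lambda>i. \<bar>?f (i + Suc j)\<bar>)"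
          by (rule summable_comparison_test'[OF g]) (simp only: real_norm_def abs_abs le)
        show ?thesis
          by (rule order_trans[OF summable_rabs[OF sa] suminf_le[OF le sa g]])
      qed
      \<comment> \<open>With ratio 1/3 the tail after \<open>j\<close> is half of the
        \<open>j\<close>-th term; with ratio 1/2 it could cancel that term entirely.\<close>
      moreover have "(\<Sum>i. (1 / 3) ^ (i + Suc j) * N m) = (1 / 3) ^ j * N m / 2"
      proof -
        have "(\<lambda>i. (1 / 3 :: real) ^ i * ((1 / 3) ^ Suc j * N m)) sums (1 / (1 - 1 / 3) * ((1 / 3) ^ Suc j * N m))"
          by (intro sums_mult2 geometric_sums) auto
        then show ?thesis by (simp add: sums_iff power_add mult_ac)
      qed
      moreover have "(1 / 3) ^ j * N m \<le> \<bar>sum ?f {..<Suc j}\<bar>"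
        using \<beta>[of j] by (simp add: P_def m_def)
      ultimately have "(1 / 3) ^ j * N m / 2 \<le> \<bar>suminf ?f\<bar>" by linarith
      moreover have "real j + 1 < (1 / 3) ^ j * N m / 2"
        using idx[of j] by (simp add: m_def power_divide field_simps)
      ultimately show ?thesis using j by (intro exI[of _ m]) linarith
    qed
  qed
qed

text \<open>If the norms were unbounded, the gliding hump applied to the matrix of inner products of
  the \<open>u n\<close> would give a series of functionals whose sum is bounded, yet takes
  unbounded values on the sequence. Weak convergence makes these values converge.\<close>

lemma weakly_converges_bounded:
  assumes I: "I \<in> sets lebesgue" and w: "weakly_converges I s u f"
  obtains K where "\<And>n. (LINT t|lebesgue_on I. hnorm2 s (fcoeff (u n t))) \<le> K"
proof -
  have u: "u n \<in> L2_sobolev I s" for n using w by (simp add: weakly_converges_def)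
  define N where "N n = L2_sobolev_norm I s (u n)" for n
  have N0: "0 \<le> N n" for n
    unfolding N_def L2_sobolev_norm_eq[OF I u] by (auto intro!: integral_nonneg_AE simp: hnorm2_nonneg)
  \<comment> \<open>The Riesz representative of \<open>u n\<close>: the weight
    \<open>|k|^(2 s)\<close> and the conjugation carry \<open>H^s\<close> isometrically to the dual
    exponent \<open>- s\<close>, so that pairing with \<open>D n\<close> is the inner product with
    \<open>u n\<close>.\<close>
  define D where "D n t k = complex_of_real (norm (vec_of k) powr (2 * s)) * cnj (fcoeff (u n t) k)" for n t k
  have Dw: "wcoeff (- s) (D n t) k = wcoeff s (fcoeff (u n t)) k" for n t k
    by (cases "k = 0") (auto simp: wcoeff_def D_def norm_mult mult.assoc[symmetric] powr_add[symmetric])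
  have Dh: "hnorm2 (- s) (D n t) = hnorm2 s (fcoeff (u n t))" "hseq (- s) (D n t) = hseq s (fcoeff (u n t))" for n t
    by (simp_all add: hnorm2_def hseq_def Dw)
  have D: "L2_hseq I (- s) (D n)" for n
  proof -
    note E = L2_hseqD[OF L2_sobolevD(2)[OF I u[of n]]]
    have "(\<lambda>t. D n t k) \<in> borel_measurable (lebesgue_on I)" for k
      unfolding D_def using measurable_compose[OF E(1) borel_measurable_cnj]
      by (intro borel_measurable_times) auto
    then show ?thesis using E by (simp add: L2_hseq_def Dh)
  qed
  define ip where "ip n v = Re (time_pairing I (D n) v)" for n v
  have ip_le: "\<bar>ip n v\<bar> \<le> N n * L2_sobolev_norm I s v" if "v \<in> L2_sobolev I s" for n v
    using time_pairing(2)[OF I D that, of n] abs_Re_le_cmod[of "time_pairing I (D n) v"]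
    by (simp add: ip_def N_def L2_sobolev_norm_eq[OF I u] Dh)
  have ip_self: "ip n (u n) = (N n)\<^sup>2" for n
  proof -
    have "pairing (D n t) (fcoeff (u n t)) = complex_of_real (hnorm2 s (fcoeff (u n t)))" for t
    proof -
      have "D n t k * fcoeff (u n t) k = complex_of_real ((wcoeff s (fcoeff (u n t)) k)\<^sup>2)" for k
        using complex_norm_square[of "fcoeff (u n t) k"]
        by (simp add: D_def wcoeff_sq mult.assoc mult.commute[of "cnj _"])
      then show ?thesis
        unfolding pairing_def hnorm2_def by (simp only: infsum_complex_of_real)
    qed
    then show ?thesis
      unfolding ip_def time_pairing_def N_def using L2_sobolevD(3)[OF I u] by simp
  qed
  have "\<exists>K. \<forall>n. N n \<le> K"
  proof (rule ccontr)
    assume "\<nexists>K. \<forall>n. N n \<le> K"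
    then have ub: "\<exists>n. K < N n" for K by (meson not_le)
    obtain \<beta> idx where B: "summable (\<lambda>j. \<bar>\<beta> j\<bar> * N (idx j))"
      "\<And>K. \<exists>m. K < \<bar>\<Sum>j. \<beta> j * ip (idx j) (u m)\<bar>"
      using gliding_hump[of "\<lambda>i j. ip i (u j)" N, OF ip_le[OF u, folded N_def] ip_self ub] by blast
    define L where "L v = (\<Sum>j. \<beta> j * ip (idx j) v)" for v
    have bd: "\<bar>\<beta> j * ip (idx j) v\<bar> \<le> \<bar>\<beta> j\<bar> * N (idx j) * L2_sobolev_norm I s v" if "v \<in> L2_sobolev I s" for j v
      using mult_left_mono[OF ip_le[OF that, of "idx j"], of "\<bar>\<beta> j\<bar>"] by (simp add: abs_mult mult.assoc)
    have sm: "summable (\<lambda>j. \<bar>\<beta> j * ip (idx j) v\<bar>)" if "v \<in> L2_sobolev I s" for v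
      by (rule summable_comparison_test'[OF summable_mult2[OF B(1)]]) (use bd[OF that] in auto)
    have "L2_sobolev_functional I s L"
      unfolding L2_sobolev_functional_def
    proof (intro conjI ballI allI exI)
      show "L (\<lambda>t g. v t g + w t g) = L v + L w" if v: "v \<in> L2_sobolev I s" "w \<in> L2_sobolev I s" for v w
      proof -
        have "ip n (\<lambda>t g. v t g + w t g) = ip n v + ip n w" for n
          using time_pairing_add[OF I D v] by (simp add: ip_def)
        then show ?thesis
          unfolding L_def distrib_left using suminf_add[OF summable_rabs_cancel[OF sm[OF v(1)]] summable_rabs_cancel[OF sm[OF v(2)]]]
          by (simp add: distrib_left)
      qed
      show "L (\<lambda>t g. complex_of_real c * v t g) = c * L v" if v: "v \<in> L2_sobolev I s" for c v
      proof -
        have "ip n (\<lambda>t g. complex_of_real c * v t g) = c * ip n v" for n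
          by (simp add: ip_def time_pairing_cmult)
        then show ?thesis
          unfolding L_def using suminf_mult[OF summable_rabs_cancel[OF sm[OF v]], of c]
          by (simp add: mult_ac)
      qed
      show "\<bar>L v\<bar> \<le> (\<Sum>j. \<bar>\<beta> j\<bar> * N (idx j)) * L2_sobolev_norm I s v" if v: "v \<in> L2_sobolev I s" for v
      proof -
        have "\<bar>L v\<bar> \<le> (\<Sum>j. \<bar>\<beta> j * ip (idx j) v\<bar>)"
          unfolding L_def by (rule summable_rabs[OF sm[OF v]])
        also have "\<dots> \<le> (\<Sum>j. \<bar>\<beta> j\<bar> * N (idx j) * L2_sobolev_norm I s v)"
          by (rule suminf_le[OF bd[OF v] sm[OF v] summable_mult2[OF B(1)]])
        also have "\<dots> = (\<Sum>j. \<bar>\<beta> j\<bar> * N (idx j)) * L2_sobolev_norm I s v"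
          by (rule suminf_mult2[OF B(1), symmetric])
        finally show ?thesis .
      qed
    qed
    then have "(\<lambda>n. L (u n)) \<longlonglongrightarrow> L f" using w by (simp add: weakly_converges_def)
    then have "Bseq (\<lambda>n. L (u n))" by (rule convergent_imp_Bseq[OF convergentI])
    then obtain K where "\<And>n. \<bar>L (u n)\<bar> \<le> K" by (auto simp: Bseq_def)
    then show False using B(2)[of K] unfolding L_def by (metis not_le)
  qed
  then obtain K where K: "\<And>n. N n \<le> K" by blast
  have "(LINT t|lebesgue_on I. hnorm2 s (fcoeff (u n t))) \<le> K\<^sup>2" for n
    using power_mono[OF K N0, of n 2] L2_sobolevD(3)[OF I u[of n]] by (simp add: N_def)
  then show ?thesis using that by blast
qed

subsection \<open>Compactness in time\<close>

lemma integral_lebesgue_on_support: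
  fixes f :: "'a::euclidean_space \<Rightarrow> 'b::{banach, second_countable_topology}"
  assumes S: "S \<in> sets lebesgue" "T \<in> sets lebesgue" "S \<subseteq> T" and f: "\<And>x. x \<in> T - S \<Longrightarrow> f x = 0"
  shows "(LINT x|lebesgue_on T. f x) = (LINT x|lebesgue_on S. f x)"
proof -
  have "(\<lambda>x. indicator T x *\<^sub>R f x) = (\<lambda>x. indicator S x *\<^sub>R f x)"
    using S(3) f by (auto simp: indicator_def fun_eq_iff)
  then show ?thesis using S by (simp add: integral_restrict_space)
qed

lemma Cauchy_Schwarz_integral:
  fixes f g :: "'a \<Rightarrow> 'b::{real_normed_field, banach, second_countable_topology}"
  assumes f: "f \<in> borel_measurable M" "integrable M (\<lambda>x. (norm (f x))\<^sup>2)"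
    and g: "g \<in> borel_measurable M" "integrable M (\<lambda>x. (norm (g x))\<^sup>2)"
  shows "integrable M (\<lambda>x. f x * g x)"
    and "norm (LINT x|M. f x * g x) \<le> sqrt (LINT x|M. (norm (f x))\<^sup>2) * sqrt (LINT x|M. (norm (g x))\<^sup>2)"
proof -
  have le: "norm (f x * g x) \<le> (l * (norm (f x))\<^sup>2 + (norm (g x))\<^sup>2 / l) / 2" if "0 < l" for l x
    using weighted_am_gm[OF that] by (simp add: norm_mult)
  have int: "integrable M (\<lambda>x. (l * (norm (f x))\<^sup>2 + (norm (g x))\<^sup>2 / l) / 2)" for l
    using f g by auto
  show i: "integrable M (\<lambda>x. f x * g x)"
  proof (rule Bochner_Integration.integrable_bound[OF int[of 1]])
    show "(\<lambda>x. f x * g x) \<in> borel_measurable M" using f g by measurable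
    show "AE x in M. norm (f x * g x) \<le> norm ((1 * (norm (f x))\<^sup>2 + (norm (g x))\<^sup>2 / 1) / 2)"
    proof (rule AE_I2)
      fix x
      show "norm (f x * g x) \<le> norm ((1 * (norm (f x))\<^sup>2 + (norm (g x))\<^sup>2 / 1) / 2)"
        by (rule order_trans[OF le[OF zero_less_one, of x]]) simp
    qed
  qed
  show "norm (LINT x|M. f x * g x) \<le> sqrt (LINT x|M. (norm (f x))\<^sup>2) * sqrt (LINT x|M. (norm (g x))\<^sup>2)"
  proof (rule le_sqrt_mult_sqrtI)
    fix l :: real assume l: "0 < l"
    have "norm (LINT x|M. f x * g x) \<le> (LINT x|M. norm (f x * g x))"
      by (rule integral_norm_bound)
    also have "\<dots> \<le> (LINT x|M. (l * (norm (f x))\<^sup>2 + (norm (g x))\<^sup>2 / l) / 2)"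
      using i le[OF l] int by (intro integral_mono) auto
    also have "\<dots> = (l * (LINT x|M. (norm (f x))\<^sup>2) + (LINT x|M. (norm (g x))\<^sup>2) / l) / 2"
      using f g by simp
    finally show "norm (LINT x|M. f x * g x) \<le> (l * (LINT x|M. (norm (f x))\<^sup>2) + (LINT x|M. (norm (g x))\<^sup>2) / l) / 2" .
  qed auto
qed

section \<open>Integration and approximation on a compact interval of time\<close>

lemma integrable_lebesgue_on_Icc_const: "integrable (lebesgue_on {a..b::real}) (\<lambda>_. c :: 'b::{banach, second_countable_topology})"
  by (intro finite_measure.integrable_const finite_measureI) (simp add: emeasure_restrict_space emeasure_lborel_Icc_eq)

lemma integral_lebesgue_on_Icc_const: "a \<le> b \<Longrightarrow> (LINT x|lebesgue_on {a..b}. c) = (b - a) * (c :: real)"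
  by (simp add: measure_restrict_space)

lemma integrable_lebesgue_on_bounded:
  fixes f :: "real \<Rightarrow> 'b::{banach, second_countable_topology}"
  assumes "f \<in> borel_measurable (lebesgue_on {a..b})" "\<And>t. t \<in> {a..b} \<Longrightarrow> norm (f t) \<le> B"
  shows "integrable (lebesgue_on {a..b}) f"
  by (rule Bochner_Integration.integrable_bound[OF integrable_lebesgue_on_Icc_const[of a b B] assms(1)])
    (use assms(2) in \<open>auto intro!: AE_I2 order_trans[OF _ abs_ge_self]\<close>)

lemma borel_measurable_lebesgue_on_continuous:
  fixes f :: "real \<Rightarrow> 'b::euclidean_space"
  assumes "continuous_on {a..b} f"
  shows "f \<in> borel_measurable (lebesgue_on {a..b})"
  by (rule continuous_imp_measurable_on_sets_lebesgue[OF assms]) simp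

lemma integrable_lebesgue_on_continuous:
  fixes f :: "real \<Rightarrow> 'b::euclidean_space"
  assumes c: "continuous_on {a..b} f"
  shows "integrable (lebesgue_on {a..b}) f"
proof -
  have "bounded (f ` {a..b})"
    by (intro compact_imp_bounded compact_continuous_image[OF c]) simp
  then obtain B where "\<forall>y\<in>f ` {a..b}. norm y \<le> B" unfolding bounded_iff by blast
  then show ?thesis
    by (intro integrable_lebesgue_on_bounded[OF borel_measurable_lebesgue_on_continuous[OF c]]) blast
qed

text \<open>Distances are kept squared, and \<open>(x + y)^2 \<le> 2 x^2 + 2 y^2\<close> is what
  asks for quarters of \<open>e\<close>.\<close>

lemma L2_approx_trans:
  fixes f g h :: "real \<Rightarrow> real"
  assumes m: "f \<in> borel_measurable M" "g \<in> borel_measurable M" "h \<in> borel_measurable M"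
    and i: "integrable M (\<lambda>x. (f x - g x)\<^sup>2)" "integrable M (\<lambda>x. (g x - h x)\<^sup>2)"
    and "(LINT x|M. (f x - g x)\<^sup>2) < e / 4" "(LINT x|M. (g x - h x)\<^sup>2) < e / 4"
  shows "integrable M (\<lambda>x. (f x - h x)\<^sup>2)" "(LINT x|M. (f x - h x)\<^sup>2) < e"
proof -
  have le: "(f x - h x)\<^sup>2 \<le> 2 * (f x - g x)\<^sup>2 + 2 * (g x - h x)\<^sup>2" for x
    using sum_squares_bound[of "f x - g x" "g x - h x"] power2_sum[of "f x - g x" "g x - h x"] by simp
  have int: "integrable M (\<lambda>x. 2 * (f x - g x)\<^sup>2 + 2 * (g x - h x)\<^sup>2)" using i by auto
  show fh: "integrable M (\<lambda>x. (f x - h x)\<^sup>2)"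
    by (rule Bochner_Integration.integrable_bound[OF int]) (use m le in auto)
  have "(LINT x|M. (f x - h x)\<^sup>2) \<le> (LINT x|M. 2 * (f x - g x)\<^sup>2 + 2 * (g x - h x)\<^sup>2)"
    by (rule integral_mono[OF fh int le])
  then show "(LINT x|M. (f x - h x)\<^sup>2) < e" using i assms(6,7) by simp
qed

lemma continuous_L2_approx_poly:
  fixes g :: "real \<Rightarrow> real"
  assumes ab: "a < b" and g: "continuous_on {a..b} g" and e: "0 < e"
  obtains q where "(LINT t|lebesgue_on {a..b}. (g t - poly q t)\<^sup>2) < e"
proof -
  \<comment> \<open>A uniform error \<open>d\<close> costs \<open>d^2 (b - a) = e / 2\<close> in the
    squared distance.\<close>
  define d where "d = sqrt (e / (2 * (b - a)))"
  have d: "0 < d" "d\<^sup>2 = e / (2 * (b - a))" using ab e by (auto simp: d_def)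
  obtain f where f: "real_polynomial_function f" "\<And>x. x \<in> {a..b} \<Longrightarrow> \<bar>g x - f x\<bar> < d"
    using Stone_Weierstrass_real_polynomial_function[OF _ g d(1)] by auto
  obtain c n where cn: "f = (\<lambda>x. \<Sum>i\<le>n. c i * x ^ i)"
    using f(1) real_polynomial_function_iff_sum by auto
  define q where "q = (\<Sum>i\<le>n. monom (c i) i)"
  have q: "poly q = f" by (simp add: q_def cn poly_sum poly_monom fun_eq_iff)
  have m: "(\<lambda>t. (g t - poly q t)\<^sup>2) \<in> borel_measurable (lebesgue_on {a..b})"
    by (intro borel_measurable_lebesgue_on_continuous continuous_intros g)
  have le: "(g t - poly q t)\<^sup>2 \<le> d\<^sup>2" if "t \<in> {a..b}" for t
    using power_mono[OF less_imp_le[OF f(2)[OF that]] abs_ge_zero, of 2] by (simp add: q)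
  have "(LINT t|lebesgue_on {a..b}. (g t - poly q t)\<^sup>2) \<le> (LINT t|lebesgue_on {a..b}. d\<^sup>2)"
    using le by (intro integral_mono_AE integrable_lebesgue_on_bounded[OF m] integrable_lebesgue_on_Icc_const AE_I2) auto
  also have "\<dots> = e / 2" using ab by (subst integral_lebesgue_on_Icc_const) (auto simp: d(2) field_simps)
  also have "\<dots> < e" using e by simp
  finally show ?thesis by (rule that)
qed

text \<open>The function is cut off at a height \<open>m\<close>, then approximated by a continuous
  function, then by a polynomial. The budget is \<open>e / 4\<close> for the cut-off and
  \<open>e / 16\<close> for each of the other two errors.\<close>

lemma L2_approx_poly:
  assumes ab: "a < b" and w: "w \<in> borel_measurable (lebesgue_on {a..b})"
    "integrable (lebesgue_on {a..b}) (\<lambda>t. (w t)\<^sup>2)" and e: "0 < (e :: real)"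
  obtains q where "(LINT t|lebesgue_on {a..b}. (w t - poly q t)\<^sup>2) < e"
    "integrable (lebesgue_on {a..b}) (\<lambda>t. (w t - poly q t)\<^sup>2)"
proof -
  let ?M = "lebesgue_on {a..b}"
  define cl where "cl m x = max (- m) (min m x)" for m x :: real
  have cl_cont: "continuous_on A (cl m)" for A m unfolding cl_def by (intro continuous_intros)
  have cl_meas: "(\<lambda>t. cl m (h t)) \<in> borel_measurable ?M" if "h \<in> borel_measurable ?M" for h m
    unfolding cl_def using that by measurable
  have cl_abs: "\<bar>cl m x\<bar> \<le> m" if "0 \<le> m" for m x using that by (auto simp: cl_def)
  have "(\<lambda>m. LINT t|?M. (w t - cl (real m) (w t))\<^sup>2) \<longlonglongrightarrow> (LINT t|?M. 0)"
  proof (rule integral_dominated_convergence[OF _ _ w(2)])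
    show "AE t in ?M. (\<lambda>m. (w t - cl (real m) (w t))\<^sup>2) \<longlonglongrightarrow> 0"
    proof (rule AE_I2)
      fix t
      have "\<forall>\<^sub>F m in sequentially. (w t - cl (real m) (w t))\<^sup>2 = 0"
        using eventually_ge_at_top[of "nat \<lceil>\<bar>w t\<bar>\<rceil>"]
      proof eventually_elim
        case (elim m)
        then have "\<bar>w t\<bar> \<le> real m" by linarith
        then show ?case by (auto simp: cl_def)
      qed
      then show "(\<lambda>m. (w t - cl (real m) (w t))\<^sup>2) \<longlonglongrightarrow> 0" by (rule tendsto_eventually)
    qed
    show "AE t in ?M. norm ((w t - cl (real m) (w t))\<^sup>2) \<le> (w t)\<^sup>2" for m
    proof (rule AE_I2)
      fix t
      have "\<bar>w t - cl (real m) (w t)\<bar> \<le> \<bar>w t\<bar>" by (auto simp: cl_def)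
      then show "norm ((w t - cl (real m) (w t))\<^sup>2) \<le> (w t)\<^sup>2" by (simp add: abs_le_square_iff)
    qed
  qed (use w cl_meas in auto)
  then have "\<forall>\<^sub>F m in sequentially. (LINT t|?M. (w t - cl (real m) (w t))\<^sup>2) < e / 4"
    using e by (intro order_tendstoD) auto
  then obtain m where m: "(LINT t|?M. (w t - cl (real m) (w t))\<^sup>2) < e / 4"
    by (meson eventually_sequentially order_refl)
  define v where "v t = cl (real m) (w t)" for t
  have vm: "v \<in> borel_measurable ?M" unfolding v_def using cl_meas w by blast
  have va: "\<bar>v t\<bar> \<le> real m" for t unfolding v_def by (rule cl_abs) simp
  have "v measurable_on {a..b}"
    using vm by (subst measurable_on_iff_borel_measurable) auto
  then obtain N g where N: "negligible N" and gc: "\<And>n. continuous_on UNIV (g n :: real \<Rightarrow> real)"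
    and gl: "\<And>x. x \<notin> N \<Longrightarrow> (\<lambda>n. g n x) \<longlonglongrightarrow> (if x \<in> {a..b} then v x else 0)"
    unfolding measurable_on_def by blast
  have Nae: "AE t in ?M. t \<notin> N"
    using N unfolding negligible_iff_null_sets
    by (subst AE_lebesgue_on_iff) (auto dest: AE_not_in elim!: eventually_mono)
  \<comment> \<open>Clamping the continuous approximants at the same height supplies the constant
    majorant for dominated convergence. It does not disturb the limit, because \<open>v\<close>
    already stays within that height.\<close>
  define h where "h n t = cl (real m) (g n t)" for n t
  have hc: "continuous_on A (h n)" for A n
    unfolding h_def by (rule continuous_on_compose2[OF cl_cont[of UNIV] continuous_on_subset[OF gc]]) auto
  have hm: "h n \<in> borel_measurable ?M" for n by (rule borel_measurable_lebesgue_on_continuous[OF hc])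
  have "(\<lambda>n. LINT t|?M. (v t - h n t)\<^sup>2) \<longlonglongrightarrow> (LINT t|?M. 0)"
  proof (rule integral_dominated_convergence[where w = "\<lambda>_. (2 * real m)\<^sup>2"])
    have "AE t in ?M. t \<in> {a..b}" by (rule AE_I2) simp
    then show "AE t in ?M. (\<lambda>n. (v t - h n t)\<^sup>2) \<longlonglongrightarrow> 0"
      using Nae
    proof eventually_elim
      case (elim t)
      have "(\<lambda>n. cl (real m) (g n t)) \<longlonglongrightarrow> cl (real m) (v t)"
        using gl[OF elim(2)] elim(1) cl_cont[of UNIV "real m"]
        by (intro continuous_on_tendsto_compose[of UNIV "cl (real m)"]) auto
      moreover have "cl (real m) (v t) = v t" using va[of t] by (auto simp: cl_def)
      ultimately have "(\<lambda>n. (v t - h n t)\<^sup>2) \<longlonglongrightarrow> (v t - v t)\<^sup>2"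
        unfolding h_def by (intro tendsto_intros) simp
      then show ?case by simp
    qed
    show "AE t in ?M. norm ((v t - h n t)\<^sup>2) \<le> (2 * real m)\<^sup>2" for n
    proof (rule AE_I2)
      fix t
      have "\<bar>h n t\<bar> \<le> real m" unfolding h_def by (rule cl_abs) simp
      then have "\<bar>v t - h n t\<bar> \<le> 2 * real m" using va[of t] by linarith
      then show "norm ((v t - h n t)\<^sup>2) \<le> (2 * real m)\<^sup>2"
        using power_mono[of "\<bar>v t - h n t\<bar>" "2 * real m" 2] by simp
    qed
  qed (use hm vm integrable_lebesgue_on_Icc_const in auto)
  then have "\<forall>\<^sub>F n in sequentially. (LINT t|?M. (v t - h n t)\<^sup>2) < e / 16"
    using e by (intro order_tendstoD) auto
  then obtain n where n: "(LINT t|?M. (v t - h n t)\<^sup>2) < (e / 4) / 4"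
    by (auto simp: eventually_sequentially)
  obtain q where q: "(LINT t|?M. (h n t - poly q t)\<^sup>2) < (e / 4) / 4"
    using continuous_L2_approx_poly[OF ab hc, of "e / 16"] e by auto
  have qm: "poly q \<in> borel_measurable ?M"
    by (intro borel_measurable_lebesgue_on_continuous continuous_intros)
  have i1: "integrable ?M (\<lambda>t. (w t - v t)\<^sup>2)"
  proof (rule Bochner_Integration.integrable_bound[OF w(2)])
    show "AE t in ?M. norm ((w t - v t)\<^sup>2) \<le> norm ((w t)\<^sup>2)"
    proof (rule AE_I2)
      fix t
      have "\<bar>w t - v t\<bar> \<le> \<bar>w t\<bar>" by (auto simp: v_def cl_def)
      then show "norm ((w t - v t)\<^sup>2) \<le> norm ((w t)\<^sup>2)" by (simp add: abs_le_square_iff)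
    qed
  qed (use w vm in auto)
  have i2: "integrable ?M (\<lambda>t. (v t - h n t)\<^sup>2)"
  proof (rule integrable_lebesgue_on_bounded)
    show "norm ((v t - h n t)\<^sup>2) \<le> (2 * real m)\<^sup>2" for t
    proof -
      have "\<bar>h n t\<bar> \<le> real m" unfolding h_def by (rule cl_abs) simp
      then have "\<bar>v t - h n t\<bar> \<le> 2 * real m" using va[of t] by linarith
      then show ?thesis
        using power_mono[of "\<bar>v t - h n t\<bar>" "2 * real m" 2] by simp
    qed
  qed (use hm vm in auto)
  have i3: "integrable ?M (\<lambda>t. (h n t - poly q t)\<^sup>2)"
    by (intro integrable_lebesgue_on_continuous continuous_intros hc)
  note t1 = L2_approx_trans[OF vm hm qm i2 i3 n q]
  note t2 = L2_approx_trans[OF w(1) vm qm i1 t1(1) _ t1(2)]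
  show ?thesis
    using t2 m that unfolding v_def by blast
qed

lemma poly_antiderivative:
  obtains p :: "real poly" where "pderiv p = q" "poly p a = 0"
proof -
  define r where "r = (\<Sum>i\<le>degree q. monom (coeff q i / real (Suc i)) (Suc i))"
  have "pderiv (sum f A) = (\<Sum>i\<in>A. pderiv (f i))" for f :: "nat \<Rightarrow> real poly" and A
    by (induction A rule: infinite_finite_induct) (simp_all add: pderiv_add)
  then have "pderiv r = (\<Sum>i\<le>degree q. monom (coeff q i) i)"
    unfolding r_def by (auto simp: pderiv_monom simp del: of_nat_Suc intro!: sum.cong)
  then have "pderiv r = q" by (simp add: poly_as_sum_of_monoms)
  then show ?thesis
    using that[of "r - [:poly r a:]"] by (simp add: pderiv_diff pderiv_pCons)
qed

lemma integral_indicator_times_le: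
  fixes w :: "real \<Rightarrow> real"
  assumes A: "A \<in> sets lebesgue" "A \<subseteq> {a..b}" "measure lebesgue A \<le> L"
    and w: "w \<in> borel_measurable (lebesgue_on {a..b})" "integrable (lebesgue_on {a..b}) (\<lambda>t. (w t)\<^sup>2)"
      "(LINT t|lebesgue_on {a..b}. (w t)\<^sup>2) \<le> W"
  shows "integrable (lebesgue_on {a..b}) (\<lambda>x. indicator A x * w x)"
    and "\<bar>LINT x|lebesgue_on {a..b}. indicator A x * w x\<bar> \<le> sqrt L * sqrt W"
proof -
  let ?M = "lebesgue_on {a..b}"
  have AM: "A \<in> sets ?M" using A by (simp add: sets_restrict_space_iff)
  have "(\<lambda>x. (norm (indicator A x :: real))\<^sup>2) = indicator A" by (auto simp: indicator_def)
  moreover have "integrable ?M (indicator A :: real \<Rightarrow> real)"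
    using AM by (intro integrable_lebesgue_on_bounded[where B = 1]) (auto simp: indicator_def)
  moreover have "(LINT x|?M. indicator A x) = measure lebesgue A"
    using A by (simp add: measure_restrict_space Int_absorb2)
  ultimately have i: "integrable ?M (\<lambda>x. (norm (indicator A x :: real))\<^sup>2)"
    and e: "(LINT x|?M. (norm (indicator A x :: real))\<^sup>2) = measure lebesgue A" by simp_all
  have im: "(indicator A :: real \<Rightarrow> real) \<in> borel_measurable ?M" using AM by simp
  have w2: "integrable ?M (\<lambda>t. (norm (w t))\<^sup>2)" using w by simp
  show "integrable ?M (\<lambda>x. indicator A x * w x)"
    by (rule Cauchy_Schwarz_integral(1)[OF im i w(1) w2])
  have "\<bar>LINT x|?M. indicator A x * w x\<bar> \<le> sqrt (measure lebesgue A) * sqrt (LINT t|?M. (w t)\<^sup>2)"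
    using Cauchy_Schwarz_integral(2)[OF im i w(1) w2, unfolded e] by simp
  also have "\<dots> \<le> sqrt L * sqrt W"
    using A(3) w(3) order_trans[OF measure_nonneg A(3)] by (intro mult_mono) auto
  finally show "\<bar>LINT x|?M. indicator A x * w x\<bar> \<le> sqrt L * sqrt W" .
qed

text \<open>The common bound on the square integrals makes all primitives Hoelder continuous with
  exponent 1/2 and one constant, so that smallness on a finite grid spreads to the whole
  interval.\<close>

lemma primitives_converge_uniformly:
  fixes w :: "nat \<Rightarrow> real \<Rightarrow> real"
  assumes ab: "a < b"
    and w: "\<And>n. w n \<in> borel_measurable (lebesgue_on {a..b})" "\<And>n. integrable (lebesgue_on {a..b}) (\<lambda>t. (w n t)\<^sup>2)"
      "\<And>n. (LINT t|lebesgue_on {a..b}. (w n t)\<^sup>2) \<le> W"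
    and conv: "\<And>t. t \<in> {a..b} \<Longrightarrow> (\<lambda>n. LINT x|lebesgue_on {a..b}. indicator {a..t} x * w n x) \<longlonglongrightarrow> 0"
    and e: "0 < e"
  shows "\<forall>\<^sub>F n in sequentially. \<forall>t\<in>{a..b}. \<bar>LINT x|lebesgue_on {a..b}. indicator {a..t} x * w n x\<bar> \<le> e"
proof -
  let ?M = "lebesgue_on {a..b}"
  define V where "V n t = (LINT x|?M. indicator {a..t} x * w n x)" for n t
  have hoelder: "\<bar>V n t - V n r\<bar> \<le> sqrt (t - r) * sqrt W" if "a \<le> r" "r \<le> t" "t \<le> b" for n r t
  proof -
    have i: "integrable ?M (\<lambda>x. indicator {a..c} x * w n x)" if "c \<le> b" for c
      using that by (intro integral_indicator_times_le(1)[OF _ _ order_refl w]) auto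
    have "V n t - V n r = (LINT x|?M. indicator {a..t} x * w n x - indicator {a..r} x * w n x)"
      unfolding V_def using that by (intro Bochner_Integration.integral_diff[symmetric] i) auto
    also have "\<dots> = (LINT x|?M. indicator {r<..t} x * w n x)"
      using that by (intro Bochner_Integration.integral_cong) (auto simp: indicator_def)
    also have "\<bar>\<dots>\<bar> \<le> sqrt (t - r) * sqrt W"
      using that by (intro integral_indicator_times_le(2)[OF _ _ _ w]) auto
    finally show ?thesis .
  qed
  \<comment> \<open>A grid of mesh \<open>(b - a) / Suc m\<close> is made so fine that the
    oscillation between neighbouring nodes stays below \<open>e / 2\<close>.\<close>
  have "(\<lambda>m. sqrt ((b - a) * inverse (real (Suc m))) * sqrt W) \<longlonglongrightarrow> sqrt ((b - a) * 0) * sqrt W"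
    by (intro tendsto_intros LIMSEQ_inverse_real_of_nat)
  then have "\<forall>\<^sub>F m in sequentially. sqrt ((b - a) * inverse (real (Suc m))) * sqrt W < e / 2"
    using e by (intro order_tendstoD) auto
  then obtain m where m: "sqrt ((b - a) * inverse (real (Suc m))) * sqrt W < e / 2"
    by (auto simp: eventually_sequentially)
  define h where "h = (b - a) / real (Suc m)"
  have h: "0 < h" using ab by (simp add: h_def)
  have node: "a + real i * h \<in> {a..b}" if "i \<le> Suc m" for i
  proof -
    have "real i * h \<le> real (Suc m) * h" using that h by (intro mult_right_mono) auto
    also have "\<dots> = b - a" by (simp add: h_def)
    finally show ?thesis using h by simp
  qed
  have "\<forall>i\<in>{..Suc m}. \<forall>\<^sub>F n in sequentially. \<bar>V n (a + real i * h)\<bar> < e / 2"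
  proof
    fix i assume "i \<in> {..Suc m}"
    then have "(\<lambda>n. \<bar>V n (a + real i * h)\<bar>) \<longlonglongrightarrow> 0"
      unfolding V_def by (intro tendsto_rabs_zero conv node) auto
    then show "\<forall>\<^sub>F n in sequentially. \<bar>V n (a + real i * h)\<bar> < e / 2"
      using e by (intro order_tendstoD) auto
  qed
  then have "\<forall>\<^sub>F n in sequentially. \<forall>i\<in>{..Suc m}. \<bar>V n (a + real i * h)\<bar> < e / 2"
    by (simp add: eventually_ball_finite)
  then have "\<forall>\<^sub>F n in sequentially. \<forall>t\<in>{a..b}. \<bar>V n t\<bar> \<le> e"
  proof eventually_elim
    case (elim n)
    show ?case
    proof
      fix t assume t: "t \<in> {a..b}"
      \<comment> \<open>The last node not beyond \<open>t\<close>. For \<open>t = b\<close> its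
        index is \<open>Suc m\<close>, so the grid has to include both end points.\<close>
      define i where "i = nat \<lfloor>(t - a) / h\<rfloor>"
      have q: "0 \<le> (t - a) / h" using t h by simp
      have "real i = of_int \<lfloor>(t - a) / h\<rfloor>" using q by (simp add: i_def)
      then have i: "real i \<le> (t - a) / h" "(t - a) / h < real i + 1" by linarith+
      have "(t - a) / h \<le> (b - a) / h" using t h by (intro divide_right_mono) auto
      also have "\<dots> = real (Suc m)" using ab by (simp add: h_def)
      finally have "real i \<le> real (Suc m)" using i(1) by linarith
      then have im: "i \<le> Suc m" by simp
      have r: "a + real i * h \<le> t" "t - (a + real i * h) \<le> h"
        using i h by (simp_all add: field_simps)
      have "\<bar>V n t - V n (a + real i * h)\<bar> \<le> sqrt (t - (a + real i * h)) * sqrt W"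
        using node[OF im] r t by (intro hoelder) auto
      also have "\<dots> \<le> sqrt h * sqrt W"
      proof (intro mult_right_mono real_sqrt_le_mono r)
        have "0 \<le> (LINT t|?M. (w n t)\<^sup>2)" by simp
        from order_trans[OF this w(3)] show "0 \<le> sqrt W" by simp
      qed
      also have "\<dots> < e / 2" using m by (simp only: h_def divide_inverse)
      finally have "\<bar>V n t - V n (a + real i * h)\<bar> < e / 2" .
      moreover have "\<bar>V n (a + real i * h)\<bar> < e / 2" using elim im by blast
      ultimately show "\<bar>V n t\<bar> \<le> e" by linarith
    qed
  qed
  then show ?thesis by (simp add: V_def)
qed

lemma integral_indicator_times_poly:
  fixes p :: "real poly"
  assumes t: "t \<in> {a..b}"
  shows "(LINT x|lebesgue_on {a..b}. indicator {a..t} x * poly (pderiv p) x) = poly p t - poly p a"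
proof -
  have "(LINT x|lebesgue_on {a..b}. indicator {a..t} x * poly (pderiv p) x)
      = (LINT x|lebesgue_on {a..t}. indicator {a..t} x * poly (pderiv p) x)"
    using t by (intro integral_lebesgue_on_support) auto
  also have "\<dots> = (LINT x|lebesgue_on {a..t}. poly (pderiv p) x)"
    by (intro Bochner_Integration.integral_cong) auto
  also have "\<dots> = integral {a..t} (poly (pderiv p))"
    by (intro lebesgue_integral_eq_integral integrable_lebesgue_on_continuous continuous_intros) auto
  also have "\<dots> = poly p t - poly p a"
  proof (rule integral_unique, rule fundamental_theorem_of_calculus)
    show "(poly p has_vector_derivative poly (pderiv p) x) (at x within {a..t})" for x
      unfolding has_real_derivative_iff_has_vector_derivative[symmetric]
      by (rule has_field_derivative_at_within[OF poly_DERIV])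
  qed (use t in auto)
  finally show ?thesis .
qed

text \<open>Compensated compactness in one variable: \<open>g\<^sub>n\<close> has a derivative bounded in the dual of the
  continuous functions, tested against \<open>x\<close> times polynomials, and \<open>w\<^sub>n\<close> is up to a small error
  the derivative of a polynomial whose values are small.\<close>

lemma compensated_compactness:
  fixes g :: "nat \<Rightarrow> real \<Rightarrow> complex" and w :: "nat \<Rightarrow> real \<Rightarrow> real" and x x' :: "real \<Rightarrow> real"
  assumes ab: "a < b" and x: "continuous_on {a..b} x" "continuous_on {a..b} x'"
    and g: "\<And>n. g n \<in> borel_measurable (lebesgue_on {a..b})" "\<And>n. integrable (lebesgue_on {a..b}) (\<lambda>t. (cmod (g n t))\<^sup>2)"
      "\<And>n. (LINT t|lebesgue_on {a..b}. (cmod (g n t))\<^sup>2) \<le> G"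
    and w: "\<And>n. w n \<in> borel_measurable (lebesgue_on {a..b})" "\<And>n. integrable (lebesgue_on {a..b}) (\<lambda>t. (w n t)\<^sup>2)"
      "\<And>n. (LINT t|lebesgue_on {a..b}. (w n t)\<^sup>2) \<le> W"
    and deriv: "\<And>n p B. (\<And>t. t \<in> {a..b} \<Longrightarrow> \<bar>x t * poly p t\<bar> \<le> B) \<Longrightarrow>
      cmod (LINT t|lebesgue_on {a..b}. of_real (x' t * poly p t + x t * poly (pderiv p) t) * g n t) \<le> M * B"
    and conv: "\<And>t. t \<in> {a..b} \<Longrightarrow> (\<lambda>n. LINT s|lebesgue_on {a..b}. indicator {a..t} s * w n s) \<longlonglongrightarrow> 0"
  shows "(\<lambda>n. LINT t|lebesgue_on {a..b}. of_real (x t * w n t) * g n t) \<longlonglongrightarrow> 0"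
proof -
  let ?M = "lebesgue_on {a..b}"
  define I where "I n = (LINT t|?M. of_real (x t * w n t) * g n t)" for n
  have "compact (x ` {a..b} \<union> x' ` {a..b})"
    using x by (intro compact_Un compact_continuous_image) auto
  then have "bounded (x ` {a..b} \<union> x' ` {a..b})" by (rule compact_imp_bounded)
  then obtain K where "\<forall>y\<in>x ` {a..b} \<union> x' ` {a..b}. norm y \<le> K" unfolding bounded_iff by blast
  then have K: "\<bar>x t\<bar> \<le> K" "\<bar>x' t\<bar> \<le> K" if "t \<in> {a..b}" for t using that by auto
  have K0: "0 \<le> K" using K(1)[of a] ab by simp
  have "0 \<le> (LINT t|?M. (cmod (g 0 t))\<^sup>2)" by simp
  from order_trans[OF this g(3)] have G0: "0 \<le> G" .
  \<comment> \<open>\<open>R * e\<close> will bound the antiderivative \<open>p\<close>: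
    \<open>e\<close> comes from the primitive of \<open>w n\<close>, and
    \<open>sqrt (b - a) * e\<close> from the error \<open>w n - q\<close> by Cauchy-Schwarz.\<close>
  define R where "R = 1 + sqrt (b - a)"
  have R: "0 < R" using ab by (simp add: R_def add_pos_nonneg)
  \<comment> \<open>Three contributions, in this order: the error \<open>w n - q\<close>, the full
    derivative of \<open>x * p\<close>, and the term \<open>x' * p\<close> left over from
    it.\<close>
  define Q where "Q = K * sqrt G + M * (K * R) + sqrt (b - a) * (K * R) * sqrt G"
  have CS: "integrable ?M (\<lambda>t. of_real (f t) * g n t)" 
    "cmod (LINT t|?M. of_real (f t) * g n t) \<le> sqrt F * sqrt G"
    if f: "f \<in> borel_measurable ?M" "integrable ?M (\<lambda>t. (f t)\<^sup>2)" "(LINT t|?M. (f t)\<^sup>2) \<le> F" for f F n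
  proof -
    have fm: "(\<lambda>t. complex_of_real (f t)) \<in> borel_measurable ?M" using f(1) by measurable
    have f2: "integrable ?M (\<lambda>t. (cmod (complex_of_real (f t)))\<^sup>2)" using f(2) by simp
    show "integrable ?M (\<lambda>t. of_real (f t) * g n t)"
      by (rule Cauchy_Schwarz_integral(1)[OF fm f2 g(1,2)])
    have "cmod (LINT t|?M. of_real (f t) * g n t) \<le> sqrt (LINT t|?M. (f t)\<^sup>2) * sqrt (LINT t|?M. (cmod (g n t))\<^sup>2)"
      using Cauchy_Schwarz_integral(2)[OF fm f2 g(1,2)] by simp
    also have "\<dots> \<le> sqrt F * sqrt G"
    proof (intro mult_mono real_sqrt_le_mono f(3) g(3))
      have "0 \<le> (LINT t|?M. (f t)\<^sup>2)" by simp
      from order_trans[OF this f(3)] show "0 \<le> sqrt F" by simp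
    qed simp
    finally show "cmod (LINT t|?M. of_real (f t) * g n t) \<le> sqrt F * sqrt G" .
  qed
  have main: "cmod (I n) \<le> Q * e"
    if e: "0 < e" and small: "\<And>t. t \<in> {a..b} \<Longrightarrow> \<bar>LINT s|?M. indicator {a..t} s * w n s\<bar> \<le> e" for n e
  proof -
    obtain q where q: "(LINT t|?M. (w n t - poly q t)\<^sup>2) < e\<^sup>2" "integrable ?M (\<lambda>t. (w n t - poly q t)\<^sup>2)"
      using L2_approx_poly[OF ab w(1,2)[of n], of "e\<^sup>2"] e by auto
    obtain p where p: "pderiv p = q" "poly p a = 0" by (rule poly_antiderivative)
    have qm: "poly r \<in> borel_measurable ?M" for r
      by (intro borel_measurable_lebesgue_on_continuous continuous_intros)
    have xm: "x \<in> borel_measurable ?M" "x' \<in> borel_measurable ?M"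
      by (intro borel_measurable_lebesgue_on_continuous x)+
    have wq: "(\<lambda>t. w n t - poly q t) \<in> borel_measurable ?M" using w(1)[of n] qm by measurable
    have pb: "\<bar>poly p t\<bar> \<le> R * e" if t: "t \<in> {a..b}" for t
    proof -
      have "poly p t = (LINT s|?M. indicator {a..t} s * poly q s)"
        using integral_indicator_times_poly[OF t, of p] p by simp
      also have "\<dots> = (LINT s|?M. indicator {a..t} s * w n s - indicator {a..t} s * (w n s - poly q s))"
        by (intro Bochner_Integration.integral_cong) (auto simp: algebra_simps)
      also have "\<dots> = (LINT s|?M. indicator {a..t} s * w n s) - (LINT s|?M. indicator {a..t} s * (w n s - poly q s))"
        using t by (intro Bochner_Integration.integral_diff integral_indicator_times_le(1)[OF _ _ order_refl _ _ order_refl] w q wq) auto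
      finally have "\<bar>poly p t\<bar> \<le> \<bar>LINT s|?M. indicator {a..t} s * w n s\<bar> + \<bar>LINT s|?M. indicator {a..t} s * (w n s - poly q s)\<bar>"
        by linarith
      also have "\<dots> \<le> e + sqrt (b - a) * sqrt (e\<^sup>2)"
        using t q(1) by (intro add_mono small integral_indicator_times_le(2)[OF _ _ _ wq q(2)]) auto
      also have "\<dots> = R * e" using e by (simp add: R_def algebra_simps)
      finally show ?thesis .
    qed
    have s1: "(x t * (w n t - poly q t))\<^sup>2 \<le> K\<^sup>2 * (w n t - poly q t)\<^sup>2" if "t \<in> {a..b}" for t
      using power_mono[OF K(1)[OF that] abs_ge_zero, of 2] by (simp add: power_mult_distrib mult_right_mono)
    have i1: "integrable ?M (\<lambda>t. (x t * (w n t - poly q t))\<^sup>2)"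
    proof (rule Bochner_Integration.integrable_bound[OF integrable_mult_right[OF q(2), of "K\<^sup>2"]])
      show "(\<lambda>t. (x t * (w n t - poly q t))\<^sup>2) \<in> borel_measurable ?M" using xm wq by measurable
      show "AE t in ?M. norm ((x t * (w n t - poly q t))\<^sup>2) \<le> norm (K\<^sup>2 * (w n t - poly q t)\<^sup>2)"
        using s1 by (intro AE_I2) auto
    qed
    have "(LINT t|?M. (x t * (w n t - poly q t))\<^sup>2) \<le> (LINT t|?M. K\<^sup>2 * (w n t - poly q t)\<^sup>2)"
      using s1 q(2) by (intro integral_mono_AE i1 AE_I2) auto
    also have "\<dots> \<le> K\<^sup>2 * e\<^sup>2" using q(1) by (simp add: mult_left_mono)
    finally have l1: "(LINT t|?M. (x t * (w n t - poly q t))\<^sup>2) \<le> K\<^sup>2 * e\<^sup>2" .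
    have m1: "(\<lambda>t. x t * (w n t - poly q t)) \<in> borel_measurable ?M" using xm wq by measurable
    note T1 = CS[OF m1 i1 l1, of n]
    have s3: "(x' t * poly p t)\<^sup>2 \<le> (K * (R * e))\<^sup>2" if "t \<in> {a..b}" for t
    proof -
      have "\<bar>x' t * poly p t\<bar> \<le> K * (R * e)"
        using K(2)[OF that] pb[OF that] K0 by (simp add: abs_mult mult_mono)
      from power_mono[OF this abs_ge_zero, of 2] show ?thesis by simp
    qed
    have m3: "(\<lambda>t. x' t * poly p t) \<in> borel_measurable ?M" using xm qm by measurable
    have i3: "integrable ?M (\<lambda>t. (x' t * poly p t)\<^sup>2)"
      using s3 m3 by (intro integrable_lebesgue_on_bounded[where B = "(K * (R * e))\<^sup>2"]) auto
    have "(LINT t|?M. (x' t * poly p t)\<^sup>2) \<le> (LINT t|?M. (K * (R * e))\<^sup>2)"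
      using s3 by (intro integral_mono_AE i3 integrable_lebesgue_on_Icc_const AE_I2) auto
    also have "\<dots> = (b - a) * (K * (R * e))\<^sup>2" by (rule integral_lebesgue_on_Icc_const[OF less_imp_le[OF ab]])
    finally have l3: "(LINT t|?M. (x' t * poly p t)\<^sup>2) \<le> (b - a) * (K * (R * e))\<^sup>2" .
    note T3 = CS[OF m3 i3 l3, of n]
    have i2: "integrable ?M (\<lambda>t. of_real (x t * poly q t) * g n t)"
    proof (rule CS(1)[OF _ _ order_refl])
      have c: "continuous_on {a..b} (\<lambda>t. x t * poly q t)" by (intro continuous_intros x)
      show "(\<lambda>t. x t * poly q t) \<in> borel_measurable ?M"
        by (rule borel_measurable_lebesgue_on_continuous[OF c])
      show "integrable ?M (\<lambda>t. (x t * poly q t)\<^sup>2)"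
        by (intro integrable_lebesgue_on_continuous continuous_intros x)
    qed
    \<comment> \<open>Integration by parts in the form \<open>x * q = (x * p)' - x' * p\<close>: the
      full derivative is controlled by the hypothesis \<open>deriv\<close>, the other term by
      Cauchy-Schwarz.\<close>
    have "(LINT t|?M. of_real (x' t * poly p t + x t * poly (pderiv p) t) * g n t)
        = (LINT t|?M. of_real (x' t * poly p t) * g n t + of_real (x t * poly q t) * g n t)"
      by (simp add: p distrib_right)
    also have "\<dots> = (LINT t|?M. of_real (x' t * poly p t) * g n t) + (LINT t|?M. of_real (x t * poly q t) * g n t)"
      by (rule Bochner_Integration.integral_add[OF T3(1) i2])
    finally have A: "(LINT t|?M. of_real (x t * poly q t) * g n t)
        = (LINT t|?M. of_real (x' t * poly p t + x t * poly (pderiv p) t) * g n t) - (LINT t|?M. of_real (x' t * poly p t) * g n t)"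
      by simp
    have T2: "cmod (LINT t|?M. of_real (x' t * poly p t + x t * poly (pderiv p) t) * g n t) \<le> M * (K * (R * e))"
      using K(1) pb K0 by (intro deriv) (simp add: abs_mult mult_mono)
    have "I n = (LINT t|?M. of_real (x t * (w n t - poly q t)) * g n t + of_real (x t * poly q t) * g n t)"
      unfolding I_def by (intro Bochner_Integration.integral_cong) (auto simp: algebra_simps)
    also have "\<dots> = (LINT t|?M. of_real (x t * (w n t - poly q t)) * g n t) + (LINT t|?M. of_real (x t * poly q t) * g n t)"
      by (rule Bochner_Integration.integral_add[OF T1(1) i2])
    finally have In: "I n = (LINT t|?M. of_real (x t * (w n t - poly q t)) * g n t) + (LINT t|?M. of_real (x t * poly q t) * g n t)" .
    have "cmod (I n) \<le> cmod (LINT t|?M. of_real (x t * (w n t - poly q t)) * g n t)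
        + (cmod (LINT t|?M. of_real (x' t * poly p t + x t * poly (pderiv p) t) * g n t)
          + cmod (LINT t|?M. of_real (x' t * poly p t) * g n t))"
      unfolding In A by (rule order_trans[OF norm_triangle_ineq add_left_mono[OF norm_triangle_ineq4]])
    also have "\<dots> \<le> sqrt (K\<^sup>2 * e\<^sup>2) * sqrt G + (M * (K * (R * e)) + sqrt ((b - a) * (K * (R * e))\<^sup>2) * sqrt G)"
      by (intro add_mono T1(2) T2 T3(2))
    also have "sqrt (K\<^sup>2 * e\<^sup>2) = K * e" using K0 e by (simp add: real_sqrt_mult)
    also have "sqrt ((b - a) * (K * (R * e))\<^sup>2) = sqrt (b - a) * (K * (R * e))"
      using K0 R e by (simp add: real_sqrt_mult)
    also have "K * e * sqrt G + (M * (K * (R * e)) + sqrt (b - a) * (K * (R * e)) * sqrt G) = Q * e"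
      by (simp add: Q_def algebra_simps)
    finally show ?thesis .
  qed
  have "I \<longlonglongrightarrow> 0"
  proof (rule tendstoI)
    fix r :: real assume r: "0 < r"
    define e where "e = r / (\<bar>Q\<bar> + 1)"
    have e: "0 < e" using r by (simp add: e_def)
    have "Q * e \<le> \<bar>Q\<bar> * e" using e by (intro mult_right_mono) auto
    also have "\<dots> < (\<bar>Q\<bar> + 1) * e" using e by (intro mult_strict_right_mono) auto
    also have "\<dots> = r" by (simp add: e_def)
    finally have Qe: "Q * e < r" .
    have "\<forall>\<^sub>F n in sequentially. \<forall>t\<in>{a..b}. \<bar>LINT s|?M. indicator {a..t} s * w n s\<bar> \<le> e"
      by (rule primitives_converge_uniformly[OF ab w conv e])
    then show "\<forall>\<^sub>F n in sequentially. dist (I n) 0 < r"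
    proof eventually_elim
      case (elim n)
      then show ?case using main[OF e, of n] Qe by simp
    qed
  qed
  then show ?thesis by (simp add: I_def[abs_def])
qed

section \<open>The weak formulation as a functional of the Fourier coefficients\<close>

lemma integral_lebesgue_on_cong_AE:
  fixes f g :: "'a::euclidean_space \<Rightarrow> 'b::euclidean_space"
  assumes "S \<in> sets lebesgue" "f \<in> borel_measurable (lebesgue_on S)" "AE x in lebesgue_on S. f x = g x"
  shows "(LINT x|lebesgue_on S. f x) = (LINT x|lebesgue_on S. g x)"
  using assms(2) borel_measurable_lebesgue_on_AE[OF assms] assms(3) by (rule integral_cong_AE)

text \<open>As \<open>- 2 * s \<le> 1\<close>, one factor \<open>weight k\<close> covers the Sobolev
  weight, and a second one remains to make the series summable.\<close>

lemma hseq_weight: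
  assumes "- 1 / 2 \<le> s" and c: "\<And>k. weight k * cmod (c k) \<le> K"
  shows "hseq (- s) c" "hnorm2 (- s) c \<le> K\<^sup>2 * (\<Sum>\<^sub>\<infinity>k. 1 / weight k)"
proof -
  have le: "(wcoeff (- s) c k)\<^sup>2 \<le> K\<^sup>2 * (1 / weight k)" for k
  proof -
    have "norm (vec_of k) powr (- (2 * s)) \<le> norm (vec_of k) powr 1"
      using assms(1) by (intro norm_vec_of_powr_mono) simp
    also have "\<dots> \<le> weight k" using norm_vec_of_le_weight by simp
    finally have "(wcoeff (- s) c k)\<^sup>2 \<le> weight k * (cmod (c k))\<^sup>2"
      by (simp add: wcoeff_sq mult_right_mono)
    also have "\<dots> = (weight k * cmod (c k))\<^sup>2 * (1 / weight k)"
      using weight_ge_1[of k] by (simp add: power2_eq_square)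
    also have "\<dots> \<le> K\<^sup>2 * (1 / weight k)"
      using c[of k] weight_ge_1[of k] by (intro mult_right_mono power_mono) auto
    finally show ?thesis .
  qed
  have hs: "((\<lambda>k. K\<^sup>2 * (1 / weight k)) has_sum K\<^sup>2 * (\<Sum>\<^sub>\<infinity>k. 1 / weight k)) UNIV"
    by (intro has_sum_cmult_right has_sum_infsum summable_on_inverse_weight)
  show h: "hseq (- s) c"
    unfolding hseq_def by (rule summable_on_comparison_test[OF has_sum_imp_summable[OF hs] le]) simp
  show "hnorm2 (- s) c \<le> K\<^sup>2 * (\<Sum>\<^sub>\<infinity>k. 1 / weight k)"
    by (rule has_sum_mono[OF hseq_has_sum[OF h] hs le])
qed

lemma integrable_indicator_Icc:
  assumes "I \<in> sets lebesgue"
  shows "integrable (lebesgue_on I) (\<lambda>t. indicator {a..b::real} t * (c :: real))"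
proof -
  have Is: "I \<inter> space lebesgue \<in> sets lebesgue" using assms by simp
  have "integrable lebesgue (\<lambda>t. indicator I t *\<^sub>R (indicator {a..b} t * c))"
    by (intro integrable_mult_indicator assms integrable_mult_left integrable_real_indicator)
      (auto simp: emeasure_lborel_Icc_eq)
  then show ?thesis by (rule integrable_restrict_space[OF Is, THEN iffD2])
qed

lemma L2_hseq_weight:
  assumes I: "I \<in> sets lebesgue" and s: "- 1 / 2 \<le> s"
    and C: "\<And>k. (\<lambda>t. C t k) \<in> borel_measurable (lebesgue_on I)" "\<And>t k. weight k * cmod (C t k) \<le> K"
      "\<And>t k. t \<notin> {a..b} \<Longrightarrow> C t k = 0"
  shows "L2_hseq I (- s) C"
proof -
  have h: "hseq (- s) (C t)" for t by (rule hseq_weight(1)[OF s C(2)])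
  have "integrable (lebesgue_on I) (\<lambda>t. hnorm2 (- s) (C t))"
  proof (rule Bochner_Integration.integrable_bound)
    show "integrable (lebesgue_on I) (\<lambda>t. indicator {a..b} t * (K\<^sup>2 * (\<Sum>\<^sub>\<infinity>k. 1 / weight k)))"
      by (rule integrable_indicator_Icc[OF I])
    show "(\<lambda>t. hnorm2 (- s) (C t)) \<in> borel_measurable (lebesgue_on I)"
      using h by (intro borel_measurable_hnorm2 I C) auto
    show "AE t in lebesgue_on I. norm (hnorm2 (- s) (C t)) \<le> norm (indicator {a..b} t * (K\<^sup>2 * (\<Sum>\<^sub>\<infinity>k. 1 / weight k)))"
    proof (rule AE_I2)
      fix t
      show "norm (hnorm2 (- s) (C t)) \<le> norm (indicator {a..b} t * (K\<^sup>2 * (\<Sum>\<^sub>\<infinity>k. 1 / weight k)))"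
      proof (cases "t \<in> {a..b}")
        case True
        have "hnorm2 (- s) (C t) \<le> \<bar>K\<^sup>2 * (\<Sum>\<^sub>\<infinity>k. 1 / weight k)\<bar>"
          by (rule order_trans[OF hseq_weight(2)[OF s C(2)] abs_ge_self])
        then show ?thesis using True by (simp add: hnorm2_nonneg)
      next
        case False
        then have "C t = (\<lambda>k. 0)" using C(3) by blast
        then show ?thesis by (simp add: hnorm2_def wcoeff_def)
      qed
    qed
  qed
  then show ?thesis using C(1) h by (simp add: L2_hseq_def)
qed

definition single_mode :: "freq \<Rightarrow> (real \<Rightarrow> complex) \<Rightarrow> real \<Rightarrow> freq \<Rightarrow> complex" where
  "single_mode k \<phi> t j = (if j = k then \<phi> t else 0)"

lemma pairing_single_mode: "pairing (single_mode k \<phi> t) a = \<phi> t * a k"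
proof -
  have "pairing (single_mode k \<phi> t) a = (\<Sum>\<^sub>\<infinity>j\<in>{k}. single_mode k \<phi> t j * a j)"
    unfolding pairing_def by (rule infsum_cong_neutral) (auto simp: single_mode_def)
  then show ?thesis by (simp add: single_mode_def)
qed

lemma L2_hseq_single_mode:
  assumes "\<phi> \<in> borel_measurable (lebesgue_on I)" "integrable (lebesgue_on I) (\<lambda>t. (cmod (\<phi> t))\<^sup>2)"
  shows "L2_hseq I s (single_mode k \<phi>)"
proof -
  have w: "(wcoeff s (single_mode k \<phi> t) j)\<^sup>2 = (if j = k then norm (vec_of k) powr (2 * s) * (cmod (\<phi> t))\<^sup>2 else 0)" for t j
    by (simp add: wcoeff_sq single_mode_def)
  have "((\<lambda>j. (wcoeff s (single_mode k \<phi> t) j)\<^sup>2) has_sum norm (vec_of k) powr (2 * s) * (cmod (\<phi> t))\<^sup>2) UNIV" for t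
    by (rule has_sum_finite_neutralI[where B = "{k}"]) (auto simp: w)
  then have "hseq s (single_mode k \<phi> t)" "hnorm2 s (single_mode k \<phi> t) = norm (vec_of k) powr (2 * s) * (cmod (\<phi> t))\<^sup>2" for t
    by (auto simp: hseq_def hnorm2_def has_sum_iff)
  moreover have "(\<lambda>t. single_mode k \<phi> t j) \<in> borel_measurable (lebesgue_on I)" for j
    using assms(1) by (cases "j = k") (auto simp: single_mode_def)
  ultimately show ?thesis using assms(2) by (simp add: L2_hseq_def)
qed

subsection \<open>The linear terms\<close>

definition distr_symbol :: "(real \<times> plane \<Rightarrow> real) \<Rightarrow> real \<Rightarrow> freq \<Rightarrow> complex" where
  "distr_symbol \<psi> t k = of_real ((2 * pi)\<^sup>2) * fhat (slice \<psi> t) (- k)"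

definition dissip_symbol :: "real \<Rightarrow> (real \<times> plane \<Rightarrow> real) \<Rightarrow> real \<Rightarrow> freq \<Rightarrow> complex" where
  "dissip_symbol \<gamma> \<psi> t k = of_real ((2 * pi)\<^sup>2) * (of_real (lam (- 1/2) k * lam (\<gamma> + 1/2) k) * cnj (fhat (slice \<psi> t) k))"

lemma distr_slice_eq_pairing:
  assumes "distribution T" "\<psi> \<in> spacetime_test"
  shows "T (slice \<psi> t) = pairing (distr_symbol \<psi> t) (fcoeff T)"
  unfolding pairing_def distr_symbol_def
  using distribution_has_sum[OF assms(1) slice_torus_test[OF assms(2)], of t]
  by (intro infsumI[symmetric]) (simp add: mult_ac)

lemma L2_inner_dissip:
  assumes "\<psi> \<in> spacetime_test"
  shows "L2_inner (Lam (- 1/2) T) (Lam (\<gamma> + 1/2) (distr_of (slice \<psi> t))) = pairing (dissip_symbol \<gamma> \<psi> t) (fcoeff T)"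
  unfolding L2_inner_def pairing_def dissip_symbol_def infsum_cmult_right'[symmetric]
  by (intro infsum_cong)
    (simp add: fcoeff_Lam fcoeff_distr_of torus_test_continuous_on slice_torus_test assms mult_ac)

text \<open>For nonzero \<open>k\<close> the product is \<open>|k|\<close> to the power
  \<open>\<gamma>\<close>, and it is 0 at \<open>k = 0\<close>. A crude cubic bound is enough
  because the coefficients of test functions decay faster than any power.\<close>

lemma lam_product_le:
  assumes "0 < \<gamma>" "\<gamma> \<le> 2"
  shows "\<bar>lam (- 1/2) k * lam (\<gamma> + 1/2) k\<bar> \<le> weight k ^ 3"
proof (cases "k = 0")
  case False
  then have n: "1 \<le> norm (vec_of k)" by (rule norm_vec_of_ge_1)
  have "norm (vec_of k) powr (- 1/2) \<le> norm (vec_of k) powr 0"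
    by (rule norm_vec_of_powr_mono) simp
  then have 1: "norm (vec_of k) powr (- 1/2) \<le> 1" using n False by simp
  have "norm (vec_of k) powr (\<gamma> + 1/2) \<le> norm (vec_of k) powr 3"
    using assms by (intro norm_vec_of_powr_mono) simp
  also have "\<dots> = norm (vec_of k) ^ 3" using n by (simp add: powr_numeral)
  also have "\<dots> \<le> weight k ^ 3" by (intro power_mono norm_vec_of_le_weight) simp
  finally have "norm (vec_of k) powr (- 1/2) * norm (vec_of k) powr (\<gamma> + 1/2) \<le> 1 * weight k ^ 3"
    using 1 by (intro mult_mono) auto
  then show ?thesis using assms by (simp add: lam_def)
qed (use assms weight_ge_1[of 0] in \<open>simp add: lam_def\<close>)

lemma borel_measurable_fhat_slice:
  assumes "\<psi> \<in> spacetime_test"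
  shows "(\<lambda>t. fhat (slice \<psi> t) k) \<in> borel_measurable (lebesgue_on I)"
proof -
  have "(\<lambda>t. fhat (slice \<psi> t) k) \<in> borel_measurable borel"
    by (rule borel_measurable_continuous_onI[OF continuous_on_fhat_slice[OF assms]])
  then have "(\<lambda>t. fhat (slice \<psi> t) k) \<in> borel_measurable lebesgue"
    by (simp add: measurable_completion)
  then show ?thesis by (rule measurable_restrict_space1)
qed

lemma L2_hseq_distr_symbol:
  assumes I: "I \<in> sets lebesgue" and s: "- 1 / 2 \<le> s" and \<psi>: "\<psi> \<in> spacetime_test"
  shows "L2_hseq I (- s) (distr_symbol \<psi>)"
proof -
  obtain a b where ab: "time_supp a b \<psi>" using \<psi> by (rule spacetime_testE)
  obtain C where C: "\<And>t k. weight k ^ 1 * cmod (fhat (slice \<psi> t) k) \<le> C"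
    using fhat_slice_decay[OF \<psi>] by blast
  show ?thesis
  proof (rule L2_hseq_weight[OF I s])
    show "(\<lambda>t. distr_symbol \<psi> t k) \<in> borel_measurable (lebesgue_on I)" for k
      unfolding distr_symbol_def by (intro borel_measurable_times borel_measurable_fhat_slice[OF \<psi>]) simp
    show "weight k * cmod (distr_symbol \<psi> t k) \<le> (2 * pi)\<^sup>2 * C" for t k
      using mult_left_mono[OF C[of "- k" t], of "(2 * pi)\<^sup>2"]
      by (simp add: distr_symbol_def norm_mult norm_power mult_ac)
    show "distr_symbol \<psi> t k = 0" if "t \<notin> {a..b}" for t k
      using fhat_slice_eq_0[OF ab that] by (simp add: distr_symbol_def)
  qed
qed

lemma L2_hseq_dissip_symbol:
  assumes I: "I \<in> sets lebesgue" and s: "- 1 / 2 \<le> s" and \<psi>: "\<psi> \<in> spacetime_test" and \<gamma>: "0 < \<gamma>" "\<gamma> \<le> 2"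
  shows "L2_hseq I (- s) (dissip_symbol \<gamma> \<psi>)"
proof -
  obtain a b where ab: "time_supp a b \<psi>" using \<psi> by (rule spacetime_testE)
  obtain C where C: "\<And>t k. weight k ^ 4 * cmod (fhat (slice \<psi> t) k) \<le> C"
    using fhat_slice_decay[OF \<psi>] by blast
  show ?thesis
  proof (rule L2_hseq_weight[OF I s])
    show "(\<lambda>t. dissip_symbol \<gamma> \<psi> t k) \<in> borel_measurable (lebesgue_on I)" for k
      unfolding dissip_symbol_def
      by (intro borel_measurable_times measurable_compose[OF borel_measurable_fhat_slice[OF \<psi>] borel_measurable_cnj]) auto
    show "weight k * cmod (dissip_symbol \<gamma> \<psi> t k) \<le> (2 * pi)\<^sup>2 * C" for t k
    proof -
      have "\<bar>lam (- 1/2) k * lam (\<gamma> + 1/2) k\<bar> * (weight k * cmod (fhat (slice \<psi> t) k))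
          \<le> weight k ^ 3 * (weight k * cmod (fhat (slice \<psi> t) k))"
        using lam_product_le[OF \<gamma>] weight_ge_1[of k] by (intro mult_right_mono) auto
      also have "\<dots> = weight k ^ 4 * cmod (fhat (slice \<psi> t) k)" by (simp add: power_Suc numeral_eq_Suc)
      also have "\<dots> \<le> C" by (rule C)
      finally have "(2 * pi)\<^sup>2 * (\<bar>lam (- 1/2) k * lam (\<gamma> + 1/2) k\<bar> * (weight k * cmod (fhat (slice \<psi> t) k))) \<le> (2 * pi)\<^sup>2 * C"
        by (rule mult_left_mono) simp
      moreover have "cmod (dissip_symbol \<gamma> \<psi> t k) = (2 * pi)\<^sup>2 * (\<bar>lam (- 1/2) k * lam (\<gamma> + 1/2) k\<bar> * cmod (fhat (slice \<psi> t) k))"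
        unfolding dissip_symbol_def norm_mult norm_of_real complex_mod_cnj by simp
      ultimately show ?thesis by (simp add: mult_ac)
    qed
    show "dissip_symbol \<gamma> \<psi> t k = 0" if "t \<notin> {a..b}" for t k
      using fhat_slice_eq_0[OF ab that] by (simp add: dissip_symbol_def)
  qed
qed

lemma time_deriv_spacetime_test: "\<psi> \<in> spacetime_test \<Longrightarrow> time_deriv \<psi> \<in> spacetime_test"
  unfolding time_deriv_def by (rule spacetime_test_pderiv_dir) (simp_all add: Basis_prod_def)

subsection \<open>The nonlinear term\<close>

definition sqg_form :: "(real \<times> plane \<Rightarrow> real) \<Rightarrow> (real \<Rightarrow> distr) \<Rightarrow> real \<Rightarrow> complex" where
  "sqg_form \<psi> u t = infsum (sqg_term (fhat (slice \<psi> t)) (fcoeff (u t))) UNIV"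

text \<open>The constant \<open>B\<close> is the same for all times, so that estimates at a fixed
  time can be integrated.\<close>

lemma conv_weight_slice:
  assumes "\<psi> \<in> spacetime_test"
  obtains B where "0 \<le> B" "\<And>t. \<exists>Bt\<le>B. (conv_weight (fhat (slice \<psi> t)) has_sum Bt) UNIV"
proof -
  obtain C where C: "\<And>t k. weight k ^ Suc 1 * cmod (fhat (slice \<psi> t) k) \<le> C"
    using fhat_slice_decay[OF assms] by blast
  have le: "conv_weight (fhat (slice \<psi> t)) k \<le> (2 * pi)\<^sup>2 * C * (1 / weight k)" for t k
  proof -
    have "weight k * cmod (fhat (slice \<psi> t) k) \<le> C * (1 / weight k)"
      using C[of k t] weight_ge_1[of k] by (simp add: field_simps)
    from mult_left_mono[OF this, of "(2 * pi)\<^sup>2"] show ?thesis by (simp add: conv_weight_def)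
  qed
  have hs: "((\<lambda>k. (2 * pi)\<^sup>2 * C * (1 / weight k)) has_sum ((2 * pi)\<^sup>2 * C * (\<Sum>\<^sub>\<infinity>k. 1 / weight k))) UNIV"
    by (intro has_sum_cmult_right has_sum_infsum summable_on_inverse_weight)
  have sm: "conv_weight (fhat (slice \<psi> t)) summable_on UNIV" for t
    by (rule summable_on_comparison_test[OF has_sum_imp_summable[OF hs] le]) (rule conv_weight_nonneg)
  have "\<exists>Bt\<le>(2 * pi)\<^sup>2 * C * (\<Sum>\<^sub>\<infinity>k. 1 / weight k). (conv_weight (fhat (slice \<psi> t)) has_sum Bt) UNIV" for t
    using has_sum_mono[OF has_sum_infsum[OF sm] hs le] has_sum_infsum[OF sm] by blast
  moreover have "0 \<le> (2 * pi)\<^sup>2 * C * (\<Sum>\<^sub>\<infinity>k. 1 / weight k)"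
    by (rule has_sum_nonneg[OF hs]) (rule order_trans[OF conv_weight_nonneg le])
  ultimately show ?thesis using that by blast
qed

lemma borel_measurable_sqg_term:
  assumes "I \<in> sets lebesgue" "u \<in> L2_sobolev I s" "\<psi> \<in> spacetime_test"
  shows "(\<lambda>t. sqg_term (fhat (slice \<psi> t)) (fcoeff (u t)) i) \<in> borel_measurable (lebesgue_on I)"
proof -
  note m = L2_hseqD(1)[OF L2_sobolevD(2)[OF assms(1,2)]]
  note m' = measurable_compose[OF m borel_measurable_cnj]
    measurable_compose[OF borel_measurable_fhat_slice[OF assms(3)] borel_measurable_cnj]
  show ?thesis
    unfolding sqg_term_def case_prod_beta
    by (intro borel_measurable_times m m' borel_measurable_const)
qed

text \<open>At almost every time the estimates for coefficient sequences apply, with constants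
  independent of time; integration gives the claims. As the form is quadratic, square integrability
  of the norm in time is exactly what makes it integrable.\<close>

lemma sqg_form:
  assumes I: "I \<in> sets lebesgue" and s: "- 1 / 2 \<le> s" and u: "u \<in> L2_sobolev I s" and \<psi>: "\<psi> \<in> spacetime_test"
    and B: "\<And>t. \<exists>Bt\<le>B. (conv_weight (fhat (slice \<psi> t)) has_sum Bt) UNIV"
  shows "integrable (lebesgue_on I) (sqg_form \<psi> u)"
    and "cmod (LINT t|lebesgue_on I. sqg_form \<psi> u t) \<le> B * (LINT t|lebesgue_on I. hnorm2 s (fcoeff (u t)))"
    and "AE t in lebesgue_on I. L2_inner (Lam (- 1/2) (u t)) (Lam (1/2) (riesz_perp_comm (slice \<psi> t) (u t))) = sqg_form \<psi> u t"
    and "\<And>F e. finite F \<Longrightarrow> 0 \<le> e \<Longrightarrow> (\<And>k. k \<notin> F \<Longrightarrow> norm (vec_of k) powr (- 1 / 2) \<le> e * norm (vec_of k) powr s) \<Longrightarrow>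
      (\<And>i. i \<in> F \<times> F \<Longrightarrow> integrable (lebesgue_on I) (\<lambda>t. sqg_term (fhat (slice \<psi> t)) (fcoeff (u t)) i)) \<Longrightarrow>
      cmod ((LINT t|lebesgue_on I. sqg_form \<psi> u t) - (\<Sum>i\<in>F \<times> F. LINT t|lebesgue_on I. sqg_term (fhat (slice \<psi> t)) (fcoeff (u t)) i))
      \<le> e * (B * (LINT t|lebesgue_on I. hnorm2 s (fcoeff (u t))))"
proof -
  let ?h = "\<lambda>t. hnorm2 s (fcoeff (u t))"
  note ae = L2_sobolevD(1)[OF I u]
  have hint: "integrable (lebesgue_on I) ?h" by (rule L2_hseqD(3)[OF L2_sobolevD(2)[OF I u]])
  have trunc: "AE t in lebesgue_on I. cmod (sqg_form \<psi> u t - (\<Sum>i\<in>F \<times> F. sqg_term (fhat (slice \<psi> t)) (fcoeff (u t)) i)) \<le> e * (B * ?h t)"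
    if F: "finite F" "0 \<le> e" "\<And>k. k \<notin> F \<Longrightarrow> norm (vec_of k) powr (- 1 / 2) \<le> e * norm (vec_of k) powr s" for F e
    using ae
  proof eventually_elim
    case (elim t)
    obtain Bt where Bt: "Bt \<le> B" "(conv_weight (fhat (slice \<psi> t)) has_sum Bt) UNIV" using B by blast
    note D = sobolev_spaceD[OF elim]
    have "cmod (sqg_form \<psi> u t - (\<Sum>i\<in>F \<times> F. sqg_term (fhat (slice \<psi> t)) (fcoeff (u t)) i)) \<le> e * (Bt * ?h t)"
      unfolding sqg_form_def by (rule sqg_term_truncation(2)[OF D(2,3) s Bt(2) F(1,3) F(2)])
    also have "\<dots> \<le> e * (B * ?h t)"
      using Bt(1) F(2) by (intro mult_left_mono mult_right_mono hnorm2_nonneg)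
    finally show ?case .
  qed
  have m: "sqg_form \<psi> u \<in> borel_measurable (lebesgue_on I)"
    unfolding sqg_form_def[abs_def]
  proof (rule borel_measurable_infsum[OF I borel_measurable_sqg_term[OF I u \<psi>]])
    show "AE t in lebesgue_on I. sqg_term (fhat (slice \<psi> t)) (fcoeff (u t)) summable_on UNIV"
      using ae
    proof eventually_elim
      case (elim t)
      obtain Bt where "(conv_weight (fhat (slice \<psi> t)) has_sum Bt) UNIV" using B by blast
      then show ?case using sqg_term_summable(1) sobolev_spaceD[OF elim] s by blast
    qed
  qed
  have bd: "AE t in lebesgue_on I. cmod (sqg_form \<psi> u t) \<le> B * ?h t"
    using trunc[of "{}" 1] norm_vec_of_powr_mono[OF s] by simp
  show int: "integrable (lebesgue_on I) (sqg_form \<psi> u)"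
    by (rule Bochner_Integration.integrable_bound[OF integrable_mult_right[OF hint, of B] m])
      (use bd in \<open>auto elim!: eventually_mono\<close>)
  have "cmod (LINT t|lebesgue_on I. sqg_form \<psi> u t) \<le> (LINT t|lebesgue_on I. cmod (sqg_form \<psi> u t))"
    by (rule integral_norm_bound)
  also have "\<dots> \<le> (LINT t|lebesgue_on I. B * ?h t)"
    using int hint bd by (intro integral_mono_AE) auto
  finally show "cmod (LINT t|lebesgue_on I. sqg_form \<psi> u t) \<le> B * (LINT t|lebesgue_on I. ?h t)" by simp
  show "AE t in lebesgue_on I. L2_inner (Lam (- 1/2) (u t)) (Lam (1/2) (riesz_perp_comm (slice \<psi> t) (u t))) = sqg_form \<psi> u t"
    using ae
  proof eventually_elim
    case (elim t)
    obtain Bt where "(conv_weight (fhat (slice \<psi> t)) has_sum Bt) UNIV" using B by blast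
    then show ?case
      unfolding sqg_form_def by (rule L2_inner_nonlinear[OF elim s slice_torus_test[OF \<psi>]])
  qed
  show "cmod ((LINT t|lebesgue_on I. sqg_form \<psi> u t) - (\<Sum>i\<in>F \<times> F. LINT t|lebesgue_on I. sqg_term (fhat (slice \<psi> t)) (fcoeff (u t)) i))
      \<le> e * (B * (LINT t|lebesgue_on I. ?h t))"
    if F: "finite F" "0 \<le> e" "\<And>k. k \<notin> F \<Longrightarrow> norm (vec_of k) powr (- 1 / 2) \<le> e * norm (vec_of k) powr s"
      and ti: "\<And>i. i \<in> F \<times> F \<Longrightarrow> integrable (lebesgue_on I) (\<lambda>t. sqg_term (fhat (slice \<psi> t)) (fcoeff (u t)) i)" for F e
  proof -
    have si: "integrable (lebesgue_on I) (\<lambda>t. \<Sum>i\<in>F \<times> F. sqg_term (fhat (slice \<psi> t)) (fcoeff (u t)) i)"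
      by (rule Bochner_Integration.integrable_sum[OF ti])
    have "(LINT t|lebesgue_on I. sqg_form \<psi> u t) - (\<Sum>i\<in>F \<times> F. LINT t|lebesgue_on I. sqg_term (fhat (slice \<psi> t)) (fcoeff (u t)) i)
        = (LINT t|lebesgue_on I. sqg_form \<psi> u t - (\<Sum>i\<in>F \<times> F. sqg_term (fhat (slice \<psi> t)) (fcoeff (u t)) i))"
      using int si by (simp add: Bochner_Integration.integral_sum[OF ti])
    also have "cmod \<dots> \<le> (LINT t|lebesgue_on I. cmod (sqg_form \<psi> u t - (\<Sum>i\<in>F \<times> F. sqg_term (fhat (slice \<psi> t)) (fcoeff (u t)) i)))"
      by (rule integral_norm_bound)
    also have "\<dots> \<le> (LINT t|lebesgue_on I. e * (B * ?h t))"
      using int si hint trunc[OF F] by (intro integral_mono_AE) auto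
    finally show ?thesis by simp
  qed
qed

text \<open>The passage from distributions to coefficients for the integrals of the weak
  formulation. The first and the third integrands agree with their Fourier forms only at almost
  every time.\<close>

lemma weak_form_eq:
  assumes I: "I \<in> sets lebesgue" and s: "- 1 / 2 \<le> s" and u: "u \<in> L2_sobolev I s" and \<psi>: "\<psi> \<in> spacetime_test"
  shows "(LINT t|lebesgue_on I. u t (slice \<psi> t)) = time_pairing I (distr_symbol \<psi>) u"
    and "(LINT t|lebesgue_on I. L2_inner (Lam (- 1/2) (u t)) (Lam (\<gamma> + 1/2) (distr_of (slice \<psi> t)))) = time_pairing I (dissip_symbol \<gamma> \<psi>) u"
    and "(LINT t|lebesgue_on I. L2_inner (Lam (- 1/2) (u t)) (Lam (1/2) (riesz_perp_comm (slice \<psi> t) (u t)))) = (LINT t|lebesgue_on I. sqg_form \<psi> u t)"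
proof -
  have "AE t in lebesgue_on I. pairing (distr_symbol \<psi> t) (fcoeff (u t)) = u t (slice \<psi> t)"
    using L2_sobolevD(1)[OF I u] by eventually_elim (simp add: distr_slice_eq_pairing \<psi> sobolev_spaceD)
  then show "(LINT t|lebesgue_on I. u t (slice \<psi> t)) = time_pairing I (distr_symbol \<psi>) u"
    unfolding time_pairing_def using time_pairing(1)[OF I L2_hseq_distr_symbol[OF I s \<psi>] u]
    by (intro integral_lebesgue_on_cong_AE[OF I, symmetric]) auto
  show "(LINT t|lebesgue_on I. L2_inner (Lam (- 1/2) (u t)) (Lam (\<gamma> + 1/2) (distr_of (slice \<psi> t)))) = time_pairing I (dissip_symbol \<gamma> \<psi>) u"
    unfolding time_pairing_def L2_inner_dissip[OF \<psi>] by (rule refl)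
  obtain B where B: "\<And>t. \<exists>Bt\<le>B. (conv_weight (fhat (slice \<psi> t)) has_sum Bt) UNIV"
    using conv_weight_slice[OF \<psi>] by blast
  show "(LINT t|lebesgue_on I. L2_inner (Lam (- 1/2) (u t)) (Lam (1/2) (riesz_perp_comm (slice \<psi> t) (u t)))) = (LINT t|lebesgue_on I. sqg_form \<psi> u t)"
    using sqg_form(1)[OF I s u \<psi> B] sqg_form(3)[OF I s u \<psi> B]
    by (intro integral_lebesgue_on_cong_AE[OF I, symmetric]) (auto elim!: eventually_mono)
qed

section \<open>Strong convergence of the low modes\<close>

text \<open>The mode is paired with a symbol living on the single frequency \<open>k\<close> and
  extended by 0 in time, which is a bounded functional on the whole half-line.\<close>

lemma weakly_converges_mode:
  assumes a: "0 < a" and w: "weakly_converges {0<..} s u f"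
    and \<phi>: "\<phi> \<in> borel_measurable (lebesgue_on {a..b})" "integrable (lebesgue_on {a..b}) (\<lambda>t. (cmod (\<phi> t))\<^sup>2)"
  shows "(\<lambda>n. LINT t|lebesgue_on {a..b}. \<phi> t * fcoeff (u n t) k) \<longlonglongrightarrow> (LINT t|lebesgue_on {a..b}. \<phi> t * fcoeff (f t) k)"
proof -
  let ?I = "{0<..} :: real set"
  define \<phi>0 where "\<phi>0 t = (if t \<in> {a..b} then \<phi> t else 0)" for t
  have "\<phi>0 \<in> borel_measurable lebesgue"
    using \<phi>(1) borel_measurable_if[of "{a..b}" \<phi>] by (simp add: \<phi>0_def[abs_def])
  then have m: "\<phi>0 \<in> borel_measurable (lebesgue_on ?I)" by (rule measurable_restrict_space1)
  have "integrable lebesgue (\<lambda>t. indicator {a..b} t *\<^sub>R (cmod (\<phi> t))\<^sup>2)"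
    using \<phi>(2) by (subst (asm) integrable_restrict_space) auto
  moreover have "(\<lambda>t. indicator {a..b} t *\<^sub>R (cmod (\<phi> t))\<^sup>2) = (\<lambda>t. indicator ?I t *\<^sub>R (cmod (\<phi>0 t))\<^sup>2)"
    using a by (auto simp: \<phi>0_def indicator_def fun_eq_iff)
  ultimately have i: "integrable (lebesgue_on ?I) (\<lambda>t. (cmod (\<phi>0 t))\<^sup>2)"
    by (subst integrable_restrict_space) auto
  have "time_pairing ?I (single_mode k \<phi>0) v = (LINT t|lebesgue_on {a..b}. \<phi> t * fcoeff (v t) k)" for v
  proof -
    have "time_pairing ?I (single_mode k \<phi>0) v = (LINT t|lebesgue_on {a..b}. \<phi>0 t * fcoeff (v t) k)"
      unfolding time_pairing_def pairing_single_mode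
      using a by (intro integral_lebesgue_on_support) (auto simp: \<phi>0_def)
    also have "\<dots> = (LINT t|lebesgue_on {a..b}. \<phi> t * fcoeff (v t) k)"
      by (intro Bochner_Integration.integral_cong) (auto simp: \<phi>0_def)
    finally show ?thesis .
  qed
  then show ?thesis
    using weakly_converges_time_pairing[OF _ L2_hseq_single_mode[OF m i, of "- s" k] w] by simp
qed

lemma L2_sobolev_mode:
  assumes I: "I \<in> sets lebesgue" and u: "u \<in> L2_sobolev I s"
  shows "(\<lambda>t. fcoeff (u t) k) \<in> borel_measurable (lebesgue_on I)"
    and "integrable (lebesgue_on I) (\<lambda>t. (cmod (fcoeff (u t) k))\<^sup>2)"
    and "(LINT t|lebesgue_on I. (cmod (fcoeff (u t) k))\<^sup>2) \<le> norm (vec_of k) powr (- 2 * s) * (LINT t|lebesgue_on I. hnorm2 s (fcoeff (u t)))"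
proof -
  note D = L2_hseqD[OF L2_sobolevD(2)[OF I u]]
  show m: "(\<lambda>t. fcoeff (u t) k) \<in> borel_measurable (lebesgue_on I)" by (rule D(1))
  have le: "AE t in lebesgue_on I. (cmod (fcoeff (u t) k))\<^sup>2 \<le> norm (vec_of k) powr (- 2 * s) * hnorm2 s (fcoeff (u t))"
    using D(2) L2_sobolev_fcoeff_0[OF I u]
  proof eventually_elim
    case (elim t)
    show ?case
    proof (cases "k = 0")
      case False
      show ?thesis by (rule norm_le_hnorm2[OF elim(1) False])
    qed (simp add: elim)
  qed
  show i: "integrable (lebesgue_on I) (\<lambda>t. (cmod (fcoeff (u t) k))\<^sup>2)"
    by (rule Bochner_Integration.integrable_bound[OF integrable_mult_right[OF D(3)]])
      (use m le in \<open>auto elim!: eventually_mono intro: order_trans[OF _ abs_ge_self]\<close>)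
  show "(LINT t|lebesgue_on I. (cmod (fcoeff (u t) k))\<^sup>2) \<le> norm (vec_of k) powr (- 2 * s) * (LINT t|lebesgue_on I. hnorm2 s (fcoeff (u t)))"
    using integral_mono_AE[OF i integrable_mult_right[OF D(3)] le] by simp
qed

lemma integral_lebesgue_on_mono_set:
  fixes f :: "'a::euclidean_space \<Rightarrow> real"
  assumes "I \<in> sets lebesgue" "J \<in> sets lebesgue" "J \<subseteq> I" "integrable (lebesgue_on I) f" "\<And>x. 0 \<le> f x"
  shows "(LINT x|lebesgue_on J. f x) \<le> (LINT x|lebesgue_on I. f x)"
proof -
  have "integrable lebesgue (\<lambda>x. indicator I x *\<^sub>R f x)" "integrable lebesgue (\<lambda>x. indicator J x *\<^sub>R f x)"
    using assms(1,2,4) integrable_lebesgue_on_subset[OF assms(1-4)] by (simp_all add: integrable_restrict_space)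
  then have "(LINT x|lebesgue. indicator J x *\<^sub>R f x) \<le> (LINT x|lebesgue. indicator I x *\<^sub>R f x)"
    using assms(3,5) by (intro integral_mono) (auto simp: indicator_def)
  then show ?thesis using assms(1,2) by (simp add: integral_restrict_space)
qed

definition tensor :: "(real \<Rightarrow> real) \<Rightarrow> (plane \<Rightarrow> real) \<Rightarrow> real \<times> plane \<Rightarrow> real" where
  "tensor A \<phi> z = A (fst z) * \<phi> (snd z)"

lemma tensor:
  assumes A: "smooth_fun A" "\<forall>t. t \<notin> {a..b} \<longrightarrow> A t = 0" "0 < a" "a < b" and \<phi>: "smooth_fun \<phi>" "periodic2 \<phi>"
  shows "tensor A \<phi> \<in> spacetime_test" "time_deriv (tensor A \<phi>) = tensor (pderiv_dir 1 A) \<phi>"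
proof -
  have "smooth_fun (tensor A \<phi>)"
    unfolding tensor_def[abs_def]
    by (intro smooth_fun_mult smooth_fun_compose_fst smooth_fun_compose_snd A(1) \<phi>(1))
  then show "tensor A \<phi> \<in> spacetime_test"
    by (rule spacetime_testI[of _ a b]) (use assms in \<open>auto simp: periodic2_def time_supp_def tensor_def\<close>)
  have "pderiv_dir (1, 0) (tensor A \<phi>) z = tensor (pderiv_dir 1 A) \<phi> z" for z
  proof -
    have "((\<lambda>z. A (fst z) * \<phi> (snd z)) has_derivative
        (\<lambda>e. A (fst z) * pderiv_dir (snd e) \<phi> (snd z) + pderiv_dir (fst e) A (fst z) * \<phi> (snd z))) (at z)"
      by (intro has_derivative_mult
          has_derivative_compose[OF has_derivative_fst[OF has_derivative_ident] smooth_fun_has_derivative[OF A(1)]]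
          has_derivative_compose[OF has_derivative_snd[OF has_derivative_ident] smooth_fun_has_derivative[OF \<phi>(1)]])
    from pderiv_dir_eqI[OF this, of "(1, 0)"]
    have "pderiv_dir (1, 0) (tensor A \<phi>) z = A (fst z) * pderiv_dir 0 \<phi> (snd z) + pderiv_dir 1 A (fst z) * \<phi> (snd z)"
      by (simp add: tensor_def[abs_def])
    then show ?thesis by (simp add: tensor_def pderiv_dir_0[OF \<phi>(1)])
  qed
  then show "time_deriv (tensor A \<phi>) = tensor (pderiv_dir 1 A) \<phi>" by (auto simp: time_deriv_def)
qed

lemma slice_tensor: "slice (tensor A \<phi>) t = (\<lambda>x. complex_of_real (A t) * complex_of_real (\<phi> x))"
  by (auto simp: slice_def tensor_def)

text \<open>The test function is \<open>A(t) \<phi>(x)\<close>. Every term of the equation is linear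
  in \<open>A\<close>, and \<open>M\<close> collects what is left once the bound \<open>B\<close> of
  \<open>|A|\<close> has been taken out: the nonlinear term through the integral of
  \<open>hnorm2\<close>, the dissipative one through Cauchy-Schwarz in time on
  \<open>{a..b}\<close>. It depends on the solution only through \<open>Kb\<close>.\<close>

lemma weak_solution_time_derivative_bound:
  assumes par: "0 \<le> \<nu>" "0 < \<gamma>" "\<gamma> \<le> 2" "- 1 / 2 \<le> s" and ab: "0 < a" "a < b"
    and \<phi>: "smooth_fun \<phi>" "periodic2 \<phi>" and Kb: "0 \<le> Kb"
  obtains M where "\<And>u A B. u \<in> L2_sobolev {0<..} s \<Longrightarrow> SQG_weak_solution \<nu> \<gamma> u \<Longrightarrow>
    (LINT t|lebesgue_on {0<..}. hnorm2 s (fcoeff (u t))) \<le> Kb \<Longrightarrow>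
    smooth_fun A \<Longrightarrow> (\<forall>t. t \<notin> {a..b} \<longrightarrow> A t = 0) \<Longrightarrow> (\<forall>t\<in>{a..b}. \<bar>A t\<bar> \<le> B) \<Longrightarrow>
    integrable (lebesgue_on {0<..}) (\<lambda>t. of_real (pderiv_dir 1 A t) * u t (\<lambda>x. of_real (\<phi> x))) \<and>
    cmod (LINT t|lebesgue_on {0<..}. of_real (pderiv_dir 1 A t) * u t (\<lambda>x. of_real (\<phi> x))) \<le> M * B"
proof -
  let ?I = "{0<..} :: real set"
  have I: "?I \<in> sets lebesgue" by simp
  let ?g = "\<lambda>x. complex_of_real (\<phi> x)"
  have g: "?g \<in> torus_test"
    using smooth_fun_linear[OF bounded_linear_of_real \<phi>(1)] \<phi>(2) by (auto simp: torus_test_def periodic2_def)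
  obtain Bg where Bg: "(conv_weight (fhat ?g) has_sum Bg) UNIV"
  proof -
    have "conv_weight (fhat ?g) summable_on UNIV"
      using summable_on_cmult_right[OF summable_on_fhat[OF g, of 1], of "(2 * pi)\<^sup>2"]
      by (simp add: conv_weight_def[abs_def])
    then show ?thesis using that has_sum_infsum by blast
  qed
  have Bg0: "0 \<le> Bg" by (rule has_sum_nonneg[OF Bg conv_weight_nonneg])
  define d where "d k = of_real ((2 * pi)\<^sup>2) * (of_real (lam (- 1/2) k * lam (\<gamma> + 1/2) k) * cnj (fhat ?g k))" for k
  define H where "H = hnorm2 (- s) d"
  define M where "M = 1 / 2 * (Bg * Kb) + \<nu> * (sqrt ((b - a) * H) * sqrt Kb)"
  show ?thesis
  proof (rule that[of M], rule conjI)
    fix u and A :: "real \<Rightarrow> real" and B :: real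
    assume u: "u \<in> L2_sobolev ?I s" and sol: "SQG_weak_solution \<nu> \<gamma> u"
      and uK: "(LINT t|lebesgue_on ?I. hnorm2 s (fcoeff (u t))) \<le> Kb"
      and A1: "smooth_fun A" and A2: "\<forall>t. t \<notin> {a..b} \<longrightarrow> A t = 0" and A3: "\<forall>t\<in>{a..b}. \<bar>A t\<bar> \<le> B"
    have A: "smooth_fun A" "\<And>t. t \<notin> {a..b} \<Longrightarrow> A t = 0" "\<And>t. t \<in> {a..b} \<Longrightarrow> \<bar>A t\<bar> \<le> B"
      using A1 A2 A3 by blast+
    have B0: "0 \<le> B" using A(3)[of a] abs_ge_zero[of "A a"] ab by (simp del: abs_ge_zero)
    have AB: "\<bar>A t\<bar> \<le> B" for t using A(2,3) B0 by (cases "t \<in> {a..b}") auto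
    let ?\<psi> = "tensor A \<phi>"
    note T = tensor[OF A1 A2 ab \<phi>]
    note T' = time_deriv_spacetime_test[OF T(1)]
    let ?C = "distr_symbol (time_deriv ?\<psi>)"
    have ae: "AE t in lebesgue_on ?I. pairing (?C t) (fcoeff (u t)) = of_real (pderiv_dir 1 A t) * u t ?g"
      using L2_sobolevD(1)[OF I u]
    proof eventually_elim
      case (elim t)
      have "pairing (?C t) (fcoeff (u t)) = u t (slice (time_deriv ?\<psi>) t)"
        by (rule distr_slice_eq_pairing[OF sobolev_spaceD(1)[OF elim] T', symmetric])
      then show ?case
        by (simp add: T(2) slice_tensor distribution_cmult[OF sobolev_spaceD(1)[OF elim] g])
    qed
    have pi: "integrable (lebesgue_on ?I) (\<lambda>t. pairing (?C t) (fcoeff (u t)))"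
      by (rule time_pairing(1)[OF I L2_hseq_distr_symbol[OF I par(4) T'] u])
    have m: "(\<lambda>t. of_real (pderiv_dir 1 A t) * u t ?g) \<in> borel_measurable (lebesgue_on ?I)"
      by (rule borel_measurable_lebesgue_on_AE[OF I borel_measurable_integrable[OF pi] ae])
    show "integrable (lebesgue_on ?I) (\<lambda>t. of_real (pderiv_dir 1 A t) * u t ?g)"
      by (rule integrable_cong_AE_imp[OF pi m]) (use ae in \<open>auto elim!: eventually_mono\<close>)
    have eq1: "(LINT t|lebesgue_on ?I. of_real (pderiv_dir 1 A t) * u t ?g) = time_pairing ?I ?C u"
      unfolding time_pairing_def
      by (rule integral_lebesgue_on_cong_AE[OF I borel_measurable_integrable[OF pi] ae, symmetric])
    have weak: "- time_pairing ?I ?C u + 1/2 * (LINT t|lebesgue_on ?I. sqg_form ?\<psi> u t)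
        + complex_of_real \<nu> * time_pairing ?I (dissip_symbol \<gamma> ?\<psi>) u = 0"
      using bspec[OF conjunct2[OF sol[unfolded SQG_weak_solution_def]] T(1)]
      unfolding weak_form_eq[OF I par(4) u T(1)] weak_form_eq(1)[OF I par(4) u T'] .
    have cw: "conv_weight (fhat (slice ?\<psi> t)) = (\<lambda>m. \<bar>A t\<bar> * conv_weight (fhat ?g) m)" for t
      by (auto simp: conv_weight_def slice_tensor fhat_cmult norm_mult)
    have "\<exists>Bt\<le>B * Bg. (conv_weight (fhat (slice ?\<psi> t)) has_sum Bt) UNIV" for t
      unfolding cw using has_sum_cmult_right[OF Bg, of "\<bar>A t\<bar>"] mult_right_mono[OF AB Bg0] by blast
    from sqg_form(2)[OF I par(4) u T(1) this]
    have b2: "cmod (LINT t|lebesgue_on ?I. sqg_form ?\<psi> u t) \<le> B * Bg * Kb"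
      using mult_left_mono[OF uK, of "B * Bg"] B0 Bg0 by simp
    have ds: "dissip_symbol \<gamma> ?\<psi> t = (\<lambda>k. of_real (A t) * d k)" for t
      by (auto simp: dissip_symbol_def d_def slice_tensor fhat_cmult mult_ac)
    have dh: "hnorm2 (- s) (dissip_symbol \<gamma> ?\<psi> t) = (A t)\<^sup>2 * H" for t
      unfolding H_def hnorm2_def infsum_cmult_right'[symmetric] ds
      by (intro infsum_cong) (simp add: wcoeff_def norm_mult power_mult_distrib)
    have H0: "0 \<le> H" unfolding H_def by (rule hnorm2_nonneg)
    have "(LINT t|lebesgue_on ?I. hnorm2 (- s) (dissip_symbol \<gamma> ?\<psi> t)) = (LINT t|lebesgue_on {a..b}. (A t)\<^sup>2 * H)"
      unfolding dh using A(2) ab by (intro integral_lebesgue_on_support) auto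
    also have "\<dots> \<le> (LINT t|lebesgue_on {a..b}. B\<^sup>2 * H)"
    proof (intro integral_mono_AE integrable_lebesgue_on_Icc_const integrable_lebesgue_on_continuous AE_I2)
      show "continuous_on {a..b} (\<lambda>t. (A t)\<^sup>2 * H)" by (intro continuous_intros smooth_fun_continuous_on A(1))
      show "(A t)\<^sup>2 * H \<le> B\<^sup>2 * H" for t
        using power_mono[OF AB abs_ge_zero, of t 2] H0 by (intro mult_right_mono) auto
    qed
    also have "\<dots> = (b - a) * (B\<^sup>2 * H)" by (rule integral_lebesgue_on_Icc_const[OF less_imp_le[OF ab(2)]])
    finally have le: "(LINT t|lebesgue_on ?I. hnorm2 (- s) (dissip_symbol \<gamma> ?\<psi> t)) \<le> B\<^sup>2 * ((b - a) * H)" by (simp add: mult_ac)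
    have "cmod (time_pairing ?I (dissip_symbol \<gamma> ?\<psi>) u) \<le> sqrt (B\<^sup>2 * ((b - a) * H)) * sqrt Kb"
      by (rule order_trans[OF time_pairing(2)[OF I L2_hseq_dissip_symbol[OF I par(4) T(1) par(2,3)] u]])
        (use le uK ab H0 Kb in \<open>auto simp: L2_sobolev_norm_eq[OF I u] hnorm2_nonneg
          intro!: mult_mono Bochner_Integration.integral_nonneg\<close>)
    also have "\<dots> = B * (sqrt ((b - a) * H) * sqrt Kb)" using B0 by (simp add: real_sqrt_mult)
    finally have b3: "cmod (time_pairing ?I (dissip_symbol \<gamma> ?\<psi>) u) \<le> B * (sqrt ((b - a) * H) * sqrt Kb)" .
    have tp: "time_pairing ?I ?C u = 1/2 * (LINT t|lebesgue_on ?I. sqg_form ?\<psi> u t)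
        + complex_of_real \<nu> * time_pairing ?I (dissip_symbol \<gamma> ?\<psi>) u"
    proof -
      have "x = y + z" if "- x + y + z = 0" for x y z :: complex using that by algebra
      from this[OF weak] show ?thesis .
    qed
    have "cmod (time_pairing ?I ?C u) \<le> 1/2 * cmod (LINT t|lebesgue_on ?I. sqg_form ?\<psi> u t)
        + \<nu> * cmod (time_pairing ?I (dissip_symbol \<gamma> ?\<psi>) u)"
      unfolding tp using par(1) by (intro order_trans[OF norm_triangle_ineq]) (simp add: norm_mult)
    also have "\<dots> \<le> 1/2 * (B * Bg * Kb) + \<nu> * (B * (sqrt ((b - a) * H) * sqrt Kb))"
      by (rule add_mono[OF mult_left_mono[OF b2] mult_left_mono[OF b3 par(1)]]) simp
    also have "\<dots> = M * B" by (simp add: M_def algebra_simps)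
    finally show "cmod (LINT t|lebesgue_on ?I. of_real (pderiv_dir 1 A t) * u t ?g) \<le> M * B"
      unfolding eq1 .
  qed
qed

text \<open>Test functions are real while a mode is complex. As \<open>wave (- k)\<close> is the
  cosine minus \<open>\<i>\<close> times the sine, the bounds for these two real profiles
  combine.\<close>

lemma weak_solution_mode_derivative_bound:
  assumes par: "0 \<le> \<nu>" "0 < \<gamma>" "\<gamma> \<le> 2" "- 1 / 2 \<le> s" and ab: "0 < a" "a < b" and Kb: "0 \<le> Kb"
  obtains M where "\<And>u A B. u \<in> L2_sobolev {0<..} s \<Longrightarrow> SQG_weak_solution \<nu> \<gamma> u \<Longrightarrow>
    (LINT t|lebesgue_on {0<..}. hnorm2 s (fcoeff (u t))) \<le> Kb \<Longrightarrow>
    smooth_fun A \<Longrightarrow> (\<forall>t. t \<notin> {a..b} \<longrightarrow> A t = 0) \<Longrightarrow> (\<forall>t\<in>{a..b}. \<bar>A t\<bar> \<le> B) \<Longrightarrow>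
    cmod (LINT t|lebesgue_on {a..b}. of_real (pderiv_dir 1 A t) * fcoeff (u t) k) \<le> M * B"
proof -
  let ?I = "{0<..} :: real set"
  have I: "?I \<in> sets lebesgue" by simp
  have per: "periodic2 (\<lambda>x. Re (wave k x))" "periodic2 (\<lambda>x. Im (wave k x))"
    using periodic2_wave unfolding periodic2_def by simp_all
  have sm: "smooth_fun (\<lambda>x. Re (wave k x))" "smooth_fun (\<lambda>x. Im (wave k x))"
    by (rule smooth_fun_linear[OF bounded_linear_Re smooth_fun_wave] smooth_fun_linear[OF bounded_linear_Im smooth_fun_wave])+
  let ?gc = "\<lambda>x. complex_of_real (Re (wave k x))" and ?gs = "\<lambda>x. complex_of_real (Im (wave k x))"
  have gt: "?gc \<in> torus_test" "?gs \<in> torus_test"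
    using smooth_fun_linear[OF bounded_linear_of_real sm(1)] smooth_fun_linear[OF bounded_linear_of_real sm(2)] per
    by (auto simp: torus_test_def periodic2_def)
  obtain M1 where M1: "\<And>u A B. u \<in> L2_sobolev ?I s \<Longrightarrow> SQG_weak_solution \<nu> \<gamma> u \<Longrightarrow>
    (LINT t|lebesgue_on ?I. hnorm2 s (fcoeff (u t))) \<le> Kb \<Longrightarrow>
    smooth_fun A \<Longrightarrow> (\<forall>t. t \<notin> {a..b} \<longrightarrow> A t = 0) \<Longrightarrow> (\<forall>t\<in>{a..b}. \<bar>A t\<bar> \<le> B) \<Longrightarrow>
    integrable (lebesgue_on ?I) (\<lambda>t. of_real (pderiv_dir 1 A t) * u t ?gc) \<and>
    cmod (LINT t|lebesgue_on ?I. of_real (pderiv_dir 1 A t) * u t ?gc) \<le> M1 * B"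
    using weak_solution_time_derivative_bound[OF par ab sm(1) per(1) Kb] by blast
  obtain M2 where M2: "\<And>u A B. u \<in> L2_sobolev ?I s \<Longrightarrow> SQG_weak_solution \<nu> \<gamma> u \<Longrightarrow>
    (LINT t|lebesgue_on ?I. hnorm2 s (fcoeff (u t))) \<le> Kb \<Longrightarrow>
    smooth_fun A \<Longrightarrow> (\<forall>t. t \<notin> {a..b} \<longrightarrow> A t = 0) \<Longrightarrow> (\<forall>t\<in>{a..b}. \<bar>A t\<bar> \<le> B) \<Longrightarrow>
    integrable (lebesgue_on ?I) (\<lambda>t. of_real (pderiv_dir 1 A t) * u t ?gs) \<and>
    cmod (LINT t|lebesgue_on ?I. of_real (pderiv_dir 1 A t) * u t ?gs) \<le> M2 * B"
    using weak_solution_time_derivative_bound[OF par ab sm(2) per(2) Kb] by blast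
  let ?c = "(2 * pi)\<^sup>2"
  show ?thesis
  proof (rule that[of "(M1 + M2) / ?c"])
    fix u and A :: "real \<Rightarrow> real" and B :: real
    assume as: "u \<in> L2_sobolev ?I s" "SQG_weak_solution \<nu> \<gamma> u"
      "(LINT t|lebesgue_on ?I. hnorm2 s (fcoeff (u t))) \<le> Kb"
      "smooth_fun A" "\<forall>t. t \<notin> {a..b} \<longrightarrow> A t = 0" "\<forall>t\<in>{a..b}. \<bar>A t\<bar> \<le> B"
    note m1 = M1[OF as] and m2 = M2[OF as]
    let ?A = "\<lambda>t. complex_of_real (pderiv_dir 1 A t)"
    let ?X1 = "LINT t|lebesgue_on ?I. ?A t * u t ?gc" and ?X2 = "LINT t|lebesgue_on ?I. ?A t * u t ?gs"
    have ae: "AE t in lebesgue_on ?I. (?A t * u t ?gc + - \<i> * (?A t * u t ?gs)) / of_real ?c = ?A t * fcoeff (u t) k"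
      using L2_sobolevD(1)[OF I as(1)]
    proof eventually_elim
      case (elim t)
      note D = sobolev_spaceD(1)[OF elim]
      have "wave (- k) = (\<lambda>x. ?gc x + - \<i> * ?gs x)"
        by (auto simp: cnj_wave[symmetric] complex_eq_iff)
      then have uw: "u t (wave (- k)) = u t ?gc + - \<i> * u t ?gs"
        using distribution_add[OF D gt(1) torus_test_cmult[OF gt(2)], of "- \<i>"] distribution_cmult[OF D gt(2), of "- \<i>"]
        by simp
      show ?case unfolding fcoeff_def uw by (simp add: algebra_simps)
    qed
    have zero: "pderiv_dir 1 A t = 0" if "t \<notin> {a..b}" for t
      by (rule pderiv_dir_eq_0[of "- {a..b}"]) (use that as(5) in auto)
    have int: "integrable (lebesgue_on ?I) (\<lambda>t. (?A t * u t ?gc + - \<i> * (?A t * u t ?gs)) / of_real ?c)"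
      using m1 m2 by (intro integrable_divide Bochner_Integration.integrable_add integrable_mult_right) auto
    have "(LINT t|lebesgue_on {a..b}. ?A t * fcoeff (u t) k) = (LINT t|lebesgue_on ?I. ?A t * fcoeff (u t) k)"
      using ab zero by (intro integral_lebesgue_on_support[symmetric]) auto
    also have "\<dots> = (LINT t|lebesgue_on ?I. (?A t * u t ?gc + - \<i> * (?A t * u t ?gs)) / of_real ?c)"
      by (rule integral_lebesgue_on_cong_AE[OF I borel_measurable_integrable[OF int] ae, symmetric])
    also have "\<dots> = (?X1 + - \<i> * ?X2) / of_real ?c"
      using m1 m2 by simp
    finally have eq: "(LINT t|lebesgue_on {a..b}. ?A t * fcoeff (u t) k) = (?X1 + - \<i> * ?X2) / of_real ?c" .
    have "cmod (LINT t|lebesgue_on {a..b}. ?A t * fcoeff (u t) k) \<le> (cmod ?X1 + cmod ?X2) / ?c"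
      unfolding eq using norm_triangle_ineq[of ?X1 "- \<i> * ?X2"]
      by (simp add: norm_divide norm_mult norm_power divide_right_mono)
    also have "\<dots> \<le> (M1 * B + M2 * B) / ?c"
      by (rule divide_right_mono[OF add_mono[OF conjunct2[OF m1] conjunct2[OF m2]]]) simp
    also have "\<dots> = (M1 + M2) / ?c * B" by (simp add: distrib_right)
    finally show "cmod (LINT t|lebesgue_on {a..b}. ?A t * fcoeff (u t) k) \<le> (M1 + M2) / ?c * B" .
  qed
qed

section \<open>Passage to the limit in the nonlinear term\<close>

lemma integrable_sqg_term:
  assumes I: "I \<in> sets lebesgue" and s: "- 1 / 2 \<le> s" and u: "u \<in> L2_sobolev I s" and \<psi>: "\<psi> \<in> spacetime_test"
  shows "integrable (lebesgue_on I) (\<lambda>t. sqg_term (fhat (slice \<psi> t)) (fcoeff (u t)) i)"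
proof -
  obtain B where B: "0 \<le> B" "\<And>t. \<exists>Bt\<le>B. (conv_weight (fhat (slice \<psi> t)) has_sum Bt) UNIV"
    using conv_weight_slice[OF \<psi>] by blast
  obtain k j where i: "i = (k, j)" by (rule prod.exhaust)
  show ?thesis
  proof (rule Bochner_Integration.integrable_bound)
    show "integrable (lebesgue_on I) (\<lambda>t. B * hnorm2 s (fcoeff (u t)))"
      using L2_hseqD(3)[OF L2_sobolevD(2)[OF I u]] by simp
    show "(\<lambda>t. sqg_term (fhat (slice \<psi> t)) (fcoeff (u t)) i) \<in> borel_measurable (lebesgue_on I)"
      by (rule borel_measurable_sqg_term[OF I u \<psi>])
    show "AE t in lebesgue_on I. norm (sqg_term (fhat (slice \<psi> t)) (fcoeff (u t)) i) \<le> norm (B * hnorm2 s (fcoeff (u t)))"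
      using L2_sobolevD(1)[OF I u]
    proof eventually_elim
      case (elim t)
      note D = sobolev_spaceD[OF elim]
      obtain Bt where Bt: "Bt \<le> B" "(conv_weight (fhat (slice \<psi> t)) has_sum Bt) UNIV" using B by blast
      have c: "conv_weight (fhat (slice \<psi> t)) (k - j) \<le> B"
        using finite_sum_le_has_sum[OF Bt(2), of "{k - j}"] Bt(1) conv_weight_nonneg by simp
      have h: "(wcoeff s (fcoeff (u t)) l)\<^sup>2 \<le> hnorm2 s (fcoeff (u t))" for l
        using finite_sum_le_has_sum[OF hseq_has_sum[OF D(3)], of "{l}"] by simp
      have "cmod (sqg_term (fhat (slice \<psi> t)) (fcoeff (u t)) (k, j))
          \<le> 1 / 2 * (conv_weight (fhat (slice \<psi> t)) (k - j) * ((wcoeff s (fcoeff (u t)) k)\<^sup>2 + (wcoeff s (fcoeff (u t)) j)\<^sup>2))"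
        using norm_sqg_term_le_hs[of "fcoeff (u t)" s k 1 j "fhat (slice \<psi> t)", OF D(2) s]
          norm_vec_of_powr_mono[OF s] by simp
      also have "\<dots> \<le> 1 / 2 * (B * (hnorm2 s (fcoeff (u t)) + hnorm2 s (fcoeff (u t))))"
        using c h B(1) by (intro mult_left_mono mult_mono add_mono) auto
      finally show ?case using B(1) by (simp add: i hnorm2_nonneg)
    qed
  qed
qed

text \<open>The \<open>j\<close>-th mode is split into that of \<open>f\<close> and a difference
  \<open>D\<close>. The product of the \<open>k\<close>-th mode with the former is linear in
  \<open>u\<close> and converges weakly. In the product with \<open>D\<close>, whose weighted
  primitives tend to 0, the \<open>k\<close>-th mode is the factor with a controlled derivative, and
  \<open>compensated_compactness\<close> applies.\<close>

lemma sqg_term_converges: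
  assumes par: "0 \<le> \<nu>" "0 < \<gamma>" "\<gamma> \<le> 2" "- 1 / 2 \<le> s" and \<psi>: "\<psi> \<in> spacetime_test"
    and sol: "\<And>n. SQG_weak_solution \<nu> \<gamma> (u n)" and w: "weakly_converges {0<..} s u f"
  shows "(\<lambda>n. LINT t|lebesgue_on {0<..}. sqg_term (fhat (slice \<psi> t)) (fcoeff (u n t)) (k, j))
    \<longlonglongrightarrow> (LINT t|lebesgue_on {0<..}. sqg_term (fhat (slice \<psi> t)) (fcoeff (f t)) (k, j))"
proof -
  let ?I = "{0<..} :: real set"
  have I: "?I \<in> sets lebesgue" by simp
  have u: "u n \<in> L2_sobolev ?I s" and f: "f \<in> L2_sobolev ?I s" for n
    using w by (simp_all add: weakly_converges_def)
  obtain K where K: "\<And>n. (LINT t|lebesgue_on ?I. hnorm2 s (fcoeff (u n t))) \<le> K"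
    using weakly_converges_bounded[OF I w] by blast
  have K0: "0 \<le> K"
    using order_trans[OF Bochner_Integration.integral_nonneg K] by (simp add: hnorm2_nonneg)
  obtain \<alpha> \<beta> where ab': "0 < \<alpha>" "\<alpha> < \<beta>" "time_supp \<alpha> \<beta> \<psi>" using \<psi> by (rule spacetime_testE)
  \<comment> \<open>The interval is enlarged on both sides so that \<open>bump a b\<close> is
    positive on the whole time support \<open>{\<alpha>..\<beta>}\<close>; halving keeps
    \<open>a\<close> positive.\<close>
  define a where "a = \<alpha> / 2"
  define b where "b = \<beta> + 1"
  have ab: "0 < a" "a < b" "a < \<alpha>" "\<beta> < b" using ab' by (auto simp: a_def b_def)
  let ?J = "{a..b}"
  have J: "?J \<in> sets lebesgue" "?J \<subseteq> ?I" using ab by auto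
  let ?M = "lebesgue_on ?J"
  have uJ: "u n \<in> L2_sobolev ?J s" and fJ: "f \<in> L2_sobolev ?J s" for n
    using L2_sobolev_mono[OF I J order_refl] u f by auto
  let ?x = "bump a b" and ?x' = "pderiv_dir 1 (bump a b)"
  have x: "continuous_on A ?x" "continuous_on A ?x'" for A
    by (intro smooth_fun_continuous_on smooth_fun_pderiv_dir smooth_fun_bump; simp)+
  define kap where "kap t = of_real ((2 * pi)\<^sup>2 * sqg_kernel k j) * cnj (fhat (slice \<psi> t) (k - j))" for t
  have kap_cont: "continuous_on A kap" for A
    unfolding kap_def by (intro continuous_intros continuous_on_fhat_slice[OF \<psi>])
  have kap_0: "kap t = 0" if "t \<notin> {\<alpha>..\<beta>}" for t
    using fhat_slice_eq_0[OF ab'(3) that] by (simp add: kap_def)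
  \<comment> \<open>The coefficient is factored as bump times \<open>r\<close>. The bump is the
    factor \<open>x\<close> of \<open>compensated_compactness\<close>, vanishing at the ends so that
    its products with polynomials are admissible in time; \<open>r\<close> is absorbed into the
    factor whose primitives tend to 0.\<close>
  define r where "r t = (if t \<in> {\<alpha>..\<beta>} then kap t / of_real (?x t) else 0)" for t
  have xpos: "0 < ?x t" if "t \<in> {\<alpha>..\<beta>}" for t using that ab by (intro bump_pos) auto
  have kap_r: "kap t = of_real (?x t) * r t" for t
    using xpos[of t] kap_0[of t] by (auto simp: r_def)
  have r_meas: "r \<in> borel_measurable (lebesgue_on A)" for A
  proof -
    have "(\<lambda>t. kap t / of_real (?x t)) \<in> borel_measurable (lebesgue_on {\<alpha>..\<beta>})"
    proof (rule borel_measurable_lebesgue_on_continuous, intro continuous_on_divide kap_cont continuous_intros x)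
      show "\<forall>t\<in>{\<alpha>..\<beta>}. complex_of_real (?x t) \<noteq> 0" using xpos by force
    qed
    then have "r \<in> borel_measurable lebesgue"
      using borel_measurable_if[of "{\<alpha>..\<beta>}" "\<lambda>t. kap t / of_real (?x t)"] by (simp add: r_def[abs_def])
    then show ?thesis by (rule measurable_restrict_space1)
  qed
  obtain R where R: "0 \<le> R" "\<And>t. cmod (r t) \<le> R"
  proof -
    have "bounded ((\<lambda>t. kap t / of_real (?x t)) ` {\<alpha>..\<beta>})"
    proof (intro compact_imp_bounded compact_continuous_image continuous_on_divide kap_cont continuous_intros x)
      show "\<forall>t\<in>{\<alpha>..\<beta>}. complex_of_real (?x t) \<noteq> 0" using xpos by force
    qed simp
    then obtain R where R: "\<forall>y\<in>(\<lambda>t. kap t / of_real (?x t)) ` {\<alpha>..\<beta>}. norm y \<le> R" unfolding bounded_iff by blast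
    have "cmod (r t) \<le> max R 0" for t
      using R by (auto simp: r_def le_max_iff_disj)
    then show ?thesis using that[of "max R 0"] by auto
  qed
  define D where "D n t = fcoeff (u n t) j - fcoeff (f t) j" for n t
  note mu = L2_sobolev_mode[OF J(1) uJ] and mf = L2_sobolev_mode[OF J(1) fJ]
  have D_meas: "D n \<in> borel_measurable ?M" for n
    unfolding D_def using mu(1) mf(1) by (intro borel_measurable_diff)
  have KJ: "(LINT t|?M. (cmod (fcoeff (u n t) l))\<^sup>2) \<le> norm (vec_of l) powr (- 2 * s) * K" for n l
  proof -
    have "(LINT t|?M. hnorm2 s (fcoeff (u n t))) \<le> (LINT t|lebesgue_on ?I. hnorm2 s (fcoeff (u n t)))"
      by (rule integral_lebesgue_on_mono_set[OF I J L2_hseqD(3)[OF L2_sobolevD(2)[OF I u]] hnorm2_nonneg])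
    then have "(LINT t|?M. hnorm2 s (fcoeff (u n t))) \<le> K" using K order_trans by blast
    from order_trans[OF mu(3) mult_left_mono[OF this]] show ?thesis by simp
  qed
  have Dle: "(cmod (D n t))\<^sup>2 \<le> 2 * (cmod (fcoeff (u n t) j))\<^sup>2 + 2 * (cmod (fcoeff (f t) j))\<^sup>2" for n t
  proof -
    have "(cmod (D n t))\<^sup>2 \<le> (cmod (fcoeff (u n t) j) + cmod (fcoeff (f t) j))\<^sup>2"
      unfolding D_def by (intro power_mono norm_triangle_ineq4) simp
    also have "\<dots> \<le> 2 * (cmod (fcoeff (u n t) j))\<^sup>2 + 2 * (cmod (fcoeff (f t) j))\<^sup>2"
      using sum_squares_bound[of "cmod (fcoeff (u n t) j)" "cmod (fcoeff (f t) j)"] by (simp add: power2_sum)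
    finally show ?thesis .
  qed
  have Di: "integrable ?M (\<lambda>t. 2 * (cmod (fcoeff (u n t) j))\<^sup>2 + 2 * (cmod (fcoeff (f t) j))\<^sup>2)" for n
    using mu(2) mf(2) by simp
  define W where "W = R\<^sup>2 * (2 * (norm (vec_of j) powr (- 2 * s) * K) + 2 * (LINT t|?M. (cmod (fcoeff (f t) j))\<^sup>2))"
  \<comment> \<open>The factor with small primitives is real in
    \<open>compensated_compactness\<close>; \<open>c = 1\<close> and \<open>c = \<i>\<close> will
    supply the two real components.\<close>
  have part: "(\<lambda>n. LINT t|?M. of_real (?x t * Re (c * (cnj (r t) * D n t))) * fcoeff (u n t) k) \<longlonglongrightarrow> 0
      \<and> (\<forall>n. integrable ?M (\<lambda>t. of_real (?x t * Re (c * (cnj (r t) * D n t))) * fcoeff (u n t) k))"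
    if c: "cmod c = 1" for c
  proof -
    define v where "v n t = Re (c * (cnj (r t) * D n t))" for n t
    have cr_meas: "(\<lambda>t. c * cnj (r t)) \<in> borel_measurable ?M"
      by (intro borel_measurable_times borel_measurable_const measurable_compose[OF r_meas borel_measurable_cnj])
    have cD_meas: "(\<lambda>t. c * (cnj (r t) * D n t)) \<in> borel_measurable ?M" for n
      using borel_measurable_times[OF cr_meas D_meas] by (simp add: mult.assoc)
    have v_meas: "v n \<in> borel_measurable ?M" for n
      unfolding v_def by (rule measurable_compose[OF cD_meas borel_measurable_Re])
    have vle: "(v n t)\<^sup>2 \<le> R\<^sup>2 * (2 * (cmod (fcoeff (u n t) j))\<^sup>2 + 2 * (cmod (fcoeff (f t) j))\<^sup>2)" for n t
    proof -
      have "\<bar>v n t\<bar> \<le> cmod (r t) * cmod (D n t)"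
        using abs_Re_le_cmod[of "c * (cnj (r t) * D n t)"] c by (simp add: v_def norm_mult)
      from power_mono[OF this abs_ge_zero, of 2]
      have "(v n t)\<^sup>2 \<le> (cmod (r t))\<^sup>2 * (cmod (D n t))\<^sup>2" by (simp add: power_mult_distrib)
      also have "\<dots> \<le> R\<^sup>2 * (2 * (cmod (fcoeff (u n t) j))\<^sup>2 + 2 * (cmod (fcoeff (f t) j))\<^sup>2)"
        by (intro mult_mono power_mono R(2) Dle) auto
      finally show ?thesis .
    qed
    have v_int: "integrable ?M (\<lambda>t. (v n t)\<^sup>2)" for n
    proof (rule Bochner_Integration.integrable_bound[OF integrable_mult_right[OF Di[of n], of "R\<^sup>2"]])
      show "(\<lambda>t. (v n t)\<^sup>2) \<in> borel_measurable ?M" using v_meas by measurable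
      show "AE t in ?M. norm ((v n t)\<^sup>2) \<le> norm (R\<^sup>2 * (2 * (cmod (fcoeff (u n t) j))\<^sup>2 + 2 * (cmod (fcoeff (f t) j))\<^sup>2))"
        using vle by (intro AE_I2) auto
    qed
    have v_W: "(LINT t|?M. (v n t)\<^sup>2) \<le> W" for n
    proof -
      have "(LINT t|?M. (v n t)\<^sup>2) \<le> (LINT t|?M. R\<^sup>2 * (2 * (cmod (fcoeff (u n t) j))\<^sup>2 + 2 * (cmod (fcoeff (f t) j))\<^sup>2))"
        by (rule integral_mono[OF v_int integrable_mult_right[OF Di] vle])
      also have "\<dots> = R\<^sup>2 * (2 * (LINT t|?M. (cmod (fcoeff (u n t) j))\<^sup>2) + 2 * (LINT t|?M. (cmod (fcoeff (f t) j))\<^sup>2))"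
        using mu(2) mf(2) by simp
      also have "\<dots> \<le> W"
        unfolding W_def using KJ[of n j] by (intro mult_left_mono add_right_mono) auto
      finally show ?thesis .
    qed
    obtain Md where Md: "\<And>u A B. u \<in> L2_sobolev ?I s \<Longrightarrow> SQG_weak_solution \<nu> \<gamma> u \<Longrightarrow>
      (LINT t|lebesgue_on ?I. hnorm2 s (fcoeff (u t))) \<le> K \<Longrightarrow>
      smooth_fun A \<Longrightarrow> (\<forall>t. t \<notin> ?J \<longrightarrow> A t = 0) \<Longrightarrow> (\<forall>t\<in>?J. \<bar>A t\<bar> \<le> B) \<Longrightarrow>
      cmod (LINT t|?M. of_real (pderiv_dir 1 A t) * fcoeff (u t) k) \<le> Md * B"
      using weak_solution_mode_derivative_bound[OF par ab(1,2) K0, of k] by blast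
    have "(\<lambda>n. LINT t|?M. of_real (?x t * v n t) * fcoeff (u n t) k) \<longlonglongrightarrow> 0"
    proof (rule compensated_compactness[OF ab(2) x mu(1) mu(2) KJ v_meas v_int v_W])
      fix n p B assume B: "\<And>t. t \<in> ?J \<Longrightarrow> \<bar>?x t * poly p t\<bar> \<le> B"
      have e: "pderiv_dir 1 (\<lambda>t. ?x t * poly p t) t = ?x' t * poly p t + ?x t * poly (pderiv p) t" for t
        by (subst pderiv_dir_mult)
          (simp_all add: smooth_fun_differentiable smooth_fun_bump smooth_fun_poly pderiv_dir_real[OF poly_DERIV])
      have "smooth_fun (\<lambda>t. ?x t * poly p t)"
        by (rule smooth_fun_mult[OF smooth_fun_bump smooth_fun_poly])
      from Md[OF u[of n] sol[of n] K[of n] this, of B] B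
      show "cmod (LINT t|?M. of_real (?x' t * poly p t + ?x t * poly (pderiv p) t) * fcoeff (u n t) k) \<le> Md * B"
        unfolding e by (simp add: bump_eq_0)
    next
      fix t assume t: "t \<in> ?J"
      \<comment> \<open>The primitive of \<open>v n\<close> at \<open>t\<close> is the real part of
        the \<open>j\<close>-th mode of \<open>u n - f\<close> integrated against this function, so
        it tends to 0 by weak convergence.\<close>
      define \<phi> where "\<phi> q = indicator {a..t} q *\<^sub>R (c * cnj (r q))" for q
      have "{a..t} \<in> sets ?M" using t by (simp add: sets_restrict_space_iff)
      then have \<phi>m: "\<phi> \<in> borel_measurable ?M"
        unfolding \<phi>_def by (intro borel_measurable_scaleR cr_meas borel_measurable_indicator)
      have \<phi>i: "integrable ?M (\<lambda>q. (cmod (\<phi> q))\<^sup>2)"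
      proof (rule integrable_lebesgue_on_bounded)
        show "(\<lambda>q. (cmod (\<phi> q))\<^sup>2) \<in> borel_measurable ?M" using \<phi>m by measurable
        show "norm ((cmod (\<phi> q))\<^sup>2) \<le> R\<^sup>2" for q
          using R power_mono[OF R(2) norm_ge_zero, of q 2] c by (simp add: \<phi>_def norm_mult indicator_def)
      qed
      have iu: "integrable ?M (\<lambda>q. \<phi> q * fcoeff (u n q) j)" "integrable ?M (\<lambda>q. \<phi> q * fcoeff (f q) j)" for n
        by (rule Cauchy_Schwarz_integral(1)[OF \<phi>m \<phi>i mu(1) mu(2)] Cauchy_Schwarz_integral(1)[OF \<phi>m \<phi>i mf(1) mf(2)])+
      have "(LINT q|?M. indicator {a..t} q * v n q) = Re ((LINT q|?M. \<phi> q * fcoeff (u n q) j) - (LINT q|?M. \<phi> q * fcoeff (f q) j))" for n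
      proof -
        have i: "integrable ?M (\<lambda>q. \<phi> q * D n q)"
          using Bochner_Integration.integrable_diff[OF iu] by (simp add: D_def right_diff_distrib)
        have "(LINT q|?M. indicator {a..t} q * v n q) = (LINT q|?M. Re (\<phi> q * D n q))"
          by (intro Bochner_Integration.integral_cong) (simp_all add: \<phi>_def v_def mult.assoc)
        also have "\<dots> = Re (LINT q|?M. \<phi> q * D n q)" by (rule integral_Re[OF i])
        also have "(LINT q|?M. \<phi> q * D n q) = (LINT q|?M. \<phi> q * fcoeff (u n q) j) - (LINT q|?M. \<phi> q * fcoeff (f q) j)"
          using Bochner_Integration.integral_diff[OF iu] by (simp add: D_def right_diff_distrib)
        finally show ?thesis .
      qed
      moreover have "(\<lambda>n. Re ((LINT q|?M. \<phi> q * fcoeff (u n q) j) - (LINT q|?M. \<phi> q * fcoeff (f q) j)))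
          \<longlonglongrightarrow> Re ((LINT q|?M. \<phi> q * fcoeff (f q) j) - (LINT q|?M. \<phi> q * fcoeff (f q) j))"
        by (intro tendsto_intros weakly_converges_mode[OF ab(1) w \<phi>m \<phi>i])
      ultimately show "(\<lambda>n. LINT q|?M. indicator {a..t} q * v n q) \<longlonglongrightarrow> 0" by simp
    qed
    moreover have "integrable ?M (\<lambda>t. of_real (?x t * v n t) * fcoeff (u n t) k)" for n
    proof (rule Cauchy_Schwarz_integral(1)[OF _ _ mu(1) mu(2)])
      have xm: "?x \<in> borel_measurable ?M" by (rule borel_measurable_lebesgue_on_continuous[OF x(1)])
      show "(\<lambda>t. complex_of_real (?x t * v n t)) \<in> borel_measurable ?M" using xm v_meas by measurable
      have "bounded (?x ` ?J)" by (intro compact_imp_bounded compact_continuous_image x) simp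
      then obtain X where X: "\<forall>y\<in>?x ` ?J. norm y \<le> X" unfolding bounded_iff by blast
      show "integrable ?M (\<lambda>t. (cmod (complex_of_real (?x t * v n t)))\<^sup>2)"
      proof (rule Bochner_Integration.integrable_bound[OF integrable_mult_right[OF v_int[of n], of "X\<^sup>2"]])
        show "(\<lambda>t. (cmod (complex_of_real (?x t * v n t)))\<^sup>2) \<in> borel_measurable ?M" using xm v_meas by measurable
        show "AE t in ?M. norm ((cmod (complex_of_real (?x t * v n t)))\<^sup>2) \<le> norm (X\<^sup>2 * (v n t)\<^sup>2)"
        proof (rule AE_I2)
          fix t assume "t \<in> space ?M"
          then have "\<bar>?x t\<bar> \<le> X" using X by simp
          from power_mono[OF this abs_ge_zero, of 2]
          show "norm ((cmod (complex_of_real (?x t * v n t)))\<^sup>2) \<le> norm (X\<^sup>2 * (v n t)\<^sup>2)"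
            by (simp add: norm_mult power_mult_distrib mult_right_mono)
        qed
      qed
    qed
    ultimately show ?thesis by (simp add: v_def)
  qed
  define \<phi> where "\<phi> t = kap t * cnj (fcoeff (f t) j)" for t
  have kapm: "kap \<in> borel_measurable ?M" by (rule borel_measurable_lebesgue_on_continuous[OF kap_cont])
  have \<phi>m: "\<phi> \<in> borel_measurable ?M"
    unfolding \<phi>_def by (intro borel_measurable_times kapm measurable_compose[OF mf(1) borel_measurable_cnj])
  have \<phi>i: "integrable ?M (\<lambda>t. (cmod (\<phi> t))\<^sup>2)"
  proof -
    have "bounded (kap ` ?J)" by (intro compact_imp_bounded compact_continuous_image kap_cont) simp
    then obtain X where X: "\<forall>y\<in>kap ` ?J. norm y \<le> X" unfolding bounded_iff by blast
    show ?thesis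
    proof (rule Bochner_Integration.integrable_bound[OF integrable_mult_right[OF mf(2), of "X\<^sup>2"]])
      show "(\<lambda>t. (cmod (\<phi> t))\<^sup>2) \<in> borel_measurable ?M" using \<phi>m by measurable
      show "AE t in ?M. norm ((cmod (\<phi> t))\<^sup>2) \<le> norm (X\<^sup>2 * (cmod (fcoeff (f t) j))\<^sup>2)"
      proof (rule AE_I2)
        fix t assume "t \<in> space ?M"
        then have "cmod (kap t) \<le> X" using X by simp
        from power_mono[OF this norm_ge_zero, of 2]
        show "norm ((cmod (\<phi> t))\<^sup>2) \<le> norm (X\<^sup>2 * (cmod (fcoeff (f t) j))\<^sup>2)"
          by (simp add: \<phi>_def norm_mult power_mult_distrib mult_right_mono)
      qed
    qed
  qed
  let ?P1 = "\<lambda>n t. of_real (?x t * Re (1 * (cnj (r t) * D n t))) * fcoeff (u n t) k"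
  let ?P2 = "\<lambda>n t. of_real (?x t * Re (\<i> * (cnj (r t) * D n t))) * fcoeff (u n t) k"
  have p1: "(\<lambda>n. LINT t|?M. ?P1 n t) \<longlonglongrightarrow> 0" "integrable ?M (?P1 n)" for n
    using part[of 1] by simp_all
  have p2: "(\<lambda>n. LINT t|?M. ?P2 n t) \<longlonglongrightarrow> 0" "integrable ?M (?P2 n)" for n
    using part[of \<i>] by simp_all
  have supp: "(LINT t|lebesgue_on ?I. sqg_term (fhat (slice \<psi> t)) (fcoeff (v t)) (k, j))
      = (LINT t|?M. kap t * (fcoeff (v t) k * cnj (fcoeff (v t) j)))" for v
  proof -
    have "(LINT t|lebesgue_on ?I. sqg_term (fhat (slice \<psi> t)) (fcoeff (v t)) (k, j))
        = (LINT t|lebesgue_on ?I. kap t * (fcoeff (v t) k * cnj (fcoeff (v t) j)))"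
      by (simp add: sqg_term_def kap_def)
    also have "\<dots> = (LINT t|?M. kap t * (fcoeff (v t) k * cnj (fcoeff (v t) j)))"
      using J ab kap_0 by (intro integral_lebesgue_on_support) auto
    finally show ?thesis .
  qed
  have split: "(LINT t|?M. kap t * (fcoeff (u n t) k * cnj (fcoeff (u n t) j)))
      = (LINT t|?M. ?P1 n t) + \<i> * (LINT t|?M. ?P2 n t) + (LINT t|?M. \<phi> t * fcoeff (u n t) k)" for n
  proof -
    \<comment> \<open>Both components are written as real parts of multiples of the conjugate, to
      match the form of \<open>part\<close>.\<close>
    have z: "of_real (Re (1 * cnj z)) + \<i> * of_real (Re (\<i> * cnj z)) = z" for z
      by (simp add: complex_eq_iff)
    have "kap t * (fcoeff (u n t) k * cnj (fcoeff (u n t) j)) = ?P1 n t + \<i> * ?P2 n t + \<phi> t * fcoeff (u n t) k" for t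
    proof -
      have "?P1 n t + \<i> * ?P2 n t = of_real (?x t) * fcoeff (u n t) k
          * (of_real (Re (1 * cnj (r t * cnj (D n t)))) + \<i> * of_real (Re (\<i> * cnj (r t * cnj (D n t)))))"
        by (simp add: algebra_simps)
      also have "\<dots> = of_real (?x t) * fcoeff (u n t) k * (r t * cnj (D n t))" unfolding z ..
      also have "\<dots> = kap t * fcoeff (u n t) k * cnj (D n t)" by (simp add: kap_r mult_ac)
      finally show ?thesis by (simp add: \<phi>_def D_def algebra_simps)
    qed
    then have "(LINT t|?M. kap t * (fcoeff (u n t) k * cnj (fcoeff (u n t) j)))
        = (LINT t|?M. ?P1 n t + \<i> * ?P2 n t + \<phi> t * fcoeff (u n t) k)" by simp
    also have "\<dots> = (LINT t|?M. ?P1 n t + \<i> * ?P2 n t) + (LINT t|?M. \<phi> t * fcoeff (u n t) k)"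
      by (rule Bochner_Integration.integral_add[OF Bochner_Integration.integrable_add[OF p1(2) integrable_mult_right[OF p2(2)]]
            Cauchy_Schwarz_integral(1)[OF \<phi>m \<phi>i mu(1) mu(2)]])
    also have "(LINT t|?M. ?P1 n t + \<i> * ?P2 n t) = (LINT t|?M. ?P1 n t) + (LINT t|?M. \<i> * ?P2 n t)"
      by (rule Bochner_Integration.integral_add[OF p1(2) integrable_mult_right[OF p2(2)]])
    also have "(LINT t|?M. \<i> * ?P2 n t) = \<i> * (LINT t|?M. ?P2 n t)"
      by (rule integral_mult_right_zero)
    finally show ?thesis .
  qed
  have "(\<lambda>n. (LINT t|?M. ?P1 n t) + \<i> * (LINT t|?M. ?P2 n t) + (LINT t|?M. \<phi> t * fcoeff (u n t) k))
      \<longlonglongrightarrow> 0 + \<i> * 0 + (LINT t|?M. \<phi> t * fcoeff (f t) k)"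
    by (intro tendsto_add tendsto_mult tendsto_const p1(1) p2(1) weakly_converges_mode[OF ab(1) w \<phi>m \<phi>i])
  moreover have "(LINT t|?M. \<phi> t * fcoeff (f t) k) = (LINT t|?M. kap t * (fcoeff (f t) k * cnj (fcoeff (f t) j)))"
    by (simp add: \<phi>_def mult_ac)
  ultimately show ?thesis
    unfolding supp split by simp
qed

text \<open>Uniform truncation reduces the double series to finitely many terms with known limits.
  Including the norm of \<open>f\<close> in \<open>L\<close> lets one set \<open>F\<close> truncate
  the sequence and its limit alike.\<close>

lemma sqg_form_converges:
  assumes par: "0 \<le> \<nu>" "0 < \<gamma>" "\<gamma> \<le> 2" "- 1 / 2 < s" and \<psi>: "\<psi> \<in> spacetime_test"
    and sol: "\<And>n. SQG_weak_solution \<nu> \<gamma> (u n)" and w: "weakly_converges {0<..} s u f"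
  shows "(\<lambda>n. LINT t|lebesgue_on {0<..}. sqg_form \<psi> (u n) t) \<longlonglongrightarrow> (LINT t|lebesgue_on {0<..}. sqg_form \<psi> f t)"
proof (rule tendstoI)
  fix e :: real assume e: "0 < e"
  let ?I = "{0<..} :: real set"
  have I: "?I \<in> sets lebesgue" by simp
  have s: "- 1 / 2 \<le> s" using par(4) by simp
  have u: "u n \<in> L2_sobolev ?I s" and f: "f \<in> L2_sobolev ?I s" for n
    using w by (simp_all add: weakly_converges_def)
  obtain K where K: "\<And>n. (LINT t|lebesgue_on ?I. hnorm2 s (fcoeff (u n t))) \<le> K"
    using weakly_converges_bounded[OF I w] by blast
  define L where "L = max K (LINT t|lebesgue_on ?I. hnorm2 s (fcoeff (f t)))"
  have L: "(LINT t|lebesgue_on ?I. hnorm2 s (fcoeff (u n t))) \<le> L" "(LINT t|lebesgue_on ?I. hnorm2 s (fcoeff (f t))) \<le> L" for n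
    using K[of n] by (simp_all add: L_def)
  have L0: "0 \<le> L"
    using order_trans[OF Bochner_Integration.integral_nonneg L(2)] by (simp add: hnorm2_nonneg)
  obtain B where B: "0 \<le> B" "\<And>t. \<exists>Bt\<le>B. (conv_weight (fhat (slice \<psi> t)) has_sum Bt) UNIV"
    using conv_weight_slice[OF \<psi>] by blast
  \<comment> \<open>The truncation error is at most \<open>d * (B * L)\<close>; the
    \<open>+ 1\<close> keeps the denominator positive when \<open>B * L = 0\<close>.\<close>
  define d where "d = e / (4 * (B * L + 1))"
  have BL: "0 \<le> B * L" using B L0 by simp
  have d: "0 < d" using e BL by (simp add: d_def)
  have dB: "d * (B * L) < e / 3"
  proof -
    have "d * (B * L) \<le> d * (B * L + 1)" using d by simp
    also have "\<dots> = e / 4" using BL by (simp add: d_def field_simps)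
    also have "\<dots> < e / 3" using e by simp
    finally show ?thesis .
  qed
  obtain F where F: "finite F" "\<And>k. k \<notin> F \<Longrightarrow> norm (vec_of k) powr (- 1 / 2) \<le> d * norm (vec_of k) powr s"
    using freq_truncation[OF par(4) d] by blast
  let ?S = "\<lambda>v. \<Sum>i\<in>F \<times> F. LINT t|lebesgue_on ?I. sqg_term (fhat (slice \<psi> t)) (fcoeff (v t)) i"
  have tail: "cmod ((LINT t|lebesgue_on ?I. sqg_form \<psi> v t) - ?S v) < e / 3"
    if v: "v \<in> L2_sobolev ?I s" "(LINT t|lebesgue_on ?I. hnorm2 s (fcoeff (v t))) \<le> L" for v
  proof -
    have "cmod ((LINT t|lebesgue_on ?I. sqg_form \<psi> v t) - ?S v) \<le> d * (B * (LINT t|lebesgue_on ?I. hnorm2 s (fcoeff (v t))))"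
      using d by (intro sqg_form(4)[OF I s v(1) \<psi> B(2) F(1) _ F(2)] integrable_sqg_term[OF I s v(1) \<psi>]) auto
    also have "\<dots> \<le> d * (B * L)" using d B(1) v(2) by (intro mult_left_mono) auto
    finally show ?thesis using dB by linarith
  qed
  have "(\<lambda>n. ?S (u n)) \<longlonglongrightarrow> ?S f"
  proof (rule tendsto_sum)
    fix i assume "i \<in> F \<times> F"
    obtain k j where "i = (k, j)" by (rule prod.exhaust)
    then show "(\<lambda>n. LINT t|lebesgue_on ?I. sqg_term (fhat (slice \<psi> t)) (fcoeff (u n t)) i)
        \<longlonglongrightarrow> (LINT t|lebesgue_on ?I. sqg_term (fhat (slice \<psi> t)) (fcoeff (f t)) i)"
      using sqg_term_converges[OF par(1-3) s \<psi> sol w] by simp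
  qed
  then have "\<forall>\<^sub>F n in sequentially. dist (?S (u n)) (?S f) < e / 3"
    using e by (intro tendstoD) auto
  then show "\<forall>\<^sub>F n in sequentially. dist (LINT t|lebesgue_on ?I. sqg_form \<psi> (u n) t) (LINT t|lebesgue_on ?I. sqg_form \<psi> f t) < e"
  proof eventually_elim
    case (elim n)
    have "dist (LINT t|lebesgue_on ?I. sqg_form \<psi> (u n) t) (?S (u n)) < e / 3"
      "dist (LINT t|lebesgue_on ?I. sqg_form \<psi> f t) (?S f) < e / 3"
      using tail[OF u L(1)] tail[OF f L(2)] by (simp_all add: dist_norm)
    then show ?case
      using elim dist_triangle[of "LINT t|lebesgue_on ?I. sqg_form \<psi> (u n) t" "LINT t|lebesgue_on ?I. sqg_form \<psi> f t" "?S (u n)"]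
        dist_triangle[of "?S (u n)" "LINT t|lebesgue_on ?I. sqg_form \<psi> f t" "?S f"]
        dist_commute[of "?S f" "LINT t|lebesgue_on ?I. sqg_form \<psi> f t"]
      by linarith
  qed
qed

theorem theorem1p6:
  fixes \<nu> \<gamma> s :: real
    and \<theta> :: "nat \<Rightarrow> real \<Rightarrow> distr"
    and f :: "real \<Rightarrow> distr"
  assumes "\<nu> \<ge> 0" and "0 < \<gamma>" and "\<gamma> \<le> 2" and "s > - 1/2"
    and "\<And>n. SQG_weak_solution \<nu> \<gamma> (\<theta> n)"
    and "\<And>n. \<theta> n \<in> L2_sobolev {0<..} s"
    and "weakly_converges {0<..} s \<theta> f"
  shows "SQG_weak_solution \<nu> \<gamma> f"
  unfolding SQG_weak_solution_def
proof (intro conjI ballI)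
  let ?I = "{0<..} :: real set"
  have I: "?I \<in> sets lebesgue" by simp
  have s: "- 1 / 2 \<le> s" using assms(4) by simp
  have f: "f \<in> L2_sobolev ?I s" using assms(7) by (simp add: weakly_converges_def)
  show "f \<in> L2_loc_sobolev (- 1/2)"
    unfolding L2_loc_sobolev_def by (intro CollectI allI impI L2_sobolev_mono[OF I _ _ s f]) auto
  fix \<psi> assume \<psi>: "\<psi> \<in> spacetime_test"
  note \<psi>' = time_deriv_spacetime_test[OF \<psi>]
  \<comment> \<open>The left-hand side of the weak formulation, written on coefficients. It vanishes
    along the sequence and converges along it to its value at \<open>f\<close>.\<close>
  define E where "E u = - time_pairing ?I (distr_symbol (time_deriv \<psi>)) u
      + 1/2 * (LINT t|lebesgue_on ?I. sqg_form \<psi> u t)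
      + complex_of_real \<nu> * time_pairing ?I (dissip_symbol \<gamma> \<psi>) u" for u
  have "E (\<theta> n) = 0" for n
    using bspec[OF conjunct2[OF assms(5)[of n, unfolded SQG_weak_solution_def]] \<psi>]
    unfolding weak_form_eq[OF I s assms(6) \<psi>] weak_form_eq(1)[OF I s assms(6) \<psi>'] E_def .
  moreover have "(\<lambda>n. E (\<theta> n)) \<longlonglongrightarrow> E f"
    unfolding E_def
    by (intro tendsto_intros weakly_converges_time_pairing[OF I L2_hseq_distr_symbol[OF I s \<psi>'] assms(7)]
        weakly_converges_time_pairing[OF I L2_hseq_dissip_symbol[OF I s \<psi> assms(2,3)] assms(7)]
        sqg_form_converges[OF assms(1-4) \<psi> assms(5,7)])
  ultimately have "E f = 0" by (simp add: LIMSEQ_const_iff)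
  then show "- (LINT t|lebesgue_on {0<..}. f t (slice (time_deriv \<psi>) t))
        + 1/2 * (LINT t|lebesgue_on {0<..}.
            L2_inner (Lam (- 1/2) (f t)) (Lam (1/2) (riesz_perp_comm (slice \<psi> t) (f t))))
        + complex_of_real \<nu> * (LINT t|lebesgue_on {0<..}.
            L2_inner (Lam (- 1/2) (f t)) (Lam (\<gamma> + 1/2) (distr_of (slice \<psi> t))))
        = 0"
    unfolding weak_form_eq[OF I s f \<psi>] weak_form_eq(1)[OF I s f \<psi>'] E_def .
qed

end
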